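(* Let $M$ be a time-like surface in the space-time $\mathbb L^3_1(c)\,{}_f\times I$ such that $T=\left(\frac{\partial}{\partial z}\right)^T$ is light-like. Then $M$ is a class $\mathcal A$ surface if and only if every $p\in M$ has a neighborhood $\mathcal N_p$ in $M$ given by one of the following five cases: (i) $\mathcal N_p$ is congruent to a surface generated by a null scroll, i.e. a surface parametrized by $$\phi(u,v)=\left(\alpha(U(u))+V(u,v)B(U(u)),\,u\right),$$ where $\alpha$ is a light-like curve in $\mathbb L^3_1(c)$ with Cartan frame $\{A,B;C\}$ and associated smooth functions $a,b$ (see context), and $U=U(u)$, $V=V(u,v)$ are smooth non-vanishing functions satisfying $$U'V^2\left(b(U)^2+c\right)-2V_u=-\frac{1}{f(u)^2U'};$$ (ii) $c=1$ and $\mathcal N_p$ is congruent to a surface parametrized by $$\phi(u,v)=\left(\tfrac{r}{A},\ r\left(\tfrac{\cos a}{A}-\sin a\right),\ r\left(\tfrac{\sin a}{A}+\cos a\right),\ \sqrt{1-r^2},\ u\right),$$ where $0<r<1$ is a constant and $A=A(u,v)$, $a=a(u)$ are smooth non-vanishing functions satisfying $A_u=-\frac{A^2}{2r^2f(u)^2a'}-\frac12a'(A^2+1)$; (iii) $c=-1$ and $\mathcal N_p$ is congruent to a surface parametrized by $$\phi(u,v)=\left(r\left(\tfrac{\cos a}{A}-\sin a\right),\ r\left(\tfrac{\sin a}{A}+\cos a\right),\ \tfrac{r}{A},\ \sqrt{r^2-1},\ u\right),$$ where $r>1$ is a constant and $A=A(u,v)$, $a=a(u)$ are smooth non-vanishing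 functions satisfying $A_u=\frac{A^2}{2r^2f(u)^2a'}-\frac12a'(A^2+1)$; (iv) $c=-1$ and $\mathcal N_p$ is congruent to a surface parametrized by $$\begin{aligned}\phi(u,v)=\Big(&\tfrac{2c_1^2F(u)+2c_2c_1+F(u)-2v}{2\sqrt2c_1},\ -\tfrac{a(c_1F(u)+c_2)(2v-F(u))}{c_1}-a-\tfrac1{4a},\\ &-\tfrac{a(c_1F(u)+c_2)(2v-F(u))}{c_1}-a+\tfrac1{4a},\ \tfrac{(2c_1^2-1)F(u)+2(c_1c_2+v)}{2\sqrt2c_1},\ u\Big),\end{aligned}$$ where $a,c_1,c_2$ are constants with $a\neq0$, $c_1\neq0$; (v) $c=0$ and $\mathcal N_p$ is congruent to a surface parametrized by $$\phi(u,v)=\left(\tfrac{r}{A},\ r\left(\tfrac{\cos a}{A}-\sin a\right),\ r\left(\tfrac{\sin a}{A}+\cos a\right),\ u\right),$$ where $r>0$ is a constant and $A=A(u,v)$, $a=a(u)$ are smooth non-vanishing functions satisfying $A_u=-\frac{A^2}{2r^2f(u)^2a'}-\frac12a'(A^2+1)$.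
   Context: Let $c\in\{-1,0,1\}$. $\mathbb L^3_1(c)$ denotes the 3-dimensional Lorentzian space form with metric $g_c$ of constant curvature $c$: for $c=1$, $\mathbb S^3_1=\{x\in\mathbb R^4:-x_1^2+x_2^2+x_3^2+x_4^2=1\}$; for $c=0$, $\mathbb E^3_1=\mathbb R^3$ with $-dx_1^2+dx_2^2+dx_3^2$; for $c=-1$, $\mathbb H^3_1=\{x\in\mathbb R^4:-x_1^2-x_2^2+x_3^2+x_4^2=-1\}$, with the metrics induced from the corresponding semi-Euclidean spaces. Let $I$ be an open interval with coordinate $z$, $f:I\to(0,\infty)$ smooth, and let $\mathbb L^3_1(c)\,{}_f\times I$ be $\mathbb L^3_1(c)\times I$ with the metric $\widetilde g=\langle\cdot,\cdot\rangle=f(z)^2g_c+dz^2$. Points are written (point of $\mathbb L^3_1(c)$, $z$). $F(z)=\int_{z_0}^z\frac{d\xi}{f(\xi)}$ for a fixed $z_0\in I$. For a time-like surface $M$ (induced metric Lorentzian), write $\frac{\partial}{\partial z}\big|_M=T+\eta$ with $T=\left(\frac{\partial}{\partial z}\right)^T$ tangent and $\eta$ normal to $M$. $T$ is light-like if $T\ne0$ and $\langle T,T\rangle=0$ at every point. Standing assumptions: $T$ and $\eta$ vanish nowhere, and no open subset of $M$ lies in a totally geodesic hypersurface of the ambient space. $M$ is of class $\mathcal A$ if at each point $T$ is an eigenvector of the shape operator $A_\xi$ for every normal vector $\xi$. Cartan frame: $\alpha$ is a light-like curve in $\mathbb L^3_1(c)$ with vector fields $A,B,C$ along it satisfying $\langle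 A,B\rangle=-1$, $\langle C,C\rangle=1$, $\langle A,A\rangle=\langle B,B\rangle=\langle C,A\rangle=\langle C,B\rangle=0$ and $\alpha'=A$, $A'=aC$, $B'=bC+c\alpha$, $C'=bA+aB$ for smooth functions $a,b$ (derivatives in the ambient semi-Euclidean space). In all families the surfaces are regular time-like surfaces, so the equations implicitly require $U'\ne0$, $V_v\neq0$ in (i) and $a'\neq0$, $A_v\ne0$ in (ii), (iii), (v). "Congruent" means equal up to an isometry of the ambient space.
   Formalization: "Congruent" is taken to mean equal up to an isometry of the ambient space that preserves ∂/∂z up to sign; with arbitrary isometries the "if" direction fails, for example for c = 0, f = 1, I = ℝ. *)

theory Defs
  imports "HOL-Analysis.Analysis"
begin

section \<open>Smooth maps\<close>

text \<open>For finite-dimensional \<open>'a\<close> and open \<open>S\<close>, \<open>Ck_on k S f\<close> says that \<open>f\<close> is of class \<open>C\<^sup>k\<close>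
  on \<open>S\<close>: all iterated directional derivatives of order at most \<open>k\<close> exist and are continuous.\<close>

primrec Ck_on :: "nat \<Rightarrow> 'a set \<Rightarrow> ('a::real_normed_vector \<Rightarrow> 'b::real_normed_vector) \<Rightarrow> bool" where
  "Ck_on 0 S f \<longleftrightarrow> continuous_on S f"
| "Ck_on (Suc k) S f \<longleftrightarrow>
     (\<forall>x\<in>S. f differentiable (at x)) \<and> (\<forall>v. Ck_on k S (\<lambda>x. frechet_derivative f (at x) v))"

definition smooth_on :: "'a set \<Rightarrow> ('a::real_normed_vector \<Rightarrow> 'b::real_normed_vector) \<Rightarrow> bool" where
  "smooth_on S f \<longleftrightarrow> (\<forall>k. Ck_on k S f)"

section \<open>The space forms and the warped product\<close>

text \<open>All three space forms are realised in \<open>real ^ 4\<close>. For \<open>c = 0\<close> the Minkowski space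
  \<open>\<real>\<^sup>3\<close> with metric \<open>-dx\<^sub>1\<^sup>2 + dx\<^sub>2\<^sup>2 + dx\<^sub>3\<^sup>2\<close> is identified with the hyperplane \<open>x\<^sub>4 = 0\<close>; this lets the
  three cases share one type.\<close>

definition lprod :: "real \<Rightarrow> real ^ 4 \<Rightarrow> real ^ 4 \<Rightarrow> real" where
  "lprod c x y =
     (if c = -1 then - x$1 * y$1 - x$2 * y$2 + x$3 * y$3 + x$4 * y$4
      else - x$1 * y$1 + x$2 * y$2 + x$3 * y$3 + x$4 * y$4)"

definition space_form :: "real \<Rightarrow> (real ^ 4) set" where
  "space_form c = (if c = 0 then {x. x$4 = 0} else {x. lprod c x x = c})"

definition space_form_tangent :: "real \<Rightarrow> real ^ 4 \<Rightarrow> (real ^ 4) set" where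
  "space_form_tangent c x = (if c = 0 then {X. X$4 = 0} else {X. lprod c x X = 0})"

type_synonym point = "(real ^ 4) \<times> real"

definition ambient :: "real \<Rightarrow> real set \<Rightarrow> point set" where
  "ambient c I = space_form c \<times> I"

definition ambient_tangent :: "real \<Rightarrow> point \<Rightarrow> point set" where
  "ambient_tangent c p = space_form_tangent c (fst p) \<times> UNIV"

text \<open>The warped product metric, defined on all of \<open>real ^ 4 \<times> I\<close>. The space-time carries its
  restriction to \<open>ambient_tangent\<close>.\<close>

definition wmetric :: "real \<Rightarrow> (real \<Rightarrow> real) \<Rightarrow> point \<Rightarrow> point \<Rightarrow> point \<Rightarrow> real" where
  "wmetric c f p X Y = (f (snd p))\<^sup>2 * lprod c (fst X) (fst Y) + snd X * snd Y"

definition dz :: point where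
  "dz = (0, 1)"

text \<open>Orthogonal projection of \<open>v\<close> to a subspace \<open>W\<close> on which the scalar product \<open>B\<close> is
  nondegenerate.\<close>

definition tan_part :: "(point \<Rightarrow> point \<Rightarrow> real) \<Rightarrow> point set \<Rightarrow> point \<Rightarrow> point" where
  "tan_part B W v = (THE t. t \<in> W \<and> (\<forall>w\<in>W. B (v - t) w = 0))"

section \<open>The Levi-Civita connection\<close>

text \<open>Christoffel symbols of the first kind of \<open>wmetric\<close> on \<open>real ^ 4 \<times> I\<close> (Koszul formula for
  constant vector fields).\<close>

definition christoffel ::
    "real \<Rightarrow> (real \<Rightarrow> real) \<Rightarrow> point \<Rightarrow> point \<Rightarrow> point \<Rightarrow> point \<Rightarrow> real" where
  "christoffel c f p X Y Z =
     (frechet_derivative (\<lambda>q. wmetric c f q Y Z) (at p) X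
      + frechet_derivative (\<lambda>q. wmetric c f q X Z) (at p) Y
      - frechet_derivative (\<lambda>q. wmetric c f q X Y) (at p) Z) / 2"

text \<open>Covariant derivative in direction \<open>w\<close> at parameter \<open>q\<close> of a vector field \<open>Y\<close> along a map
  \<open>\<phi>\<close>, first for the Levi-Civita connection of \<open>real ^ 4 \<times> I\<close>, then for that of the space-time,
  which is its tangential projection.\<close>

definition flat_cov :: "real \<Rightarrow> (real \<Rightarrow> real) \<Rightarrow> ('d::euclidean_space \<Rightarrow> point) \<Rightarrow>
    ('d \<Rightarrow> point) \<Rightarrow> 'd \<Rightarrow> 'd \<Rightarrow> point" where
  "flat_cov c f \<phi> Y q w =
     (THE D. \<forall>Z. wmetric c f (\<phi> q) D Z =
        wmetric c f (\<phi> q) (frechet_derivative Y (at q) w) Z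
        + christoffel c f (\<phi> q) (frechet_derivative \<phi> (at q) w) (Y q) Z)"

definition cov :: "real \<Rightarrow> (real \<Rightarrow> real) \<Rightarrow> ('d::euclidean_space \<Rightarrow> point) \<Rightarrow>
    ('d \<Rightarrow> point) \<Rightarrow> 'd \<Rightarrow> 'd \<Rightarrow> point" where
  "cov c f \<phi> Y q w =
     tan_part (wmetric c f (\<phi> q)) (ambient_tangent c (\<phi> q)) (flat_cov c f \<phi> Y q w)"

section \<open>Immersed submanifolds\<close>

text \<open>A submanifold is a topological space \<open>M\<close> with a map \<open>x\<close> into the space-time that is a smooth
  immersion in suitable local parametrizations \<open>\<psi>\<close> by open subsets of \<open>'d\<close>. Any two
  \<open>\<psi>\<close> for which \<open>x \<circ> \<psi>\<close> is a smooth immersion are smoothly compatible, so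
  \<open>local_param\<close> singles out exactly the parametrizations belonging to the smooth structure.
  Embedded submanifolds are the case where \<open>M\<close> is a subspace and \<open>x\<close> the inclusion.\<close>

definition local_param :: "'m topology \<Rightarrow> ('m \<Rightarrow> point) \<Rightarrow> 'd::euclidean_space set \<Rightarrow>
    ('d \<Rightarrow> 'm) \<Rightarrow> bool" where
  "local_param M x D \<psi> \<longleftrightarrow>
     open D \<and> openin M (\<psi> ` D) \<and>
     homeomorphic_map (top_of_set D) (subtopology M (\<psi> ` D)) \<psi> \<and>
     smooth_on D (x \<circ> \<psi>) \<and> (\<forall>q\<in>D. inj (frechet_derivative (x \<circ> \<psi>) (at q)))"

definition submanifold :: "'d::euclidean_space itself \<Rightarrow> real \<Rightarrow> real set \<Rightarrow>
    'm topology \<Rightarrow> ('m \<Rightarrow> point) \<Rightarrow> bool" where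
  "submanifold d c I M x \<longleftrightarrow>
     Hausdorff_space M \<and> second_countable M \<and>
     x ` topspace M \<subseteq> ambient c I \<and>
     (\<forall>p\<in>topspace M. \<exists>(D::'d set) \<psi>. local_param M x D \<psi> \<and> p \<in> \<psi> ` D)"

definition tangent_plane :: "('d::euclidean_space \<Rightarrow> point) \<Rightarrow> 'd \<Rightarrow> point set" where
  "tangent_plane \<phi> q = range (frechet_derivative \<phi> (at q))"

definition normal_space :: "real \<Rightarrow> (real \<Rightarrow> real) \<Rightarrow> ('d::euclidean_space \<Rightarrow> point) \<Rightarrow> 'd \<Rightarrow>
    point set" where
  "normal_space c f \<phi> q =
     {\<xi> \<in> ambient_tangent c (\<phi> q). \<forall>X\<in>tangent_plane \<phi> q. wmetric c f (\<phi> q) \<xi> X = 0}"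

text \<open>The definition is meaningful for degenerate hypersurfaces as well: covariant derivatives of
  tangent fields in tangent directions are tangent.\<close>

definition totally_geodesic_hypersurface :: "real \<Rightarrow> (real \<Rightarrow> real) \<Rightarrow> real set \<Rightarrow> point set \<Rightarrow> bool"
  where
  "totally_geodesic_hypersurface c f I S \<longleftrightarrow>
     submanifold TYPE(real ^ 3) c I (top_of_set S) id \<and>
     (\<forall>(D::(real ^ 3) set) \<kappa>. local_param (top_of_set S) id D \<kappa> \<longrightarrow>
        (\<forall>q\<in>D. \<forall>w w'.
           cov c f \<kappa> (\<lambda>r. frechet_derivative \<kappa> (at r) w') q w \<in> tangent_plane \<kappa> q))"

section \<open>Time-like surfaces, the vector fields T and eta, class A\<close>

definition timelike_surface :: "real \<Rightarrow> (real \<Rightarrow> real) \<Rightarrow> real set \<Rightarrow> 'm topology \<Rightarrow>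
    ('m \<Rightarrow> point) \<Rightarrow> bool" where
  "timelike_surface c f I M x \<longleftrightarrow>
     submanifold TYPE(real \<times> real) c I M x \<and>
     (\<forall>(D::(real \<times> real) set) \<psi>. local_param M x D \<psi> \<longrightarrow>
        (\<forall>q\<in>D. \<exists>X Y. tangent_plane (x \<circ> \<psi>) q = span {X, Y} \<and>
           wmetric c f (x (\<psi> q)) X X = -1 \<and> wmetric c f (x (\<psi> q)) Y Y = 1 \<and>
           wmetric c f (x (\<psi> q)) X Y = 0))"

definition T_field :: "real \<Rightarrow> (real \<Rightarrow> real) \<Rightarrow> (real \<times> real \<Rightarrow> point) \<Rightarrow> real \<times> real \<Rightarrow> point" where
  "T_field c f \<phi> q = tan_part (wmetric c f (\<phi> q)) (tangent_plane \<phi> q) dz"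

definition eta_field :: "real \<Rightarrow> (real \<Rightarrow> real) \<Rightarrow> (real \<times> real \<Rightarrow> point) \<Rightarrow> real \<times> real \<Rightarrow> point"
  where
  "eta_field c f \<phi> q = dz - T_field c f \<phi> q"

definition T_lightlike :: "real \<Rightarrow> (real \<Rightarrow> real) \<Rightarrow> 'm topology \<Rightarrow> ('m \<Rightarrow> point) \<Rightarrow> bool" where
  "T_lightlike c f M x \<longleftrightarrow>
     (\<forall>D \<psi>. local_param M x D \<psi> \<longrightarrow>
        (\<forall>q\<in>D. T_field c f (x \<circ> \<psi>) q \<noteq> 0 \<and>
           wmetric c f (x (\<psi> q)) (T_field c f (x \<circ> \<psi>) q) (T_field c f (x \<circ> \<psi>) q) = 0))"

definition standing_assumptions :: "real \<Rightarrow> (real \<Rightarrow> real) \<Rightarrow> real set \<Rightarrow> 'm topology \<Rightarrow>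
    ('m \<Rightarrow> point) \<Rightarrow> bool" where
  "standing_assumptions c f I M x \<longleftrightarrow>
     (\<forall>D \<psi>. local_param M x D \<psi> \<longrightarrow>
        (\<forall>q\<in>D. T_field c f (x \<circ> \<psi>) q \<noteq> 0 \<and> eta_field c f (x \<circ> \<psi>) q \<noteq> 0)) \<and>
     \<not> (\<exists>N S. openin M N \<and> N \<noteq> {} \<and> totally_geodesic_hypersurface c f I S \<and> x ` N \<subseteq> S)"

text \<open>Second fundamental form \<open>h(d\<phi> w, d\<phi> w')\<close> and shape operator
  \<open>\<langle>A\<^sub>\<xi> X, Y\<rangle> = \<langle>h(X, Y), \<xi>\<rangle>\<close>.\<close>

definition second_ff :: "real \<Rightarrow> (real \<Rightarrow> real) \<Rightarrow> (real \<times> real \<Rightarrow> point) \<Rightarrow> real \<times> real \<Rightarrow>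
    real \<times> real \<Rightarrow> real \<times> real \<Rightarrow> point" where
  "second_ff c f \<phi> q w w' =
     (let D = cov c f \<phi> (\<lambda>r. frechet_derivative \<phi> (at r) w') q w
      in D - tan_part (wmetric c f (\<phi> q)) (tangent_plane \<phi> q) D)"

definition shape_op :: "real \<Rightarrow> (real \<Rightarrow> real) \<Rightarrow> (real \<times> real \<Rightarrow> point) \<Rightarrow> real \<times> real \<Rightarrow>
    point \<Rightarrow> point \<Rightarrow> point" where
  "shape_op c f \<phi> q \<xi> X =
     (THE S. S \<in> tangent_plane \<phi> q \<and>
        (\<forall>w w'. frechet_derivative \<phi> (at q) w = X \<longrightarrow>
           wmetric c f (\<phi> q) S (frechet_derivative \<phi> (at q) w') =
           wmetric c f (\<phi> q) (second_ff c f \<phi> q w w') \<xi>))"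

definition class_A :: "real \<Rightarrow> (real \<Rightarrow> real) \<Rightarrow> 'm topology \<Rightarrow> ('m \<Rightarrow> point) \<Rightarrow> bool" where
  "class_A c f M x \<longleftrightarrow>
     (\<forall>D \<psi>. local_param M x D \<psi> \<longrightarrow>
        (\<forall>q\<in>D. T_field c f (x \<circ> \<psi>) q \<noteq> 0 \<and>
           (\<forall>\<xi>\<in>normal_space c f (x \<circ> \<psi>) q. \<exists>k.
              shape_op c f (x \<circ> \<psi>) q \<xi> (T_field c f (x \<circ> \<psi>) q) = k *\<^sub>R T_field c f (x \<circ> \<psi>) q)))"

section \<open>Congruence\<close>

text \<open>Only the values of \<open>\<Psi>\<close> on the space-time matter; smoothness of \<open>\<Psi>\<close> and of its
  inverse is expressed by smooth extensions to open neighbourhoods in \<open>real ^ 4 \<times> real\<close>.\<close>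

definition ambient_isometry :: "real \<Rightarrow> (real \<Rightarrow> real) \<Rightarrow> real set \<Rightarrow> (point \<Rightarrow> point) \<Rightarrow> bool" where
  "ambient_isometry c f I \<Psi> \<longleftrightarrow>
     (\<exists>W. open W \<and> ambient c I \<subseteq> W \<and> smooth_on W \<Psi>) \<and>
     bij_betw \<Psi> (ambient c I) (ambient c I) \<and>
     (\<exists>W \<Phi>. open W \<and> ambient c I \<subseteq> W \<and> smooth_on W \<Phi> \<and> (\<forall>p\<in>ambient c I. \<Phi> (\<Psi> p) = p)) \<and>
     (\<forall>p\<in>ambient c I. \<forall>X\<in>ambient_tangent c p. \<forall>Y\<in>ambient_tangent c p.
        wmetric c f (\<Psi> p) (frechet_derivative \<Psi> (at p) X) (frechet_derivative \<Psi> (at p) Y) =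
        wmetric c f p X Y)"

text \<open>Since \<open>T\<close> and class A refer to the distinguished field \<open>\<partial>/\<partial>z\<close>, congruences are isometries of
  the space-time as a warped product: they preserve \<open>\<partial>/\<partial>z\<close> up to sign. For special warping functions
  there are further isometries (for example all Lorentz transformations when \<open>c = 0\<close>, \<open>f = 1\<close>,
  \<open>I = UNIV\<close>), and these preserve neither \<open>T\<close> nor class A.\<close>

definition congruence :: "real \<Rightarrow> (real \<Rightarrow> real) \<Rightarrow> real set \<Rightarrow> (point \<Rightarrow> point) \<Rightarrow> bool" where
  "congruence c f I \<Psi> \<longleftrightarrow> ambient_isometry c f I \<Psi> \<and>
     (\<exists>\<epsilon>\<in>{-1, 1}. \<forall>p\<in>ambient c I. frechet_derivative \<Psi> (at p) dz = \<epsilon> *\<^sub>R dz)"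

section \<open>The five families\<close>

definition cartan_framed :: "real \<Rightarrow> real set \<Rightarrow> (real \<Rightarrow> real ^ 4) \<Rightarrow> (real \<Rightarrow> real ^ 4) \<Rightarrow>
    (real \<Rightarrow> real ^ 4) \<Rightarrow> (real \<Rightarrow> real ^ 4) \<Rightarrow> (real \<Rightarrow> real) \<Rightarrow> (real \<Rightarrow> real) \<Rightarrow> bool" where
  "cartan_framed c J \<alpha> A B C a b \<longleftrightarrow>
     open J \<and> is_interval J \<and>
     smooth_on J \<alpha> \<and> smooth_on J A \<and> smooth_on J B \<and> smooth_on J C \<and> smooth_on J a \<and> smooth_on J b \<and>
     (\<forall>s\<in>J. \<alpha> s \<in> space_form c \<and>
        A s \<in> space_form_tangent c (\<alpha> s) \<and> B s \<in> space_form_tangent c (\<alpha> s) \<and>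
        C s \<in> space_form_tangent c (\<alpha> s) \<and>
        lprod c (A s) (B s) = -1 \<and> lprod c (C s) (C s) = 1 \<and>
        lprod c (A s) (A s) = 0 \<and> lprod c (B s) (B s) = 0 \<and>
        lprod c (C s) (A s) = 0 \<and> lprod c (C s) (B s) = 0 \<and>
        (\<alpha> has_vector_derivative A s) (at s) \<and>
        (A has_vector_derivative a s *\<^sub>R C s) (at s) \<and>
        (B has_vector_derivative b s *\<^sub>R C s + c *\<^sub>R \<alpha> s) (at s) \<and>
        (C has_vector_derivative b s *\<^sub>R A s + a s *\<^sub>R B s) (at s))"

definition family_i :: "real \<Rightarrow> (real \<Rightarrow> real) \<Rightarrow> (real \<times> real) set \<Rightarrow> (real \<times> real \<Rightarrow> point) \<Rightarrow> bool"
  where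
  "family_i c f D \<phi> \<longleftrightarrow>
     (\<exists>J \<alpha> A B C a b U V. cartan_framed c J \<alpha> A B C a b \<and>
        smooth_on (fst ` D) U \<and> smooth_on D (\<lambda>(u, v). V u v) \<and>
        (\<forall>(u, v)\<in>D. U u \<in> J \<and> U u \<noteq> 0 \<and> V u v \<noteq> 0 \<and> deriv U u \<noteq> 0 \<and> deriv (\<lambda>t. V u t) v \<noteq> 0 \<and>
           deriv U u * (V u v)\<^sup>2 * ((b (U u))\<^sup>2 + c) - 2 * deriv (\<lambda>s. V s v) u
             = - 1 / ((f u)\<^sup>2 * deriv U u) \<and>
           \<phi> (u, v) = (\<alpha> (U u) + V u v *\<^sub>R B (U u), u)))"

definition family_ii :: "real \<Rightarrow> (real \<Rightarrow> real) \<Rightarrow> (real \<times> real) set \<Rightarrow> (real \<times> real \<Rightarrow> point) \<Rightarrow> bool"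
  where
  "family_ii c f D \<phi> \<longleftrightarrow> c = 1 \<and>
     (\<exists>r a A. 0 < r \<and> r < 1 \<and> smooth_on (fst ` D) a \<and> smooth_on D (\<lambda>(u, v). A u v) \<and>
        (\<forall>(u, v)\<in>D. a u \<noteq> 0 \<and> A u v \<noteq> 0 \<and> deriv a u \<noteq> 0 \<and> deriv (\<lambda>t. A u t) v \<noteq> 0 \<and>
           deriv (\<lambda>s. A s v) u
             = - (A u v)\<^sup>2 / (2 * r\<^sup>2 * (f u)\<^sup>2 * deriv a u) - 1/2 * deriv a u * ((A u v)\<^sup>2 + 1) \<and>
           \<phi> (u, v) = (vector [r / A u v, r * (cos (a u) / A u v - sin (a u)),
                        r * (sin (a u) / A u v + cos (a u)), sqrt (1 - r\<^sup>2)], u)))"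

definition family_iii :: "real \<Rightarrow> (real \<Rightarrow> real) \<Rightarrow> (real \<times> real) set \<Rightarrow> (real \<times> real \<Rightarrow> point) \<Rightarrow> bool"
  where
  "family_iii c f D \<phi> \<longleftrightarrow> c = -1 \<and>
     (\<exists>r a A. 1 < r \<and> smooth_on (fst ` D) a \<and> smooth_on D (\<lambda>(u, v). A u v) \<and>
        (\<forall>(u, v)\<in>D. a u \<noteq> 0 \<and> A u v \<noteq> 0 \<and> deriv a u \<noteq> 0 \<and> deriv (\<lambda>t. A u t) v \<noteq> 0 \<and>
           deriv (\<lambda>s. A s v) u
             = (A u v)\<^sup>2 / (2 * r\<^sup>2 * (f u)\<^sup>2 * deriv a u) - 1/2 * deriv a u * ((A u v)\<^sup>2 + 1) \<and>
           \<phi> (u, v) = (vector [r * (cos (a u) / A u v - sin (a u)),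
                        r * (sin (a u) / A u v + cos (a u)), r / A u v, sqrt (r\<^sup>2 - 1)], u)))"

definition F_int :: "(real \<Rightarrow> real) \<Rightarrow> real \<Rightarrow> real \<Rightarrow> real" where
  "F_int f z0 z = (LBINT \<zeta>=ereal z0..ereal z. 1 / f \<zeta>)"

definition family_iv :: "real \<Rightarrow> (real \<Rightarrow> real) \<Rightarrow> real \<Rightarrow> (real \<times> real) set \<Rightarrow>
    (real \<times> real \<Rightarrow> point) \<Rightarrow> bool" where
  "family_iv c f z0 D \<phi> \<longleftrightarrow> c = -1 \<and>
     (\<exists>a c1 c2. a \<noteq> 0 \<and> c1 \<noteq> 0 \<and>
        (\<forall>(u, v)\<in>D. let F = F_int f z0 u in
           \<phi> (u, v) = (vector
             [(2 * c1\<^sup>2 * F + 2 * c2 * c1 + F - 2 * v) / (2 * sqrt 2 * c1),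
              - (a * (c1 * F + c2) * (2 * v - F) / c1) - a - 1 / (4 * a),
              - (a * (c1 * F + c2) * (2 * v - F) / c1) - a + 1 / (4 * a),
              ((2 * c1\<^sup>2 - 1) * F + 2 * (c1 * c2 + v)) / (2 * sqrt 2 * c1)], u)))"

definition family_v :: "real \<Rightarrow> (real \<Rightarrow> real) \<Rightarrow> (real \<times> real) set \<Rightarrow> (real \<times> real \<Rightarrow> point) \<Rightarrow> bool"
  where
  "family_v c f D \<phi> \<longleftrightarrow> c = 0 \<and>
     (\<exists>r a A. 0 < r \<and> smooth_on (fst ` D) a \<and> smooth_on D (\<lambda>(u, v). A u v) \<and>
        (\<forall>(u, v)\<in>D. a u \<noteq> 0 \<and> A u v \<noteq> 0 \<and> deriv a u \<noteq> 0 \<and> deriv (\<lambda>t. A u t) v \<noteq> 0 \<and>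
           deriv (\<lambda>s. A s v) u
             = - (A u v)\<^sup>2 / (2 * r\<^sup>2 * (f u)\<^sup>2 * deriv a u) - 1/2 * deriv a u * ((A u v)\<^sup>2 + 1) \<and>
           \<phi> (u, v) = (vector [r / A u v, r * (cos (a u) / A u v - sin (a u)),
                        r * (sin (a u) / A u v + cos (a u)), 0], u)))"

text \<open>\<open>N\<close> is a piece of the surface on which, after a congruence, \<open>x\<close> reads \<open>\<phi>\<close> in
  suitable coordinates \<open>(u, v) \<in> D\<close>.\<close>

definition congruent_to_param :: "real \<Rightarrow> (real \<Rightarrow> real) \<Rightarrow> real set \<Rightarrow> 'm topology \<Rightarrow>
    ('m \<Rightarrow> point) \<Rightarrow> 'm set \<Rightarrow> (real \<times> real) set \<Rightarrow> (real \<times> real \<Rightarrow> point) \<Rightarrow> bool" where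
  "congruent_to_param c f I M x N D \<phi> \<longleftrightarrow>
     connected D \<and> D \<subseteq> I \<times> UNIV \<and>
     (\<exists>\<psi> \<Psi>. local_param M x D \<psi> \<and> \<psi> ` D = N \<and> congruence c f I \<Psi> \<and>
        (\<forall>q\<in>D. \<Psi> (x (\<psi> q)) = \<phi> q))"

end

theory Submission
  imports Defs
begin

text \<open>On the surface, \<open>T\<close> is the gradient of the height \<open>z\<close>. If \<open>T\<close> is light-like, its integral curves
  are the level curves of \<open>z\<close>, which are null curves in slices of the space-time. In a Lorentzian plane
  a null vector spans its own orthogonal complement, so \<open>T\<close> is an eigenvector of \<open>A\<^sub>\<xi>\<close> iff
  \<open>\<langle>A\<^sub>\<xi> T, T\<rangle> = 0\<close>, and class A means that the second fundamental form vanishes on \<open>(T, T)\<close>. The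
  Christoffel symbols vanish on a horizontal null vector, and what remains is that the acceleration of
  the level curves in \<open>real ^ 4\<close> is tangent to the surface (\<open>shape_op_T_eigenvector_iff\<close>), hence
  proportional to their velocity: the level curves are straight null lines. Class A surfaces are thus
  the surfaces that are ruled by null lines of the slices.

  Conversely to this description, such a surface is a null scroll over any null curve that is transversal
  to the rulings (\<open>null_scroll_frame\<close>). A transversal null curve is found by solving a Riccati equation,
  and a Cartan frame along it by choosing an affine parameter. Another Riccati equation, the one of the
  first family, provides the coordinate \<open>v\<close> for which the \<open>u\<close>-curves are null as well. Riccati equations
  are linear systems in disguise (\<open>riccati_flow\<close>), so that Picard iteration for Lipschitz equations
  suffices and the solution depends smoothly on its initial value. In this way every class A surface
  belongs locally to the first family (\<open>class_A_imp_family_i\<close>).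

  The surfaces of all five families are ruled by null lines (\<open>null_ruled\<close>). That this
  implies class A also for a congruent surface requires that congruences preserve the tangency of the
  acceleration along null lines (\<open>image_of_null_line\<close>). For this, a null line is made a ruling of a
  surface with degenerate metric, on which the relevant component of the acceleration is determined by
  the metric. Finally \<open>class_A_at_null_ruled\<close> compares accelerations along a level curve in an arbitrary
  chart, where the smooth inverse function theorem supplies the level curve.\<close>

section \<open>Calculus of smooth maps\<close>

lemma Ck_on_cong:
  assumes "open S" "\<And>x. x \<in> S \<Longrightarrow> f x = g x"
  shows "Ck_on k S f \<longleftrightarrow> Ck_on k S g"
  using assms(2)
proof (induction k arbitrary: f g)
  case 0
  then show ?case by (auto intro: continuous_on_cong)
next
  case (Suc k)
  have imp: "Ck_on (Suc k) S h" if gk: "Ck_on (Suc k) S g'" and eq: "\<And>x. x \<in> S \<Longrightarrow> g' x = h x"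
    for g' h :: "'a \<Rightarrow> 'b"
  proof -
    have d: "(h has_derivative frechet_derivative g' (at x)) (at x)" if "x \<in> S" for x
    proof -
      have "(g' has_derivative frechet_derivative g' (at x)) (at x)"
        using gk that by (simp add: frechet_derivative_works[symmetric])
      then show ?thesis
        by (rule has_derivative_transform_within_open[OF _ assms(1) that]) (use eq in auto)
    qed
    have "frechet_derivative g' (at x) = frechet_derivative h (at x)" if "x \<in> S" for x
      using frechet_derivative_at[OF d[OF that]] .
    then have "Ck_on k S (\<lambda>x. frechet_derivative h (at x) v)" for v
      using gk Suc.IH[of "\<lambda>x. frechet_derivative g' (at x) v" "\<lambda>x. frechet_derivative h (at x) v"]
      by auto
    with d show ?thesis by (auto simp: differentiable_def)
  qed
  show ?case using imp[of f g] imp[of g f] Suc.prems by metis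
qed

lemma smooth_on_cong:
  assumes "open S" "\<And>x. x \<in> S \<Longrightarrow> f x = g x"
  shows "smooth_on S f \<longleftrightarrow> smooth_on S g"
  using Ck_on_cong[OF assms] by (auto simp: smooth_on_def)

lemma Ck_on_SucD: "Ck_on (Suc k) S f \<Longrightarrow> Ck_on k S f"
proof (induction k arbitrary: f)
  case 0
  then show ?case
    by (auto intro!: continuous_at_imp_continuous_on differentiable_imp_continuous_within)
next
  case (Suc k)
  then show ?case by (metis Ck_on.simps(2))
qed

lemma Ck_on_SucI:
  assumes "open S" "\<And>x. x \<in> S \<Longrightarrow> (f has_derivative f' x) (at x)"
    "\<And>v. Ck_on k S (\<lambda>x. f' x v)"
  shows "Ck_on (Suc k) S f"
proof -
  have "Ck_on k S (\<lambda>x. frechet_derivative f (at x) v)" for v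
    using assms(3)[of v] Ck_on_cong[OF assms(1), of "\<lambda>x. f' x v" "\<lambda>x. frechet_derivative f (at x) v"]
      frechet_derivative_at[OF assms(2)] by auto
  then show ?thesis using assms(2) by (auto simp: differentiable_def)
qed

lemma Ck_on_SucE:
  assumes "Ck_on (Suc k) S f"
  shows "\<And>x. x \<in> S \<Longrightarrow> (f has_derivative frechet_derivative f (at x)) (at x)"
    "\<And>v. Ck_on k S (\<lambda>x. frechet_derivative f (at x) v)"
  using assms by (auto simp: frechet_derivative_works[symmetric])

lemma smooth_on_subset: "smooth_on S f \<Longrightarrow> T \<subseteq> S \<Longrightarrow> smooth_on T f"
proof -
  have "Ck_on k S f \<Longrightarrow> T \<subseteq> S \<Longrightarrow> Ck_on k T f" for k
    by (induction k arbitrary: f) (auto intro: continuous_on_subset)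
  then show "smooth_on S f \<Longrightarrow> T \<subseteq> S \<Longrightarrow> smooth_on T f" by (auto simp: smooth_on_def)
qed

lemma smooth_on_has_derivative:
  "smooth_on S f \<Longrightarrow> x \<in> S \<Longrightarrow> (f has_derivative frechet_derivative f (at x)) (at x)"
  using Ck_on_SucE(1)[of 0 S f] unfolding smooth_on_def by blast

lemma smooth_on_frechet_derivative:
  "smooth_on S f \<Longrightarrow> smooth_on S (\<lambda>x. frechet_derivative f (at x) v)"
  using Ck_on_SucE(2)[of _ S f] unfolding smooth_on_def by blast

lemma derivative_of_constant:
  assumes "(h has_derivative h') (at x)" "open S" "x \<in> S" "\<And>y. y \<in> S \<Longrightarrow> h y = k"
  shows "h' v = 0"
proof -
  have "(h has_derivative (\<lambda>v. 0)) (at x)"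
    by (rule has_derivative_transform_within_open[OF has_derivative_const assms(2,3), of k]) (simp add: assms(4))
  from fun_cong[OF has_derivative_unique[OF assms(1) this]] show ?thesis .
qed

lemma smooth_on_imp_continuous_on: "smooth_on S f \<Longrightarrow> continuous_on S f"
  by (metis Ck_on.simps(1) smooth_on_def)

lemma Ck_on_const [simp]: "Ck_on k S (\<lambda>x. a)"
  by (induction k arbitrary: a) auto

lemma Ck_on_bounded_linear:
  assumes "open S" "bounded_linear f" shows "Ck_on k S f"
proof (cases k)
  case 0
  then show ?thesis using assms by (simp add: linear_continuous_on)
next
  case (Suc j)
  show ?thesis unfolding Suc
    by (rule Ck_on_SucI[OF assms(1), of f "\<lambda>x. f"])
       (auto intro: bounded_linear_imp_has_derivative assms)
qed

lemma Ck_on_bounded_linear_compose: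
  assumes "open S" "bounded_linear L" "Ck_on k S f"
  shows "Ck_on k S (\<lambda>x. L (f x))"
  using assms(3)
proof (induction k arbitrary: f)
  case 0
  then show ?case using assms(2) by (auto intro: linear_continuous_on_compose bounded_linear.continuous_on)
next
  case (Suc k)
  note E = Ck_on_SucE[OF Suc.prems]
  show ?case
    by (rule Ck_on_SucI[OF assms(1), of _ "\<lambda>x v. L (frechet_derivative f (at x) v)"])
       (auto intro: bounded_linear.has_derivative[OF assms(2)] E Suc.IH)
qed

lemma Ck_on_add:
  assumes "open S" "Ck_on k S f" "Ck_on k S g"
  shows "Ck_on k S (\<lambda>x. f x + g x)"
  using assms(2,3)
proof (induction k arbitrary: f g)
  case 0
  then show ?case by (auto intro: continuous_on_add)
next
  case (Suc k)
  note E = Ck_on_SucE[OF Suc.prems(1)] Ck_on_SucE[OF Suc.prems(2)]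
  show ?case
    by (rule Ck_on_SucI[OF assms(1)]) (auto intro: has_derivative_add E Suc.IH)
qed

lemma Ck_on_bilinear:
  assumes "open S" "bounded_bilinear pr" "Ck_on k S f" "Ck_on k S g"
  shows "Ck_on k S (\<lambda>x. pr (f x) (g x))"
  using assms(3,4)
proof (induction k arbitrary: f g)
  case 0
  then show ?case using bounded_bilinear.continuous_on[OF assms(2)] by auto
next
  case (Suc k)
  note E = Ck_on_SucE[OF Suc.prems(1)] Ck_on_SucE[OF Suc.prems(2)]
  note C = Ck_on_SucD[OF Suc.prems(1)] Ck_on_SucD[OF Suc.prems(2)]
  show ?case
    by (rule Ck_on_SucI[OF assms(1)], rule bounded_bilinear.FDERIV[OF assms(2)])
       (auto intro!: Ck_on_add[OF assms(1)] Suc.IH E C)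
qed

lemma Ck_on_sum:
  assumes "open S" "\<And>i. i \<in> A \<Longrightarrow> Ck_on k S (f i)"
  shows "Ck_on k S (\<lambda>x. \<Sum>i\<in>A. f i x)"
  using assms(2) by (induction A rule: infinite_finite_induct) (auto intro: Ck_on_add[OF assms(1)])

text \<open>The chain rule is expanded in a basis, because the induction hypothesis applies to the
  derivatives of \<open>g\<close> in fixed directions only.\<close>

lemma Ck_on_compose:
  fixes f :: "'a::real_normed_vector \<Rightarrow> 'b::euclidean_space"
    and g :: "'b \<Rightarrow> 'c::real_normed_vector"
  assumes "open S" "open T" "Ck_on k T g" "Ck_on k S f" "f ` S \<subseteq> T"
  shows "Ck_on k S (\<lambda>x. g (f x))"
  using assms(3,4)
proof (induction k arbitrary: g)
  case 0
  then show ?case using assms(5) continuous_on_compose2[of T g S f] by auto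
next
  case (Suc k)
  note E = Ck_on_SucE[OF Suc.prems(1)] Ck_on_SucE[OF Suc.prems(2)]
  note C = Ck_on_SucD[OF Suc.prems(2)]
  define h where "h x v = (\<Sum>b\<in>Basis. (frechet_derivative f (at x) v \<bullet> b) *\<^sub>R
      frechet_derivative g (at (f x)) b)" for x v
  have h: "h x v = frechet_derivative g (at (f x)) (frechet_derivative f (at x) v)" if "x \<in> S" for x v
  proof -
    have lin: "linear (frechet_derivative g (at (f x)))"
      using E(1)[of "f x"] that assms(5) has_derivative_linear by blast
    have "frechet_derivative g (at (f x)) (\<Sum>b\<in>Basis. (frechet_derivative f (at x) v \<bullet> b) *\<^sub>R b) = h x v"
      unfolding h_def by (simp add: linear_sum[OF lin] linear_cmul[OF lin])
    then show ?thesis by (simp add: euclidean_representation)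
  qed
  show ?case
  proof (rule Ck_on_SucI[OF assms(1), of _ h])
    fix x assume x: "x \<in> S"
    have "((\<lambda>x. g (f x)) has_derivative (\<lambda>v. frechet_derivative g (at (f x)) (frechet_derivative f (at x) v))) (at x)"
      by (rule has_derivative_compose[OF E(3)[OF x]]) (use E(1)[of "f x"] x assms(5) in auto)
    then show "((\<lambda>x. g (f x)) has_derivative h x) (at x)" using h[OF x] by presburger
  next
    fix v
    show "Ck_on k S (\<lambda>x. h x v)"
      unfolding h_def
      by (intro Ck_on_sum assms(1) Ck_on_bilinear[OF _ bounded_bilinear_scaleR]
          Ck_on_bounded_linear_compose[OF _ bounded_linear_inner_left] Suc.IH E C)
  qed
qed

text \<open>The bootstrap principle: solutions of smooth total differential equations are smooth, since each degree of
  differentiability of the solution is inherited by its derivative. This covers inverse functions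
  as well as ordinary differential equations.\<close>

lemma smooth_on_bootstrap:
  fixes g :: "'a::euclidean_space \<Rightarrow> 'b::euclidean_space"
  assumes S: "open S" and T: "open T"
    and d: "\<And>y. y \<in> S \<Longrightarrow> (g has_derivative (\<lambda>v. H v (y, g y))) (at y)"
    and H: "\<And>v. smooth_on T (H v)" and sub: "\<And>y. y \<in> S \<Longrightarrow> (y, g y) \<in> T"
  shows "smooth_on S g"
proof -
  have "Ck_on k S g" for k
  proof (induction k)
    case 0
    show ?case using d
      by (auto intro!: continuous_at_imp_continuous_on has_derivative_continuous)
  next
    case (Suc k)
    have p: "Ck_on k S (\<lambda>y. (y, g y))"
    proof -
      have "Ck_on k S (\<lambda>y. (y, 0) + (0, g y))"
        by (intro Ck_on_add S Ck_on_bounded_linear Ck_on_bounded_linear_compose[OF S _ Suc]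
              bounded_linear_Pair bounded_linear_ident bounded_linear_zero)
      then show ?thesis by simp
    qed
    show ?case
      by (rule Ck_on_SucI[OF S d]) (auto intro!: Ck_on_compose[OF S T _ p] sub H[unfolded smooth_on_def, rule_format])
  qed
  then show ?thesis by (simp add: smooth_on_def)
qed

lemma smooth_on_const: "smooth_on S (\<lambda>x. a)"
  by (simp add: smooth_on_def)

lemma smooth_on_linear: "open S \<Longrightarrow> bounded_linear L \<Longrightarrow> smooth_on S L"
  by (simp add: smooth_on_def Ck_on_bounded_linear)

lemma smooth_on_linear_compose:
  "open S \<Longrightarrow> bounded_linear L \<Longrightarrow> smooth_on S f \<Longrightarrow> smooth_on S (\<lambda>x. L (f x))"
  by (simp add: smooth_on_def Ck_on_bounded_linear_compose)

lemma smooth_on_compose: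
  fixes f :: "'a::real_normed_vector \<Rightarrow> 'b::euclidean_space"
  shows "smooth_on T g \<Longrightarrow> smooth_on S f \<Longrightarrow> open S \<Longrightarrow> open T \<Longrightarrow> f ` S \<subseteq> T \<Longrightarrow>
    smooth_on S (\<lambda>x. g (f x))"
  by (simp add: smooth_on_def Ck_on_compose)

lemma smooth_on_bilinear:
  "open S \<Longrightarrow> bounded_bilinear pr \<Longrightarrow> smooth_on S f \<Longrightarrow> smooth_on S g \<Longrightarrow> smooth_on S (\<lambda>x. pr (f x) (g x))"
  by (simp add: smooth_on_def Ck_on_bilinear)

lemma smooth_on_add: "open S \<Longrightarrow> smooth_on S f \<Longrightarrow> smooth_on S g \<Longrightarrow> smooth_on S (\<lambda>x. f x + g x)"
  by (simp add: smooth_on_def Ck_on_add)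

lemma smooth_on_minus: "open S \<Longrightarrow> smooth_on S f \<Longrightarrow> smooth_on S (\<lambda>x. - f x)"
  using smooth_on_linear_compose[OF _ bounded_linear_minus[OF bounded_linear_ident]] .

lemma smooth_on_diff: "open S \<Longrightarrow> smooth_on S f \<Longrightarrow> smooth_on S g \<Longrightarrow> smooth_on S (\<lambda>x. f x - g x)"
  using smooth_on_add[of S f "\<lambda>x. - g x"] smooth_on_minus[of S g] by simp

lemma smooth_on_scaleR:
  "open S \<Longrightarrow> smooth_on S f \<Longrightarrow> smooth_on S g \<Longrightarrow> smooth_on S (\<lambda>x. f x *\<^sub>R g x)"
  using smooth_on_bilinear[OF _ bounded_bilinear_scaleR] .

lemma smooth_on_mult:
  fixes f :: "'a::real_normed_vector \<Rightarrow> 'b::real_normed_algebra"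
  shows "open S \<Longrightarrow> smooth_on S f \<Longrightarrow> smooth_on S g \<Longrightarrow> smooth_on S (\<lambda>x. f x * g x)"
  using smooth_on_bilinear[OF _ bounded_bilinear_mult] .

lemma smooth_on_power:
  fixes f :: "'a::real_normed_vector \<Rightarrow> 'b::real_normed_algebra_1"
  shows "open S \<Longrightarrow> smooth_on S f \<Longrightarrow> smooth_on S (\<lambda>x. f x ^ n)"
  by (induction n) (auto intro: smooth_on_const smooth_on_mult)

lemma smooth_on_Pair:
  assumes "open S" "smooth_on S f" "smooth_on S g" shows "smooth_on S (\<lambda>x. (f x, g x))"
proof -
  have "smooth_on S (\<lambda>x. (f x, 0) + (0, g x))"
    by (intro smooth_on_add assms(1) smooth_on_linear_compose[OF assms(1) _ assms(2)]
      smooth_on_linear_compose[OF assms(1) _ assms(3)]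
      bounded_linear_Pair bounded_linear_ident bounded_linear_zero)
  then show ?thesis by simp
qed

lemma smooth_on_fst: "open S \<Longrightarrow> smooth_on S f \<Longrightarrow> smooth_on S (\<lambda>x. fst (f x))"
  using smooth_on_linear_compose[OF _ bounded_linear_fst] .

lemma smooth_on_snd: "open S \<Longrightarrow> smooth_on S f \<Longrightarrow> smooth_on S (\<lambda>x. snd (f x))"
  using smooth_on_linear_compose[OF _ bounded_linear_snd] .

lemma smooth_on_vec_nth: "open S \<Longrightarrow> smooth_on S f \<Longrightarrow> smooth_on S (\<lambda>x. f x $ i)"
  using smooth_on_linear_compose[OF _ bounded_linear_vec_nth] .

lemma smooth_on_id: "open S \<Longrightarrow> smooth_on S (\<lambda>x. x)"
  using smooth_on_linear[OF _ bounded_linear_ident] .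

text \<open>The elementary functions are smooth because each of them solves a first-order differential
  equation.\<close>

lemma smooth_on_inverse:
  fixes f :: "'a::real_normed_vector \<Rightarrow> real"
  assumes "open S" "smooth_on S f" "\<And>x. x \<in> S \<Longrightarrow> f x \<noteq> 0"
  shows "smooth_on S (\<lambda>x. inverse (f x))"
proof (rule smooth_on_compose[OF _ assms(2,1), of "- {0}"])
  show "smooth_on (- {0}) (inverse :: real \<Rightarrow> real)"
    by (rule smooth_on_bootstrap[where H = "\<lambda>v z. - (snd z * v * snd z)" and T = UNIV])
       (auto intro!: derivative_eq_intros smooth_on_minus smooth_on_mult smooth_on_snd smooth_on_const smooth_on_id)
qed (use assms in auto)

lemma smooth_on_divide:
  fixes f :: "'a::real_normed_vector \<Rightarrow> real"
  assumes "open S" "smooth_on S f" "smooth_on S g" "\<And>x. x \<in> S \<Longrightarrow> g x \<noteq> 0"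
  shows "smooth_on S (\<lambda>x. f x / g x)"
  using smooth_on_mult[OF assms(1,2) smooth_on_inverse[OF assms(1,3,4)]] by (simp add: divide_inverse)

lemma smooth_on_exp:
  fixes f :: "'a::real_normed_vector \<Rightarrow> real"
  assumes "open S" "smooth_on S f"
  shows "smooth_on S (\<lambda>x. exp (f x))"
proof (rule smooth_on_compose[OF _ assms(2,1), of "UNIV"])
  show "smooth_on UNIV (exp :: real \<Rightarrow> real)"
    by (rule smooth_on_bootstrap[where H = "\<lambda>v z. snd z * v" and T = UNIV])
       (auto intro!: derivative_eq_intros smooth_on_minus smooth_on_mult smooth_on_snd smooth_on_const smooth_on_id)
qed auto

lemma smooth_on_sqrt:
  fixes f :: "'a::real_normed_vector \<Rightarrow> real"
  assumes "open S" "smooth_on S f" "\<And>x. x \<in> S \<Longrightarrow> f x > 0"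
  shows "smooth_on S (\<lambda>x. sqrt (f x))"
proof (rule smooth_on_compose[OF _ assms(2,1), of "{0<..}"])
  show "smooth_on {0<..} (sqrt :: real \<Rightarrow> real)"
    by (rule smooth_on_bootstrap[where H = "\<lambda>v z. v * inverse (2 * snd z)" and T = "UNIV \<times> {0<..}"])
       (auto intro!: derivative_eq_intros smooth_on_mult smooth_on_snd smooth_on_const smooth_on_id
         smooth_on_divide open_Times simp: divide_simps)
qed (use assms in auto)

lemmas smooth_intros =
  smooth_on_const smooth_on_id smooth_on_add smooth_on_diff smooth_on_minus smooth_on_mult smooth_on_scaleR
  smooth_on_power smooth_on_Pair smooth_on_fst smooth_on_snd smooth_on_vec_nth smooth_on_inverse
  smooth_on_divide smooth_on_exp smooth_on_sqrt

text \<open>Both mixed second derivatives are limits of the same second difference quotient, which the mean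
  value theorem, applied in one direction after the other, turns into a value of either of them.\<close>

lemma mixed_derivatives_eq_real:
  fixes f :: "'a::euclidean_space \<Rightarrow> real"
  assumes S: "open S" and f: "smooth_on S f" and p: "p \<in> S"
  shows "frechet_derivative (\<lambda>r. frechet_derivative f (at r) w) (at p) v =
         frechet_derivative (\<lambda>r. frechet_derivative f (at r) v) (at p) w"
proof -
  define d2 where "d2 v w r = frechet_derivative (\<lambda>r. frechet_derivative f (at r) w) (at r) v" for v w r
  have *: "\<exists>\<delta>>0. \<forall>h. 0 < h \<and> h < \<delta> \<longrightarrow>
      \<bar>(f (p + h *\<^sub>R v + h *\<^sub>R w) - f (p + h *\<^sub>R v) - f (p + h *\<^sub>R w) + f p) / h\<^sup>2 - d2 w v p\<bar> < e"
    if e: "e > 0" for v w e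
  proof -
    have "continuous_on S (d2 w v)"
      unfolding d2_def
      by (intro smooth_on_imp_continuous_on smooth_on_frechet_derivative f)
    then have "isCont (d2 w v) p" using S p by (simp add: continuous_on_eq_continuous_at)
    then obtain d where d: "d > 0" "\<And>r. dist r p < d \<Longrightarrow> \<bar>d2 w v r - d2 w v p\<bar> < e"
      using e unfolding continuous_at_eps_delta by (metis dist_real_def)
    obtain d' where d': "d' > 0" "ball p d' \<subseteq> S" using S p open_contains_ball by blast
    define \<delta> where "\<delta> = min d d' / (norm v + norm w + 1)"
    have n1: "norm v + norm w + 1 > 0" by (simp add: add_nonneg_pos)
    have \<delta>: "\<delta> > 0" unfolding \<delta>_def using d d' n1 by auto
    have inb: "dist (p + s *\<^sub>R v + t *\<^sub>R w) p < min d d'" if "0 \<le> s" "s \<le> h" "0 \<le> t" "t \<le> h" "h < \<delta>" for s t h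
    proof -
      have "norm (s *\<^sub>R v + t *\<^sub>R w) \<le> s * norm v + t * norm w"
        using norm_triangle_ineq[of "s *\<^sub>R v" "t *\<^sub>R w"] that by simp
      also have "\<dots> \<le> h * norm v + h * norm w"
        using that by (intro add_mono mult_right_mono) auto
      also have "\<dots> \<le> h * (norm v + norm w + 1)" using that by (simp add: algebra_simps)
      also have "\<dots> < \<delta> * (norm v + norm w + 1)" using that n1 by (intro mult_strict_right_mono)
      also have "\<dots> = min d d'" unfolding \<delta>_def using n1 by simp
      finally show ?thesis by (simp add: dist_norm add.assoc)
    qed
    have inS: "p + s *\<^sub>R v + t *\<^sub>R w \<in> S" if "0 \<le> s" "s \<le> h" "0 \<le> t" "t \<le> h" "h < \<delta>" for s t h
      using inb[OF that] d'(2) by (auto simp: dist_commute)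
    have "\<bar>(f (p + h *\<^sub>R v + h *\<^sub>R w) - f (p + h *\<^sub>R v) - f (p + h *\<^sub>R w) + f p) / h\<^sup>2 - d2 w v p\<bar> < e"
      if h: "0 < h" "h < \<delta>" for h
    proof -
      define g where "g s = f (p + s *\<^sub>R v + h *\<^sub>R w) - f (p + s *\<^sub>R v + 0 *\<^sub>R w)" for s
      define g' where "g' s = frechet_derivative f (at (p + s *\<^sub>R v + h *\<^sub>R w)) v -
          frechet_derivative f (at (p + s *\<^sub>R v + 0 *\<^sub>R w)) v" for s
      have f1: "((\<lambda>s. f (p + s *\<^sub>R v + t *\<^sub>R w)) has_real_derivative frechet_derivative f (at (p + s *\<^sub>R v + t *\<^sub>R w)) v) (at s)"
        if "0 \<le> s" "s \<le> h" "0 \<le> t" "t \<le> h" for s t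
      proof -
        have "((\<lambda>s. f (p + s *\<^sub>R v + t *\<^sub>R w)) has_derivative (\<lambda>x. frechet_derivative f (at (p + s *\<^sub>R v + t *\<^sub>R w)) (x *\<^sub>R v))) (at s)"
          by (rule has_derivative_compose[where g = f and f = "\<lambda>s. p + s *\<^sub>R v + t *\<^sub>R w"])
             (auto intro!: derivative_eq_intros smooth_on_has_derivative[OF f] inS[OF that h(2)])
        moreover have "linear (frechet_derivative f (at (p + s *\<^sub>R v + t *\<^sub>R w)))"
          using smooth_on_has_derivative[OF f] inS[OF that h(2)] has_derivative_linear by blast
        ultimately show ?thesis
          by (simp add: has_field_derivative_def linear_cmul mult_commute_abs)
      qed
      have "\<exists>z>0. z < h \<and> g h - g 0 = (h - 0) * g' z"
        by (rule MVT2[OF h(1)]) (auto simp: g_def[abs_def] g'_def intro!: DERIV_diff f1 f1[of _ 0, simplified] less_imp_le[OF h(1)])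
      then obtain z where z: "0 < z" "z < h" "g h - g 0 = h * g' z" by auto
      define k where "k t = frechet_derivative f (at (p + z *\<^sub>R v + t *\<^sub>R w)) v" for t
      have k1: "(k has_real_derivative d2 w v (p + z *\<^sub>R v + t *\<^sub>R w)) (at t)"
        if "0 \<le> t" "t \<le> h" for t
      proof -
        have i: "p + z *\<^sub>R v + t *\<^sub>R w \<in> S" using inS[of z h t] that z h by auto
        have sm: "smooth_on S (\<lambda>r. frechet_derivative f (at r) v)" by (intro smooth_on_frechet_derivative f)
        have "(k has_derivative (\<lambda>x. frechet_derivative (\<lambda>r. frechet_derivative f (at r) v) (at (p + z *\<^sub>R v + t *\<^sub>R w)) (x *\<^sub>R w))) (at t)"
          unfolding k_def
          by (rule has_derivative_compose[where g = "\<lambda>r. frechet_derivative f (at r) v" and f = "\<lambda>s. p + z *\<^sub>R v + s *\<^sub>R w"])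
             (auto intro!: derivative_eq_intros smooth_on_has_derivative[OF sm i])
        moreover have "linear (frechet_derivative (\<lambda>r. frechet_derivative f (at r) v) (at (p + z *\<^sub>R v + t *\<^sub>R w)))"
          using smooth_on_has_derivative[OF sm i] has_derivative_linear by blast
        ultimately show ?thesis
          by (simp add: has_field_derivative_def linear_cmul d2_def mult_commute_abs)
      qed
      have "\<exists>y>0. y < h \<and> k h - k 0 = (h - 0) * d2 w v (p + z *\<^sub>R v + y *\<^sub>R w)"
        by (rule MVT2[OF h(1)]) (auto intro: k1)
      then obtain y where y: "0 < y" "y < h" "k h - k 0 = h * d2 w v (p + z *\<^sub>R v + y *\<^sub>R w)" by auto
      have "g' z = k h - k 0" by (simp add: g'_def k_def)
      then have "f (p + h *\<^sub>R v + h *\<^sub>R w) - f (p + h *\<^sub>R v) - f (p + h *\<^sub>R w) + f p =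
         h\<^sup>2 * d2 w v (p + z *\<^sub>R v + y *\<^sub>R w)"
        using z(3) y(3) by (simp add: g_def power2_eq_square)
      then show ?thesis
        using d(2)[of "p + z *\<^sub>R v + y *\<^sub>R w"] inb[of z h y] z y h by simp
    qed
    then show ?thesis using \<delta> by blast
  qed
  have "\<bar>d2 w v p - d2 v w p\<bar> < e" if e: "e > 0" for e
  proof -
    have e2: "e/2 > 0" using e by simp
    obtain \<delta>1 where 1: "\<delta>1 > 0" "\<And>h. 0 < h \<Longrightarrow> h < \<delta>1 \<Longrightarrow>
      \<bar>(f (p + h *\<^sub>R v + h *\<^sub>R w) - f (p + h *\<^sub>R v) - f (p + h *\<^sub>R w) + f p) / h\<^sup>2 - d2 w v p\<bar> < e/2"
      using *[OF e2, of v w] by blast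
    obtain \<delta>2 where 2: "\<delta>2 > 0" "\<And>h. 0 < h \<Longrightarrow> h < \<delta>2 \<Longrightarrow>
      \<bar>(f (p + h *\<^sub>R w + h *\<^sub>R v) - f (p + h *\<^sub>R w) - f (p + h *\<^sub>R v) + f p) / h\<^sup>2 - d2 v w p\<bar> < e/2"
      using *[OF e2, of w v] by blast
    define h where "h = min \<delta>1 \<delta>2 / 2"
    have h: "0 < h" "h < \<delta>1" "h < \<delta>2" using 1(1) 2(1) by (auto simp: h_def min_def)
    have s: "f (p + h *\<^sub>R w + h *\<^sub>R v) - f (p + h *\<^sub>R w) - f (p + h *\<^sub>R v) + f p =
          f (p + h *\<^sub>R v + h *\<^sub>R w) - f (p + h *\<^sub>R v) - f (p + h *\<^sub>R w) + f p"
      by (simp add: algebra_simps)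
    show ?thesis using 1(2)[OF h(1,2)] 2(2)[OF h(1,3)] unfolding s by linarith
  qed
  then have "\<bar>d2 w v p - d2 v w p\<bar> \<le> 0" by (meson linorder_not_le order.irrefl)
  then have "d2 w v p = d2 v w p" by simp
  then show ?thesis by (simp add: d2_def)
qed

lemma frechet_derivative_linear_compose:
  assumes "bounded_linear L" "f differentiable at x"
  shows "frechet_derivative (\<lambda>x. L (f x)) (at x) v = L (frechet_derivative f (at x) v)"
  using frechet_derivative_at[OF bounded_linear.has_derivative[OF assms(1)
      assms(2)[unfolded frechet_derivative_works]]] by metis

lemma mixed_derivatives_eq:
  fixes f :: "'a::euclidean_space \<Rightarrow> 'b::euclidean_space"
  assumes S: "open S" and f: "smooth_on S f" and p: "p \<in> S"
  shows "frechet_derivative (\<lambda>r. frechet_derivative f (at r) w) (at p) v =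
         frechet_derivative (\<lambda>r. frechet_derivative f (at r) v) (at p) w"
proof (rule euclidean_eqI)
  fix b :: 'b assume "b \<in> Basis"
  have L: "bounded_linear (\<lambda>x::'b. x \<bullet> b)" by (rule bounded_linear_inner_left)
  have dd: "f differentiable at x" if "x \<in> S" for x
    using smooth_on_has_derivative[OF f that] differentiable_def by blast
  have e: "frechet_derivative (\<lambda>r. frechet_derivative (\<lambda>x. f x \<bullet> b) (at r) w) (at p) v =
        frechet_derivative (\<lambda>r. frechet_derivative f (at r) w) (at p) v \<bullet> b" for v w
  proof -
    have d1: "((\<lambda>r. frechet_derivative f (at r) w \<bullet> b) has_derivative
        (\<lambda>v. frechet_derivative (\<lambda>r. frechet_derivative f (at r) w) (at p) v \<bullet> b)) (at p)"
      by (intro bounded_linear.has_derivative[OF L] smooth_on_has_derivative[OF _ p]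
           smooth_on_frechet_derivative f)
    have "((\<lambda>r. frechet_derivative (\<lambda>x. f x \<bullet> b) (at r) w) has_derivative
        (\<lambda>v. frechet_derivative (\<lambda>r. frechet_derivative f (at r) w) (at p) v \<bullet> b)) (at p)"
      by (rule has_derivative_transform_within_open[OF d1 S p])
         (simp add: frechet_derivative_linear_compose[OF L dd])
    then show ?thesis using frechet_derivative_at by metis
  qed
  have "smooth_on S (\<lambda>x. f x \<bullet> b)" using smooth_on_linear_compose[OF S L f] .
  from mixed_derivatives_eq_real[OF S this p, of w v]
  show "frechet_derivative (\<lambda>r. frechet_derivative f (at r) w) (at p) v \<bullet> b =
         frechet_derivative (\<lambda>r. frechet_derivative f (at r) v) (at p) w \<bullet> b"
    unfolding e .
qed

section \<open>Inverse functions and differential equations\<close>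

text \<open>The derivative of the inverse is a rational expression in the derivatives of \<open>\<theta>\<close> at the
  value of the inverse, so the inverse inherits smoothness by the bootstrap principle.\<close>

lemma smooth_inverse_function:
  fixes \<theta> :: "real \<times> real \<Rightarrow> real \<times> real"
  assumes S: "open S" and sm: "smooth_on S \<theta>" and q: "q \<in> S"
    and inj: "inj (frechet_derivative \<theta> (at q))"
  obtains U V g where "open U" "U \<subseteq> S" "q \<in> U" "open V" "homeomorphism U V \<theta> g" "smooth_on V g"
    "\<And>y. y \<in> V \<Longrightarrow> inj (frechet_derivative g (at y))"
proof -
  define f' where "f' x = Blinfun (frechet_derivative \<theta> (at x))" for x
  have hd: "(\<theta> has_derivative frechet_derivative \<theta> (at x)) (at x)" if "x \<in> S" for x
    using smooth_on_has_derivative[OF sm that] .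
  have f': "blinfun_apply (f' x) = frechet_derivative \<theta> (at x)" if "x \<in> S" for x
    unfolding f'_def by (rule bounded_linear_Blinfun_apply, rule has_derivative_bounded_linear[OF hd[OF that]])
  have lin: "linear (frechet_derivative \<theta> (at x))" if "x \<in> S" for x
    using has_derivative_linear[OF hd[OF that]] .
  have contf: "continuous_on S f'"
  proof (rule continuous_on_blinfun_componentwise)
    fix v :: "real \<times> real"
    have "continuous_on S (\<lambda>x. frechet_derivative \<theta> (at x) v)"
      by (intro smooth_on_imp_continuous_on smooth_on_frechet_derivative sm)
    then show "continuous_on S (\<lambda>x. blinfun_apply (f' x) v)" using f' by simp
  qed
  have bijq: "bij (frechet_derivative \<theta> (at q))"
    using inj linear_injective_imp_surjective[OF lin[OF q] inj] by (simp add: bij_def)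
  define iq where "iq = Blinfun (inv (frechet_derivative \<theta> (at q)))"
  have "linear (inv (frechet_derivative \<theta> (at q)))"
    using lin[OF q] bijq by (simp add: inj_linear_imp_inv_linear bij_is_inj)
  then have iq: "blinfun_apply iq = inv (frechet_derivative \<theta> (at q))"
    unfolding iq_def by (intro bounded_linear_Blinfun_apply) (simp add: linear_conv_bounded_linear)
  have invf: "iq o\<^sub>L f' q = id_blinfun"
    by (rule blinfun_eqI) (simp add: iq f'[OF q] inv_f_f[OF inj])
  obtain U V g g' where UV: "open U" "U \<subseteq> S" "q \<in> U" "open V" "\<theta> q \<in> V" "homeomorphism U V \<theta> g"
    and g: "\<And>y. y \<in> V \<Longrightarrow> (g has_derivative (g' y)) (at y)"
    and g': "\<And>y. y \<in> V \<Longrightarrow> g' y = inv (blinfun_apply (f' (g y)))"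
    and bij: "\<And>y. y \<in> V \<Longrightarrow> bij (blinfun_apply (f' (g y)))"
    using inverse_function_theorem[OF S _ contf q invf] hd f' by metis
  have gU: "g y \<in> U" if "y \<in> V" for y using UV(6) that by (auto simp: homeomorphism_def)
  have bij': "bij (frechet_derivative \<theta> (at x))" if "x \<in> U" for x
  proof -
    have "\<theta> x \<in> V" "g (\<theta> x) = x" using UV(6) that by (auto simp: homeomorphism_def)
    then show ?thesis using bij[of "\<theta> x"] f'[of x] that UV(2) by auto
  qed
  \<comment> \<open>Cramer's rule expresses the derivative of the inverse through that of \<open>\<theta>\<close>.\<close>
  define a b where "a x = frechet_derivative \<theta> (at x) (1, 0)"
    and "b x = frechet_derivative \<theta> (at x) (0, 1)" for x
  define det where "det x = fst (a x) * snd (b x) - fst (b x) * snd (a x)" for x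
  define H where "H v z = (inverse (det (snd z)) * (fst v * snd (b (snd z)) - fst (b (snd z)) * snd v),
      inverse (det (snd z)) * (fst (a (snd z)) * snd v - snd (a (snd z)) * fst v))"
    for v :: "real \<times> real" and z :: "(real \<times> real) \<times> (real \<times> real)"
  have exp: "frechet_derivative \<theta> (at x) (s, t) = s *\<^sub>R a x + t *\<^sub>R b x" if "x \<in> S" for x s t
  proof -
    have "(s, t) = s *\<^sub>R (1, 0) + t *\<^sub>R (0::real, 1::real)" by simp
    then show ?thesis unfolding a_def b_def
      using linear_add[OF lin[OF that]] linear_cmul[OF lin[OF that]] by metis
  qed
  have det: "det x \<noteq> 0" if x: "x \<in> U" for x
  proof
    assume d0: "det x = 0"
    have xS: "x \<in> S" using x UV(2) by auto
    have inj: "w = 0" if "frechet_derivative \<theta> (at x) w = 0" for w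
      using bij'[OF x] that linear_0[OF lin[OF xS]] by (metis bij_def injD)
    have "frechet_derivative \<theta> (at x) (snd (b x), - snd (a x)) = 0"
      unfolding exp[OF xS] using d0 by (auto simp: det_def prod_eq_iff mult.commute)
    then have "snd (b x) = 0" "snd (a x) = 0" using inj[of "(snd (b x), - snd (a x))"] by (auto simp: zero_prod_def)
    moreover have "frechet_derivative \<theta> (at x) (fst (b x), - fst (a x)) = 0"
      unfolding exp[OF xS] using d0 calculation by (auto simp: det_def prod_eq_iff)
    then have "fst (b x) = 0" "fst (a x) = 0" using inj[of "(fst (b x), - fst (a x))"] by (auto simp: zero_prod_def)
    ultimately have "a x = 0" by (simp add: prod_eq_iff)
    then have "frechet_derivative \<theta> (at x) (1, 0) = 0" by (simp add: a_def)
    then show False using inj[of "(1, 0)"] by (simp add: zero_prod_def)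
  qed
  have g'H: "g' y v = H v (y, g y)" if y: "y \<in> V" for y v
  proof -
    have gy: "g y \<in> S" "g y \<in> U" using gU[OF y] UV(2) by auto
    have "frechet_derivative \<theta> (at (g y)) (H v (y, g y)) = v"
      unfolding H_def snd_conv exp[OF gy(1)] using det[OF gy(2)]
      by (auto simp: prod_eq_iff field_simps) (auto simp: det_def algebra_simps)
    then show ?thesis unfolding g'[OF y] f'[OF gy(1)]
      using bij'[OF gy(2)] by (metis bij_inv_eq_iff)
  qed
  have smg: "smooth_on V g"
  proof (rule smooth_on_bootstrap[where H = H and T = "UNIV \<times> U"])
    show "(g has_derivative (\<lambda>v. H v (y, g y))) (at y)" if "y \<in> V" for y
      using g[OF that] g'H[OF that] by (metis (no_types, lifting) has_derivative_eq_rhs ext)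
    have op: "open ((UNIV :: (real \<times> real) set) \<times> U)" using UV(1) by (intro open_Times) auto
    have d: "smooth_on (UNIV \<times> U) (\<lambda>z::(real \<times> real) \<times> real \<times> real. frechet_derivative \<theta> (at (snd z)) v)" for v
      by (rule smooth_on_compose[OF smooth_on_subset[OF smooth_on_frechet_derivative[OF sm] UV(2)]])
         (auto intro!: smooth_intros op UV)
    have ab: "smooth_on (UNIV \<times> U) (\<lambda>z::(real \<times> real) \<times> real \<times> real. a (snd z))"
      "smooth_on (UNIV \<times> U) (\<lambda>z::(real \<times> real) \<times> real \<times> real. b (snd z))"
      unfolding a_def b_def by (simp_all add: d)
    show "smooth_on (UNIV \<times> U) (H v)" for v
      unfolding H_def det_def
      by (intro smooth_intros op ab) (use det in \<open>auto simp: det_def\<close>)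
  qed (use UV gU in \<open>auto intro!: open_Times\<close>)
  have "inj (frechet_derivative g (at y))" if "y \<in> V" for y
  proof -
    have "frechet_derivative g (at y) = inv (frechet_derivative \<theta> (at (g y)))"
      using frechet_derivative_at[OF g[OF that]] g'[OF that] f'[of "g y"] gU[OF that] UV(2) by auto
    then show ?thesis using bij'[OF gU[OF that]] bij_imp_bij_inv bij_is_inj by metis
  qed
  with that UV smg show ?thesis by blast
qed

text \<open>A linear or, more generally, globally Lipschitz equation is solved by Picard iteration,
  which contracts the supremum norm on a short interval.\<close>

lemma local_ode_solution:
  fixes F :: "real \<Rightarrow> 'a::euclidean_space \<Rightarrow> 'a"
  assumes d: "d > 0" and F: "continuous_on (cball t0 d \<times> UNIV) (\<lambda>(t, y). F t y)"
    and L: "\<And>t x y. t \<in> cball t0 d \<Longrightarrow> norm (F t x - F t y) \<le> K * norm (x - y)"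
  obtains e y where "0 < e" "e \<le> d" "y t0 = y0"
    "\<And>t. t \<in> ball t0 e \<Longrightarrow> (y has_vector_derivative F t (y t)) (at t)"
proof -
  define e where "e = min d (1 / (8 * (\<bar>K\<bar> + 1)))"
  define a b where "a = t0 - e" and "b = t0 + e"
  have K1: "\<bar>K\<bar> + 1 > 0" by linarith
  have e: "0 < e" "e \<le> d" using d K1 by (auto simp: e_def)
  have eK: "e * (\<bar>K\<bar> + 1) \<le> 1/8"
  proof -
    have "e * (\<bar>K\<bar> + 1) \<le> 1 / (8 * (\<bar>K\<bar> + 1)) * (\<bar>K\<bar> + 1)"
      using K1 by (intro mult_right_mono) (auto simp: e_def)
    also have "\<dots> = 1/8" using K1 by (simp add: field_simps)
    finally show ?thesis .
  qed
  have ab: "a < b" "t0 \<in> {a..b}" "{a..b} \<subseteq> cball t0 d" "b - a = 2 * e"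
    using e by (auto simp: a_def b_def dist_real_def)
  define cl where "cl t = max a (min b t)" for t
  have cl: "cl t \<in> {a..b}" "t \<in> {a..b} \<Longrightarrow> cl t = t" for t using ab by (auto simp: cl_def)
  define G where "G g = (\<lambda>s. F s (apply_bcontfun g s))" for g :: "real \<Rightarrow>\<^sub>C 'a"
  have G: "continuous_on {a..b} (G g)" for g
  proof -
    have "continuous_on {a..b} (\<lambda>s. (\<lambda>(t, y). F t y) (s, apply_bcontfun g s))"
      by (rule continuous_on_compose2[OF F]) (use ab(3) in \<open>auto intro!: continuous_intros continuous_on_apply_bcontfun\<close>)
    then show ?thesis by (simp add: G_def)
  qed
  define P where "P g t = y0 + integral {a..cl t} (G g) - integral {a..t0} (G g)" for g t
  have contI: "continuous_on {a..b} (\<lambda>x. integral {a..x} (G g))" for g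
    by (rule indefinite_integral_continuous_1) (intro integrable_continuous_interval G)
  have P: "P g \<in> bcontfun" for g
  proof -
    have c: "continuous_on UNIV (P g)"
      unfolding P_def
      by (intro continuous_intros continuous_on_compose2[OF contI])
         (use cl in \<open>auto simp: cl_def intro!: continuous_intros\<close>)
    have "P g ` UNIV \<subseteq> P g ` {a..b}"
    proof safe
      fix t
      have "P g t = P g (cl t)" using cl by (simp add: P_def)
      then show "P g t \<in> P g ` {a..b}" using cl(1) by blast
    qed
    moreover have "compact (P g ` {a..b})"
      by (intro compact_continuous_image continuous_on_subset[OF c]) auto
    ultimately have "bounded (range (P g))" using bounded_subset compact_imp_bounded by blast
    then show ?thesis using c by (simp add: bcontfun_def)
  qed
  have P_apply: "apply_bcontfun (Bcontfun (P g)) = P g" for g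
    using P by (simp add: Bcontfun_inverse)
  have lip: "dist (Bcontfun (P g)) (Bcontfun (P h)) \<le> 1/2 * dist g h" for g h
  proof (rule dist_bound, unfold P_apply)
    fix t
    have sub: "norm (integral {a..s} (G g) - integral {a..s} (G h)) \<le> (\<bar>K\<bar> + 1) * dist g h * (2 * e)"
      if s: "s \<in> {a..b}" for s
    proof -
      have i: "continuous_on {a..s} (G g)" "continuous_on {a..s} (G h)"
        using s by (auto intro!: continuous_on_subset[OF G])
      have "norm (integral {a..s} (\<lambda>r. G g r - G h r)) \<le> (\<bar>K\<bar> + 1) * dist g h * (s - a)"
      proof (rule integral_bound)
        fix r assume r: "r \<in> {a..s}"
        have "norm (G g r - G h r) \<le> K * norm (apply_bcontfun g r - apply_bcontfun h r)"
          unfolding G_def by (rule L[OF subsetD[OF ab(3)]]) (use r s in auto)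
        also have "\<dots> \<le> (\<bar>K\<bar> + 1) * dist g h"
          by (intro mult_mono) (use dist_bounded[of g r h] in \<open>auto simp: dist_norm\<close>)
        finally show "norm (G g r - G h r) \<le> (\<bar>K\<bar> + 1) * dist g h" .
      qed (use s i in \<open>auto intro!: continuous_intros\<close>)
      also have "\<dots> \<le> (\<bar>K\<bar> + 1) * dist g h * (2 * e)"
        by (intro mult_left_mono) (use s ab(4) in auto)
      finally show ?thesis using i by (simp add: integral_diff integrable_continuous_interval)
    qed
    have "dist (P g t) (P h t) = norm ((integral {a..cl t} (G g) - integral {a..cl t} (G h)) -
        (integral {a..t0} (G g) - integral {a..t0} (G h)))"
      by (simp add: P_def dist_norm algebra_simps)
    also have "\<dots> \<le> (\<bar>K\<bar> + 1) * dist g h * (2 * e) + (\<bar>K\<bar> + 1) * dist g h * (2 * e)"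
      using norm_triangle_ineq4 sub[OF cl(1), of t] sub[OF ab(2)] by (smt (verit))
    also have "\<dots> = 4 * (e * (\<bar>K\<bar> + 1)) * dist g h" by (simp add: algebra_simps)
    also have "\<dots> \<le> 1/2 * dist g h" using eK by (intro mult_right_mono) auto
    finally show "dist (P g t) (P h t) \<le> 1/2 * dist g h" .
  qed
  obtain y where y: "Bcontfun (P y) = y"
    using banach_fix_type[of "1/2" "\<lambda>g. Bcontfun (P g)"] lip by auto
  have yP: "apply_bcontfun y = P y" using P_apply[of y] y by simp
  show ?thesis
  proof (rule that[of e "apply_bcontfun y"])
    show "apply_bcontfun y t0 = y0" unfolding yP by (simp add: P_def cl(2)[OF ab(2)])
    fix t assume t: "t \<in> ball t0 e"
    have tab: "t \<in> {a<..<b}" using t by (auto simp: a_def b_def dist_real_def)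
    have "((\<lambda>x. integral {a..x} (G y)) has_vector_derivative G y t) (at t within {a..b})"
      by (rule integral_has_vector_derivative[OF G]) (use tab in auto)
    then have "((\<lambda>x. integral {a..x} (G y)) has_vector_derivative G y t) (at t)"
      using tab at_within_interior[of t "{a..b}"] by auto
    then have "((\<lambda>x. y0 + integral {a..x} (G y) - integral {a..t0} (G y)) has_vector_derivative G y t) (at t)"
      by (auto intro!: derivative_eq_intros)
    then have "(apply_bcontfun y has_vector_derivative G y t) (at t)"
      by (rule has_vector_derivative_transform_within_open[of _ _ _ "{a<..<b}"])
         (use tab cl(2) in \<open>auto simp: yP P_def\<close>)
    then show "(apply_bcontfun y has_vector_derivative F t (apply_bcontfun y t)) (at t)" by (simp add: G_def)
  qed (use e in auto)
qed

lemma local_antiderivative: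
  fixes h :: "real \<Rightarrow> real"
  assumes J: "open J" "u0 \<in> J" and h: "smooth_on J h"
  obtains e H where "0 < e" "ball u0 e \<subseteq> J" "smooth_on (ball u0 e) H" "H u0 = h0"
    "\<And>u. u \<in> ball u0 e \<Longrightarrow> (H has_real_derivative h u) (at u)"
proof -
  obtain d where d: "d > 0" "cball u0 d \<subseteq> J" using J open_contains_cball by blast
  have c: "continuous_on (cball u0 d \<times> UNIV) (\<lambda>(t, y::real). h t)"
    unfolding split_beta
    by (rule continuous_on_compose2[OF smooth_on_imp_continuous_on[OF h]])
       (use d in \<open>auto intro!: continuous_intros\<close>)
  obtain e H where e: "0 < e" "e \<le> d" "H u0 = h0"
    "\<And>t. t \<in> ball u0 e \<Longrightarrow> (H has_vector_derivative h t) (at t)"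
    using local_ode_solution[OF d(1) c, of 0 h0] by auto
  have sub: "ball u0 e \<subseteq> J" using d e by auto
  have "smooth_on (ball u0 e) H"
  proof (rule smooth_on_bootstrap[where H = "\<lambda>v z. v * h (fst z)" and T = "ball u0 e \<times> UNIV"])
    show "(H has_derivative (\<lambda>v. v * h (fst (y, H y)))) (at y)" if "y \<in> ball u0 e" for y
      using e(4)[OF that] by (simp add: has_vector_derivative_def)
    have op: "open (ball u0 e \<times> (UNIV::real set))" by (intro open_Times) auto
    show "smooth_on (ball u0 e \<times> UNIV) (\<lambda>z::real \<times> real. v * h (fst z))" for v
      by (intro smooth_intros op smooth_on_compose[OF smooth_on_subset[OF h sub]]) auto
  qed (auto intro!: open_Times)
  with that e sub show ?thesis by (auto simp: has_real_derivative_iff_has_vector_derivative)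
qed

text \<open>A Riccati equation is the projectivisation of a linear system. Its flow is therefore a
  fractional linear function of the initial value, which makes the smooth dependence on the
  initial value explicit.\<close>

lemma riccati_flow:
  fixes p q r :: "real \<Rightarrow> real"
  assumes J: "open J" "u0 \<in> J" and sm: "smooth_on J p" "smooth_on J q" "smooth_on J r"
  obtains E V where "open E" "(u0, v0) \<in> E" "fst ` E \<subseteq> J" "smooth_on E (\<lambda>(u, v). V u v)" "V u0 v0 = v0"
    "\<And>u v. (u, v) \<in> E \<Longrightarrow> ((\<lambda>s. V s v) has_real_derivative p u * (V u v)\<^sup>2 + q u * V u v + r u) (at u)"
    "\<And>u v. (u, v) \<in> E \<Longrightarrow> \<exists>m. m \<noteq> 0 \<and> ((\<lambda>t. V u t) has_real_derivative m) (at v)"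
proof -
  obtain d where d: "d > 0" "cball u0 d \<subseteq> J" using J open_contains_cball by blast
  define F where "F t y = (q t / 2 * fst y + r t * snd y, - p t * fst y - q t / 2 * snd y)"
    for t and y :: "real \<times> real"
  have cpqr: "continuous_on (cball u0 d) p" "continuous_on (cball u0 d) q" "continuous_on (cball u0 d) r"
    using sm[THEN smooth_on_imp_continuous_on] d(2) continuous_on_subset by blast+
  have c: "continuous_on (cball u0 d \<times> UNIV) (\<lambda>(t, y). F t y)"
    unfolding F_def split_beta
    by (intro continuous_intros continuous_on_compose2[OF cpqr(1)] continuous_on_compose2[OF cpqr(2)]
        continuous_on_compose2[OF cpqr(3)]) auto
  have "compact ((\<lambda>t. \<bar>p t\<bar> + \<bar>q t\<bar> + \<bar>r t\<bar>) ` cball u0 d)"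
    by (intro compact_continuous_image continuous_intros cpqr) auto
  then have "bounded ((\<lambda>t. \<bar>p t\<bar> + \<bar>q t\<bar> + \<bar>r t\<bar>) ` cball u0 d)" by (rule compact_imp_bounded)
  then obtain K where K: "\<And>t. t \<in> cball u0 d \<Longrightarrow> \<bar>p t\<bar> + \<bar>q t\<bar> + \<bar>r t\<bar> \<le> K"
    unfolding bounded_iff by fastforce
  have L: "norm (F t x - F t y) \<le> K * norm (x - y)" if t: "t \<in> cball u0 d" for t x y
  proof -
    define n where "n = norm (x - y)"
    have 1: "\<bar>fst x - fst y\<bar> \<le> n" "\<bar>snd x - snd y\<bar> \<le> n"
      unfolding n_def using norm_fst_le[of "fst (x - y)" "snd (x - y)"] norm_snd_le[of "snd (x - y)" "fst (x - y)"]
      unfolding prod.collapse by auto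
    have mm: "\<bar>a * z\<bar> \<le> \<bar>a\<bar> * n" if "\<bar>z\<bar> \<le> n" for a z :: real
      unfolding abs_mult using that by (intro mult_left_mono) auto
    have "F t x - F t y = (q t / 2 * (fst x - fst y) + r t * (snd x - snd y),
        - p t * (fst x - fst y) - q t / 2 * (snd x - snd y))"
      by (simp add: F_def field_simps)
    then have "norm (F t x - F t y) \<le> \<bar>q t / 2 * (fst x - fst y) + r t * (snd x - snd y)\<bar>
        + \<bar>- p t * (fst x - fst y) - q t / 2 * (snd x - snd y)\<bar>"
      using norm_Pair_le by (metis real_norm_def)
    also have "\<dots> \<le> \<bar>q t / 2\<bar> * n + \<bar>r t\<bar> * n + \<bar>p t\<bar> * n + \<bar>q t / 2\<bar> * n"
    proof -
      have "\<bar>a + b\<bar> + \<bar>c - d\<bar> \<le> A + B + C + D" if "\<bar>a\<bar> \<le> A" "\<bar>b\<bar> \<le> B" "\<bar>c\<bar> \<le> C" "\<bar>d\<bar> \<le> D"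
        for a b c d A B C D :: real using that by linarith
      then show ?thesis
        using mm[OF 1(1), of "q t / 2"] mm[OF 1(2), of "r t"] mm[OF 1(1), of "- p t"] mm[OF 1(2), of "q t / 2"]
        by (metis abs_minus_cancel)
    qed
    also have "\<dots> = (\<bar>p t\<bar> + \<bar>q t\<bar> + \<bar>r t\<bar>) * n" by (simp add: algebra_simps)
    also have "\<dots> \<le> K * n" using K[OF t] by (intro mult_right_mono) (auto simp: n_def)
    finally show ?thesis by (simp add: n_def)
  qed
  obtain e1 y where y: "0 < e1" "e1 \<le> d" "y u0 = (1, 0)"
    "\<And>t. t \<in> ball u0 e1 \<Longrightarrow> (y has_vector_derivative F t (y t)) (at t)"
    using local_ode_solution[OF d(1) c L, of "(1, 0)"] by metis
  obtain e2 w where w: "0 < e2" "e2 \<le> d" "w u0 = (0, 1)"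
    "\<And>t. t \<in> ball u0 e2 \<Longrightarrow> (w has_vector_derivative F t (w t)) (at t)"
    using local_ode_solution[OF d(1) c L, of "(0, 1)"] by metis
  define e where "e = min e1 e2"
  define B where "B = ball u0 e"
  have B: "open B" "u0 \<in> B" "B \<subseteq> J" "B \<subseteq> ball u0 e1" "B \<subseteq> ball u0 e2"
    using y w d by (auto simp: B_def e_def subset_iff)
  have smF: "smooth_on B z" if z: "\<And>t. t \<in> B \<Longrightarrow> (z has_vector_derivative F t (z t)) (at t)" for z
  proof (rule smooth_on_bootstrap[where H = "\<lambda>v z. v *\<^sub>R F (fst z) (snd z)" and T = "B \<times> UNIV"])
    show "(z has_derivative (\<lambda>v. v *\<^sub>R F (fst (t, z t)) (snd (t, z t)))) (at t)" if "t \<in> B" for t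
      using z[OF that] by (simp add: has_vector_derivative_def)
    have op: "open (B \<times> (UNIV::(real \<times> real) set))" using B by (intro open_Times) auto
    have pqr: "smooth_on (B \<times> UNIV) (\<lambda>z::real \<times> real \<times> real. k (fst z))" if "smooth_on J k" for k :: "real \<Rightarrow> real"
      by (rule smooth_on_compose[OF that]) (use op J B in \<open>auto intro!: smooth_intros\<close>)
    show "smooth_on (B \<times> UNIV) (\<lambda>z. v *\<^sub>R F (fst z) (snd z))" for v
      unfolding F_def by (intro smooth_intros op pqr sm) auto
  qed (use B in \<open>auto intro!: open_Times\<close>)
  have smy: "smooth_on B y" "smooth_on B w" using smF y w B by blast+
  have dc: "((\<lambda>t. fst (z t)) has_real_derivative q t / 2 * fst (z t) + r t * snd (z t)) (at t)"
    "((\<lambda>t. snd (z t)) has_real_derivative - p t * fst (z t) - q t / 2 * snd (z t)) (at t)"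
    if "(z has_vector_derivative F t (z t)) (at t)" for z t
    using bounded_linear.has_vector_derivative[OF bounded_linear_fst that]
      bounded_linear.has_vector_derivative[OF bounded_linear_snd that]
    by (auto simp: F_def has_real_derivative_iff_has_vector_derivative)
  note dy = dc[OF y(4)] and dw = dc[OF w(4)]
  define N D where "N u v = fst (y u) * v + fst (w u)" and "D u v = snd (y u) * v + snd (w u)" for u v
  define V where "V u v = N u v / D u v" for u v
  \<comment> \<open>the linear system has trace zero, hence a constant Wronskian\<close>
  have W: "fst (y u) * snd (w u) - snd (y u) * fst (w u) = 1" if u: "u \<in> B" for u
  proof -
    define dt where "dt u = fst (y u) * snd (w u) - snd (y u) * fst (w u)" for u
    have "(dt has_real_derivative 0) (at u)" if u: "u \<in> B" for u
      unfolding dt_def using dy[of u] dw[of u] u B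
      by (auto intro!: derivative_eq_intros simp: algebra_simps subset_iff)
    then have "(dt has_derivative (\<lambda>h. 0)) (at u within B)" if "u \<in> B" for u
      using that by (auto simp: has_field_derivative_def mult_zero_class.mult_zero_left[abs_def] intro: has_derivative_at_withinI)
    then obtain k where k: "\<And>u. u \<in> B \<Longrightarrow> dt u = k"
      using has_derivative_zero_constant[of B dt] by (auto simp: B_def convex_ball)
    then have "k = 1" using k[OF B(2)] y(3) w(3) by (simp add: dt_def)
    then show ?thesis using k[OF u] by (simp add: dt_def)
  qed
  have op: "open (B \<times> (UNIV :: real set))" using B by (intro open_Times) auto
  have "smooth_on (B \<times> UNIV) (\<lambda>z::real \<times> real. k (fst z))" if "smooth_on B k" for k :: "real \<Rightarrow> real \<times> real"
    by (rule smooth_on_compose[OF that]) (use op B in \<open>auto intro!: smooth_intros\<close>)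
  note smyw = this[OF smy(1)] this[OF smy(2)]
  have smND: "smooth_on (B \<times> UNIV) (\<lambda>z. N (fst z) (snd z))" "smooth_on (B \<times> UNIV) (\<lambda>z. D (fst z) (snd z))"
    unfolding N_def D_def by (intro smooth_intros op smyw)+
  define E where "E = {z \<in> B \<times> UNIV. D (fst z) (snd z) \<in> - {0}}"
  have E: "open E" unfolding E_def
    by (rule continuous_open_preimage[OF smooth_on_imp_continuous_on[OF smND(2)] op, unfolded vimage_def, simplified Int_def mem_Collect_eq]) auto
  have EB: "u \<in> B" "D u v \<noteq> 0" if "(u, v) \<in> E" for u v using that by (auto simp: E_def)
  have "smooth_on E (\<lambda>z. N (fst z) (snd z) / D (fst z) (snd z))"
    by (intro smooth_intros E smooth_on_subset[OF smND(1)] smooth_on_subset[OF smND(2)])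
       (auto simp: E_def)
  then have smV: "smooth_on E (\<lambda>(u, v). V u v)" by (simp add: V_def case_prod_unfold)
  have dV: "((\<lambda>s. V s v) has_real_derivative p u * (V u v)\<^sup>2 + q u * V u v + r u) (at u)"
    if uv: "(u, v) \<in> E" for u v
  proof -
    have u: "u \<in> ball u0 e1" "u \<in> ball u0 e2" "D u v \<noteq> 0" using EB[OF uv] B by auto
    define n m where "n = N u v" and "m = D u v"
    have 1: "((\<lambda>s. N s v) has_real_derivative q u / 2 * n + r u * m) (at u)"
      unfolding N_def n_def m_def D_def using dy(1)[OF u(1)] dw(1)[OF u(2)]
      by (auto intro!: derivative_eq_intros simp: algebra_simps)
    have 2: "((\<lambda>s. D s v) has_real_derivative - p u * n - q u / 2 * m) (at u)"
      unfolding N_def n_def m_def D_def using dy(2)[OF u(1)] dw(2)[OF u(2)]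
      by (auto intro!: derivative_eq_intros simp: algebra_simps)
    have "((\<lambda>s. V s v) has_real_derivative ((q u / 2 * n + r u * m) * m - n * (- p u * n - q u / 2 * m)) / (m * m)) (at u)"
      unfolding V_def n_def m_def using DERIV_divide[OF 1 2 u(3)] by (simp add: n_def m_def)
    moreover have "((q u / 2 * n + r u * m) * m - n * (- p u * n - q u / 2 * m)) / (m * m)
       = p u * (V u v)\<^sup>2 + q u * V u v + r u"
      using u(3) unfolding V_def n_def[symmetric] m_def[symmetric]
      by (simp add: field_simps power2_eq_square)
    ultimately show ?thesis by simp
  qed
  have dV2: "\<exists>m. m \<noteq> 0 \<and> ((\<lambda>t. V u t) has_real_derivative m) (at v)" if uv: "(u, v) \<in> E" for u v
  proof -
    note u = EB[OF uv]
    have "((\<lambda>t. V u t) has_real_derivative (fst (y u) * D u v - N u v * snd (y u)) / (D u v * D u v)) (at v)"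
      unfolding V_def
      by (rule DERIV_divide) (use u in \<open>auto simp: N_def D_def intro!: derivative_eq_intros\<close>)
    moreover have "fst (y u) * D u v - N u v * snd (y u) = 1"
      using W[OF u(1)] by (simp add: N_def D_def algebra_simps)
    ultimately show ?thesis using u(2) by (auto intro!: exI[of _ "1 / (D u v * D u v)"])
  qed
  show ?thesis
    by (rule that[OF E _ _ smV _ dV dV2])
       (use B y w in \<open>auto simp: E_def D_def N_def V_def\<close>)
qed

section \<open>The metrics\<close>

interpretation lprod: bounded_bilinear "lprod c" for c
  unfolding bilinear_conv_bounded_bilinear[symmetric] bilinear_def linear_iff
  by (auto simp: lprod_def algebra_simps)

lemma lprod_commute: "lprod c x y = lprod c y x"
  by (simp add: lprod_def algebra_simps)

lemma lprod_nondegenerate: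
  assumes "\<And>z. lprod c x z = 0" shows "x = 0"
proof -
  have "x $ i = 0" for i
    using assms[of "axis i 1"] exhaust_4[of i] by (auto simp: lprod_def axis_def split: if_splits)
  then show ?thesis by (simp add: vec_eq_iff)
qed

lemma wmetric_bilinear: "bounded_bilinear (wmetric c f p)"
  unfolding bilinear_conv_bounded_bilinear[symmetric] bilinear_def linear_iff
  by (auto simp: wmetric_def algebra_simps lprod.add_left lprod.add_right lprod.scaleR_left lprod.scaleR_right)

interpretation wmetric: bounded_bilinear "wmetric c f p" for c f p
  by (rule wmetric_bilinear)

lemma wmetric_commute: "wmetric c f p X Y = wmetric c f p Y X"
  by (simp add: wmetric_def lprod_commute mult.commute)

lemma wmetric_dz: "wmetric c f p dz X = snd X"
  by (simp add: wmetric_def dz_def lprod.zero_left)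

lemma wmetric_nondegenerate:
  assumes "f (snd p) \<noteq> 0" "\<And>Z. wmetric c f p X Z = 0" shows "X = 0"
proof -
  have "snd X = 0" using assms(2)[of dz] wmetric_dz wmetric_commute by metis
  moreover have "fst X = 0"
  proof (rule lprod_nondegenerate)
    show "lprod c (fst X) z = 0" for z using assms(2)[of "(z, 0)"] assms(1) by (simp add: wmetric_def)
  qed
  ultimately show ?thesis by (simp add: prod_eq_iff)
qed

text \<open>If every vector has an orthogonal projection to \<open>W\<close>, then \<open>W\<close> is nondegenerate, so the
  projection is unique and \<open>tan_part\<close> is that projection.\<close>

lemma
  assumes f: "f (snd p) \<noteq> 0" and W: "subspace W"
    and ex: "\<And>v. \<exists>t\<in>W. \<forall>w\<in>W. wmetric c f p (v - t) w = 0"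
  shows nondegenerate_subspace: "s \<in> W \<Longrightarrow> (\<And>w. w \<in> W \<Longrightarrow> wmetric c f p s w = 0) \<Longrightarrow> s = 0"
    and tan_part_mem: "tan_part (wmetric c f p) W v \<in> W"
    and tan_part_orthogonal: "w \<in> W \<Longrightarrow> wmetric c f p (v - tan_part (wmetric c f p) W v) w = 0"
proof -
  have nd: "s = 0" if s: "s \<in> W" "\<And>w. w \<in> W \<Longrightarrow> wmetric c f p s w = 0" for s
  proof (rule wmetric_nondegenerate[where f = f and p = p and c = c, OF f])
    fix Z
    obtain t where t: "t \<in> W" "wmetric c f p (Z - t) s = 0" using ex[of Z] s(1) by blast
    show "wmetric c f p s Z = 0"
      using s(2)[OF t(1)] t(2) by (metis wmetric.diff_left wmetric_commute diff_zero)
  qed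
  then show "s \<in> W \<Longrightarrow> (\<And>w. w \<in> W \<Longrightarrow> wmetric c f p s w = 0) \<Longrightarrow> s = 0" .
  have uniq: "t = t'" if "t \<in> W" "t' \<in> W" "\<forall>w\<in>W. wmetric c f p (v - t) w = 0"
      "\<forall>w\<in>W. wmetric c f p (v - t') w = 0" for t t'
  proof -
    have "t - t' = 0"
    proof (rule nd)
      show "t - t' \<in> W" using that W subspace_diff by blast
      show "wmetric c f p (t - t') w = 0" if w: "w \<in> W" for w
        using w \<open>\<forall>w\<in>W. wmetric c f p (v - t) w = 0\<close> \<open>\<forall>w\<in>W. wmetric c f p (v - t') w = 0\<close>
        by (simp add: wmetric.diff_left)
    qed
    then show ?thesis by simp
  qed
  have ex1: "\<exists>!t. t \<in> W \<and> (\<forall>w\<in>W. wmetric c f p (v - t) w = 0)" using ex[of v] uniq by blast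
  show "tan_part (wmetric c f p) W v \<in> W"
    "w \<in> W \<Longrightarrow> wmetric c f p (v - tan_part (wmetric c f p) W v) w = 0"
    using theI'[OF ex1] by (auto simp: tan_part_def)
qed

lemma span_two: "x \<in> span {X, Y} \<longleftrightarrow> (\<exists>a b. x = a *\<^sub>R X + b *\<^sub>R Y)" for X :: "'a::real_vector"
proof -
  have "x \<in> span {X, Y} \<longleftrightarrow> (\<exists>k l. x - k *\<^sub>R X = l *\<^sub>R Y)"
    by (auto simp: span_breakdown_eq span_singleton)
  also have "\<dots> \<longleftrightarrow> (\<exists>a b. x = a *\<^sub>R X + b *\<^sub>R Y)"
    by (simp add: diff_eq_eq add.commute)
  finally show ?thesis .
qed

text \<open>A null vector \<open>a X + b Y \<noteq> 0\<close> has \<open>a\<^sup>2 = b\<^sup>2 \<noteq> 0\<close>. Orthogonality to it is one nontrivial linear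
  equation in the plane, and the vector itself is a solution.\<close>

lemma lorentz_plane_null_complement:
  assumes X: "wmetric c f p X X = -1" and Y: "wmetric c f p Y Y = 1" and XY: "wmetric c f p X Y = 0"
    and T: "T \<in> span {X, Y}" "T \<noteq> 0" "wmetric c f p T T = 0"
    and S: "S \<in> span {X, Y}" "wmetric c f p S T = 0"
  shows "\<exists>k. S = k *\<^sub>R T"
proof -
  obtain a b where ab: "T = a *\<^sub>R X + b *\<^sub>R Y" using T by (auto simp: span_two)
  obtain s t where st: "S = s *\<^sub>R X + t *\<^sub>R Y" using S by (auto simp: span_two)
  have YX: "wmetric c f p Y X = 0" using XY wmetric_commute by metis
  note b = wmetric.add_left wmetric.add_right wmetric.scaleR_left wmetric.scaleR_right X Y XY YX
  have 1: "b * b = a * a" using T(3) unfolding ab by (simp add: b)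
  have 2: "t * b = s * a" using S(2) unfolding st ab by (simp add: b mult.commute)
  have a: "a \<noteq> 0" using 1 T(2) ab by auto
  have b: "b \<noteq> 0" using 1 a by auto
  have "t = s / a * b"
  proof -
    have "t * b = (s / a * b) * b" using 2 1 a by (simp add: field_simps)
    then show ?thesis using b mult_cancel_right by blast
  qed
  then have "S = (s / a) *\<^sub>R T" using a unfolding st ab by (simp add: scaleR_add_right)
  then show ?thesis ..
qed

definition second_derivative :: "('a::real_normed_vector \<Rightarrow> 'b::real_normed_vector) \<Rightarrow> 'a \<Rightarrow> 'a \<Rightarrow> 'a \<Rightarrow> 'b" where
  "second_derivative \<phi> q w w' = frechet_derivative (\<lambda>r. frechet_derivative \<phi> (at r) w') (at q) w"

locale warped_space_form =
  fixes c :: real and f :: "real \<Rightarrow> real" and I :: "real set"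
  assumes c: "c \<in> {-1, 0, 1}" and open_I: "open I" and smooth_f: "smooth_on I f"
    and f_pos: "z \<in> I \<Longrightarrow> 0 < f z"
begin

lemma f_has_derivative: "z \<in> I \<Longrightarrow> (f has_real_derivative deriv f z) (at z)"
  using smooth_on_has_derivative[OF smooth_f, of z]
  by (metis DERIV_deriv_iff_real_differentiable differentiable_def)

lemma snd_ambient: "p \<in> ambient c I \<Longrightarrow> snd p \<in> I"
  by (auto simp: ambient_def)

lemma f_nonzero: "p \<in> ambient c I \<Longrightarrow> f (snd p) \<noteq> 0"
  using f_pos snd_ambient by fastforce

lemma subspace_ambient_tangent: "subspace (ambient_tangent c p)"
  unfolding ambient_tangent_def space_form_tangent_def
  by (intro subspace_Times subspace_UNIV)
     (simp add: subspace_def lprod.zero_right lprod.add_right lprod.scaleR_right)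

text \<open>The normal of the space form at \<open>p\<close> is the position vector, or the fourth axis if \<open>c = 0\<close>.\<close>

lemma ambient_projection_exists:
  assumes p: "p \<in> ambient c I"
  shows "\<exists>t\<in>ambient_tangent c p. \<forall>w\<in>ambient_tangent c p. wmetric c f p (v - t) w = 0"
proof (cases "c = 0")
  case True
  show ?thesis
    by (rule bexI[of _ "(fst v - (fst v $ 4) *\<^sub>R axis 4 1, snd v)"])
       (auto simp: True ambient_tangent_def space_form_tangent_def wmetric_def lprod_def axis_def)
next
  case False
  have pp: "lprod c (fst p) (fst p) = c" using p False by (auto simp: ambient_def space_form_def)
  have cc: "c * c = 1" using c False by auto
  show ?thesis
    by (rule bexI[of _ "(fst v - (c * lprod c (fst p) (fst v)) *\<^sub>R fst p, snd v)"])
       (use False in \<open>auto simp: ambient_tangent_def space_form_tangent_def wmetric_def lprod.diff_right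
          lprod.scaleR_right lprod.scaleR_left pp cc algebra_simps\<close>)
qed

lemma ambient_nondegenerate:
  assumes p: "p \<in> ambient c I" and "s \<in> ambient_tangent c p"
    "\<And>w. w \<in> ambient_tangent c p \<Longrightarrow> wmetric c f p s w = 0"
  shows "s = 0"
  using nondegenerate_subspace[where f = f and c = c and p = p, OF f_nonzero[OF p] subspace_ambient_tangent
      ambient_projection_exists[OF p]] assms(2,3) by blast

lemma derivative_in_ambient_tangent:
  assumes h: "(h has_derivative h') (at x)" and S: "open S" "x \<in> S" and amb: "\<And>y. y \<in> S \<Longrightarrow> h y \<in> ambient c I"
  shows "h' w \<in> ambient_tangent c (h x)"
proof -
  note d = has_derivative_fst[OF h]
  show ?thesis
  proof (cases "c = 0")
    case True
    have "fst (h' w) $ 4 = 0"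
      by (rule derivative_of_constant[OF bounded_linear.has_derivative[OF bounded_linear_vec_nth d] S])
         (use True in \<open>auto dest!: amb simp: ambient_def space_form_def mem_Times_iff\<close>)
    then show ?thesis using True by (simp add: ambient_tangent_def space_form_tangent_def mem_Times_iff)
  next
    case False
    have "lprod c (fst (h x)) (fst (h' w)) + lprod c (fst (h' w)) (fst (h x)) = 0"
      by (rule derivative_of_constant[OF lprod.FDERIV[OF d d] S])
         (use False in \<open>auto dest!: amb simp: ambient_def space_form_def mem_Times_iff\<close>)
    then have "2 * lprod c (fst (h x)) (fst (h' w)) = 0" unfolding lprod_commute[of c "fst (h' w)"] by simp
    then show ?thesis using False by (simp add: ambient_tangent_def space_form_tangent_def mem_Times_iff)
  qed
qed

lemma christoffel_eq:
  assumes "snd p \<in> I"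
  shows "christoffel c f p X Y Z = f (snd p) * deriv f (snd p) *
    (snd X * lprod c (fst Y) (fst Z) + snd Y * lprod c (fst X) (fst Z) - snd Z * lprod c (fst X) (fst Y))"
proof -
  have "((\<lambda>q::point. wmetric c f q Y Z) has_derivative
      (\<lambda>X. 2 * f (snd p) * deriv f (snd p) * snd X * lprod c (fst Y) (fst Z))) (at p)" for Y Z
  proof -
    have "((\<lambda>q::point. f (snd q)) has_derivative (\<lambda>X. deriv f (snd p) * snd X)) (at p)"
      using has_derivative_compose[OF has_derivative_snd[OF has_derivative_ident]
          f_has_derivative[OF assms, unfolded has_field_derivative_def]] .
    then show ?thesis
      unfolding wmetric_def by (auto intro!: derivative_eq_intros simp: algebra_simps)
  qed
  then have "frechet_derivative (\<lambda>q::point. wmetric c f q Y Z) (at p) =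
      (\<lambda>X. 2 * f (snd p) * deriv f (snd p) * snd X * lprod c (fst Y) (fst Z))" for Y Z
    using frechet_derivative_at by metis
  then show ?thesis unfolding christoffel_def
    by (simp add: lprod_commute[of c "fst Y" "fst X"] field_simps)
qed

lemma wmetric_flat_cov:
  assumes p: "\<phi> q \<in> ambient c I"
  shows "wmetric c f (\<phi> q) (flat_cov c f \<phi> Y q w) Z =
        wmetric c f (\<phi> q) (frechet_derivative Y (at q) w) Z
        + christoffel c f (\<phi> q) (frechet_derivative \<phi> (at q) w) (Y q) Z"
proof -
  define X where "X = frechet_derivative \<phi> (at q) w"
  define h where "h = f (snd (\<phi> q))"
  have h: "h \<noteq> 0" using f_nonzero[OF p] by (simp add: h_def)
  \<comment> \<open>the connection of a warped product: \<open>f'/f\<close> mixes the components, and two horizontal vectors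
    contribute a multiple of \<open>\<partial>/\<partial>z\<close>\<close>
  define E :: point where "E = frechet_derivative Y (at q) w +
    ((deriv f (snd (\<phi> q)) / h) *\<^sub>R (snd X *\<^sub>R fst (Y q) + snd (Y q) *\<^sub>R fst X),
     - h * deriv f (snd (\<phi> q)) * lprod c (fst X) (fst (Y q)))"
  have E: "\<forall>Z. wmetric c f (\<phi> q) E Z = wmetric c f (\<phi> q) (frechet_derivative Y (at q) w) Z
        + christoffel c f (\<phi> q) X (Y q) Z"
    unfolding E_def christoffel_eq[OF snd_ambient[OF p]] wmetric.add_left
    using h by (auto simp: wmetric_def h_def[symmetric] lprod.add_left lprod.scaleR_left field_simps power2_eq_square)
  have "flat_cov c f \<phi> Y q w = E"
    unfolding flat_cov_def
  proof (rule the_equality)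
    show "\<forall>Z. wmetric c f (\<phi> q) E Z = wmetric c f (\<phi> q) (frechet_derivative Y (at q) w) Z
        + christoffel c f (\<phi> q) (frechet_derivative \<phi> (at q) w) (Y q) Z"
      using E by (simp add: X_def)
    fix D assume "\<forall>Z. wmetric c f (\<phi> q) D Z = wmetric c f (\<phi> q) (frechet_derivative Y (at q) w) Z
        + christoffel c f (\<phi> q) (frechet_derivative \<phi> (at q) w) (Y q) Z"
    then have "wmetric c f (\<phi> q) D Z = wmetric c f (\<phi> q) E Z" for Z
      using E by (simp only: X_def)
    then have "wmetric c f (\<phi> q) (D - E) Z = 0" for Z
      by (simp add: wmetric.diff_left)
    then have "D - E = 0" using wmetric_nondegenerate[of f "\<phi> q"] f_nonzero[OF p] by blast
    then show "D = E" by simp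
  qed
  then show ?thesis using E by (simp only: X_def)
qed

lemma wmetric_cov:
  assumes p: "\<phi> q \<in> ambient c I" and \<xi>: "\<xi> \<in> ambient_tangent c (\<phi> q)"
  shows "wmetric c f (\<phi> q) (cov c f \<phi> Y q w) \<xi> =
        wmetric c f (\<phi> q) (frechet_derivative Y (at q) w) \<xi>
        + christoffel c f (\<phi> q) (frechet_derivative \<phi> (at q) w) (Y q) \<xi>"
  using tan_part_orthogonal[where f = f and p = "\<phi> q" and c = c, OF f_nonzero[OF p] subspace_ambient_tangent
      ambient_projection_exists[OF p] \<xi>] wmetric_flat_cov[where \<phi> = \<phi> and q = q, OF p]
  by (simp add: cov_def wmetric.diff_left)

end

section \<open>The class A condition in a chart\<close>

text \<open>A chart of a time-like surface with light-like \<open>T\<close>, as a bare parametrisation.\<close>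

locale lightlike_chart = warped_space_form c f I for c f I +
  fixes D :: "(real \<times> real) set" and \<phi> :: "real \<times> real \<Rightarrow> point"
  assumes open_D: "open D" and smooth_chart: "smooth_on D \<phi>"
    and chart_ambient: "q \<in> D \<Longrightarrow> \<phi> q \<in> ambient c I"
    and chart_inj: "q \<in> D \<Longrightarrow> inj (frechet_derivative \<phi> (at q))"
    and chart_lorentz: "q \<in> D \<Longrightarrow> \<exists>X Y. tangent_plane \<phi> q = span {X, Y} \<and>
           wmetric c f (\<phi> q) X X = -1 \<and> wmetric c f (\<phi> q) Y Y = 1 \<and> wmetric c f (\<phi> q) X Y = 0"
    and chart_T: "q \<in> D \<Longrightarrow> T_field c f \<phi> q \<noteq> 0"
    and chart_T_null: "q \<in> D \<Longrightarrow> wmetric c f (\<phi> q) (T_field c f \<phi> q) (T_field c f \<phi> q) = 0"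
begin

abbreviation d\<phi> :: "real \<times> real \<Rightarrow> real \<times> real \<Rightarrow> point" where
  "d\<phi> q \<equiv> frechet_derivative \<phi> (at q)"

lemma d\<phi>: "q \<in> D \<Longrightarrow> (\<phi> has_derivative d\<phi> q) (at q)"
  using smooth_on_has_derivative[OF smooth_chart] .

lemma linear_d\<phi>: "q \<in> D \<Longrightarrow> linear (d\<phi> q)"
  using d\<phi> has_derivative_linear by blast

lemma linear_second_derivative:
  assumes q: "q \<in> D" shows "linear (second_derivative \<phi> q w)" "linear (\<lambda>w. second_derivative \<phi> q w w')"
proof -
  have 1: "linear (\<lambda>w. second_derivative \<phi> q w w')" for w'
    unfolding second_derivative_def
    using smooth_on_has_derivative[OF smooth_on_frechet_derivative[OF smooth_chart] q] has_derivative_linear by blast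
  moreover have "second_derivative \<phi> q w w' = second_derivative \<phi> q w' w" for w w'
    unfolding second_derivative_def by (rule mixed_derivatives_eq[OF open_D smooth_chart q])
  then have "second_derivative \<phi> q w = (\<lambda>w'. second_derivative \<phi> q w' w)" by blast
  ultimately show "linear (second_derivative \<phi> q w)" by simp
  show "linear (\<lambda>w. second_derivative \<phi> q w w')" by (rule 1)
qed

lemma subspace_tangent_plane: "q \<in> D \<Longrightarrow> subspace (tangent_plane \<phi> q)"
  unfolding tangent_plane_def using linear_subspace_image[OF linear_d\<phi> subspace_UNIV] .

lemma tangent_plane_mem: "d\<phi> q w \<in> tangent_plane \<phi> q"
  by (simp add: tangent_plane_def)

lemma tangent_projection_exists:
  assumes q: "q \<in> D"
  shows "\<exists>t\<in>tangent_plane \<phi> q. \<forall>w\<in>tangent_plane \<phi> q. wmetric c f (\<phi> q) (v - t) w = 0"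
proof -
  obtain X Y where XY: "tangent_plane \<phi> q = span {X, Y}" "wmetric c f (\<phi> q) X X = -1"
    "wmetric c f (\<phi> q) Y Y = 1" "wmetric c f (\<phi> q) X Y = 0" using chart_lorentz[OF q] by blast
  have YX: "wmetric c f (\<phi> q) Y X = 0" using XY(4) wmetric_commute by metis
  show ?thesis
  proof
    show "(- wmetric c f (\<phi> q) v X) *\<^sub>R X + wmetric c f (\<phi> q) v Y *\<^sub>R Y \<in> tangent_plane \<phi> q"
      unfolding XY(1) span_two by blast
  qed (auto simp: XY YX span_two wmetric.diff_left wmetric.add_left wmetric.add_right wmetric.minus_left
         wmetric.scaleR_left wmetric.scaleR_right)
qed

lemma
  assumes q: "q \<in> D"
  shows tangent_nondegenerate: "s \<in> tangent_plane \<phi> q \<Longrightarrow>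
      (\<And>w. w \<in> tangent_plane \<phi> q \<Longrightarrow> wmetric c f (\<phi> q) s w = 0) \<Longrightarrow> s = 0"
    and tangent_part_mem: "tan_part (wmetric c f (\<phi> q)) (tangent_plane \<phi> q) v \<in> tangent_plane \<phi> q"
    and tangent_part_orthogonal: "w \<in> tangent_plane \<phi> q \<Longrightarrow>
      wmetric c f (\<phi> q) (v - tan_part (wmetric c f (\<phi> q)) (tangent_plane \<phi> q) v) w = 0"
  using nondegenerate_subspace[where f = f and c = c and p = "\<phi> q", OF f_nonzero[OF chart_ambient[OF q]]
      subspace_tangent_plane[OF q] tangent_projection_exists[OF q]]
    tan_part_mem[where f = f and c = c and p = "\<phi> q", OF f_nonzero[OF chart_ambient[OF q]]
      subspace_tangent_plane[OF q] tangent_projection_exists[OF q]]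
    tan_part_orthogonal[where f = f and c = c and p = "\<phi> q", OF f_nonzero[OF chart_ambient[OF q]]
      subspace_tangent_plane[OF q] tangent_projection_exists[OF q]]
  by blast+

lemma T_mem: "q \<in> D \<Longrightarrow> T_field c f \<phi> q \<in> tangent_plane \<phi> q"
  unfolding T_field_def by (rule tangent_part_mem)

text \<open>\<open>T\<close> is the gradient of the height on the surface.\<close>

lemma wmetric_T:
  assumes q: "q \<in> D" and X: "X \<in> tangent_plane \<phi> q"
  shows "wmetric c f (\<phi> q) (T_field c f \<phi> q) X = snd X"
  using tangent_part_orthogonal[OF q X, of dz] unfolding T_field_def
  by (simp add: wmetric.diff_left wmetric_dz)

text \<open>Horizontal means orthogonal to \<open>T\<close>, and the orthogonal complement of a null vector in the
  Lorentzian tangent plane is its line.\<close>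

lemma horizontal_iff_parallel_T:
  assumes q: "q \<in> D" and X: "X \<in> tangent_plane \<phi> q"
  shows "snd X = 0 \<longleftrightarrow> (\<exists>k. X = k *\<^sub>R T_field c f \<phi> q)"
proof
  assume "snd X = 0"
  then have "wmetric c f (\<phi> q) X (T_field c f \<phi> q) = 0" using wmetric_T[OF q X] wmetric_commute by metis
  then show "\<exists>k. X = k *\<^sub>R T_field c f \<phi> q"
    using chart_lorentz[OF q] lorentz_plane_null_complement T_mem[OF q] chart_T[OF q] chart_T_null[OF q] X by metis
next
  assume "\<exists>k. X = k *\<^sub>R T_field c f \<phi> q"
  then show "snd X = 0" using wmetric_T[OF q T_mem[OF q]] chart_T_null[OF q] by auto
qed

lemma horizontal_null:
  assumes q: "q \<in> D" and w: "snd (d\<phi> q w) = 0"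
  shows "lprod c (fst (d\<phi> q w)) (fst (d\<phi> q w)) = 0"
proof -
  obtain k where k: "d\<phi> q w = k *\<^sub>R T_field c f \<phi> q"
    using horizontal_iff_parallel_T[OF q tangent_plane_mem] w by blast
  then have "wmetric c f (\<phi> q) (d\<phi> q w) (d\<phi> q w) = 0"
    using chart_T_null[OF q] by (simp add: wmetric.scaleR_left wmetric.scaleR_right)
  then show ?thesis using w f_nonzero[OF chart_ambient[OF q]] by (simp add: wmetric_def)
qed

lemma not_horizontal_exists:
  assumes q: "q \<in> D" shows "\<exists>w. snd (d\<phi> q w) \<noteq> 0"
proof (rule ccontr)
  assume a: "\<not> (\<exists>w. snd (d\<phi> q w) \<noteq> 0)"
  have "wmetric c f (\<phi> q) (T_field c f \<phi> q) X = 0" if "X \<in> tangent_plane \<phi> q" for X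
    using wmetric_T[OF q that] a that by (auto simp: tangent_plane_def)
  then show False using tangent_nondegenerate[OF q T_mem[OF q]] chart_T[OF q] by blast
qed

lemma wmetric_second_ff:
  assumes q: "q \<in> D" and \<xi>: "\<xi> \<in> normal_space c f \<phi> q"
  shows "wmetric c f (\<phi> q) (second_ff c f \<phi> q w w') \<xi> =
    wmetric c f (\<phi> q) (second_derivative \<phi> q w w') \<xi> + christoffel c f (\<phi> q) (d\<phi> q w) (d\<phi> q w') \<xi>"
proof -
  have \<xi>': "\<xi> \<in> ambient_tangent c (\<phi> q)" "X \<in> tangent_plane \<phi> q \<Longrightarrow> wmetric c f (\<phi> q) X \<xi> = 0" for X
    using \<xi> wmetric_commute by (auto simp: normal_space_def)
  show ?thesis
    unfolding second_ff_def Let_def wmetric.diff_left wmetric_cov[where \<phi> = \<phi> and q = q, OF chart_ambient[OF q] \<xi>'(1)]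
    using \<xi>'(2)[OF tangent_part_mem[OF q]] by (simp add: second_derivative_def)
qed

text \<open>The shape operator preserves the line of the null vector \<open>T\<close> iff \<open>\<langle>A\<^sub>\<xi> T, T\<rangle>\<close> vanishes, and
  on a horizontal null vector the Christoffel symbols vanish. Class A is therefore a condition on
  the second derivatives of the chart alone.\<close>

lemma shape_op_T_eigenvector_iff:
  assumes q: "q \<in> D" and \<xi>: "\<xi> \<in> normal_space c f \<phi> q"
  shows "(\<exists>k. shape_op c f \<phi> q \<xi> (T_field c f \<phi> q) = k *\<^sub>R T_field c f \<phi> q) \<longleftrightarrow>
    (\<forall>w. snd (d\<phi> q w) = 0 \<longrightarrow> wmetric c f (\<phi> q) (second_derivative \<phi> q w w) \<xi> = 0)"
proof -
  let ?T = "T_field c f \<phi> q" and ?g = "wmetric c f (\<phi> q)"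
  note lin = linear_d\<phi>[OF q] and lin2 = linear_second_derivative[OF q]
  obtain w0 where w0: "d\<phi> q w0 = ?T" using T_mem[OF q] by (auto simp: tangent_plane_def)
  define \<beta> where "\<beta> w' = ?g (second_ff c f \<phi> q w0 w') \<xi>" for w'
  have \<beta>: "\<beta> w' = ?g (second_derivative \<phi> q w0 w') \<xi> + christoffel c f (\<phi> q) ?T (d\<phi> q w') \<xi>" for w'
    unfolding \<beta>_def wmetric_second_ff[OF q \<xi>] w0 ..
  have lin\<beta>: "linear \<beta>"
    unfolding linear_iff \<beta> christoffel_eq[OF snd_ambient[OF chart_ambient[OF q]]]
    by (simp add: linear_add[OF lin2(1)] linear_cmul[OF lin2(1)] linear_add[OF lin] linear_cmul[OF lin]
        wmetric.add_left wmetric.scaleR_left lprod.add_left lprod.scaleR_left lprod.add_right lprod.scaleR_right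
        algebra_simps)
  obtain X Y where XY: "tangent_plane \<phi> q = span {X, Y}" "?g X X = -1" "?g Y Y = 1" "?g X Y = 0"
    using chart_lorentz[OF q] by blast
  have YX: "?g Y X = 0" using XY(4) wmetric_commute by metis
  have "X \<in> tangent_plane \<phi> q" "Y \<in> tangent_plane \<phi> q" using XY by (auto intro: span_base)
  then obtain wX wY where wXY: "d\<phi> q wX = X" "d\<phi> q wY = Y" by (auto simp: tangent_plane_def)
  define S where "S = (- \<beta> wX) *\<^sub>R X + \<beta> wY *\<^sub>R Y"
  have S_mem: "S \<in> tangent_plane \<phi> q" unfolding XY span_two S_def by blast
  have S: "?g S (d\<phi> q w') = \<beta> w'" for w'
  proof -
    obtain a b where ab: "d\<phi> q w' = a *\<^sub>R X + b *\<^sub>R Y"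
      using tangent_plane_mem[of q w'] unfolding XY span_two by blast
    then have "d\<phi> q w' = d\<phi> q (a *\<^sub>R wX + b *\<^sub>R wY)"
      by (simp add: linear_add[OF lin] linear_cmul[OF lin] wXY)
    then have "w' = a *\<^sub>R wX + b *\<^sub>R wY" using chart_inj[OF q] by (simp add: inj_eq)
    then have "\<beta> w' = a * \<beta> wX + b * \<beta> wY" by (simp add: linear_add[OF lin\<beta>] linear_cmul[OF lin\<beta>])
    then show ?thesis unfolding ab S_def
      by (simp add: wmetric.add_left wmetric.add_right wmetric.scaleR_left wmetric.scaleR_right
          wmetric.minus_left wmetric.diff_left XY YX)
  qed
  have "shape_op c f \<phi> q \<xi> ?T = S"
    unfolding shape_op_def
  proof (rule the_equality)
    have "w = w0" if "d\<phi> q w = ?T" for w using that w0 chart_inj[OF q] by (metis injD)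
    then show "S \<in> tangent_plane \<phi> q \<and> (\<forall>w w'. d\<phi> q w = ?T \<longrightarrow>
        ?g S (d\<phi> q w') = ?g (second_ff c f \<phi> q w w') \<xi>)"
      using S S_mem by (auto simp: \<beta>_def)
  next
    fix S' assume S': "S' \<in> tangent_plane \<phi> q \<and> (\<forall>w w'. d\<phi> q w = ?T \<longrightarrow>
        ?g S' (d\<phi> q w') = ?g (second_ff c f \<phi> q w w') \<xi>)"
    have "S' - S = 0"
    proof (rule tangent_nondegenerate[OF q])
      show "S' - S \<in> tangent_plane \<phi> q" using S' S_mem subspace_tangent_plane[OF q] subspace_diff by blast
      show "?g (S' - S) w = 0" if "w \<in> tangent_plane \<phi> q" for w
      proof -
        obtain w' where "w = d\<phi> q w'" using \<open>w \<in> tangent_plane \<phi> q\<close> by (auto simp: tangent_plane_def)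
        moreover from this have "?g S' w = \<beta> w'" using S' w0 unfolding \<beta>_def by blast
        ultimately show ?thesis using S[of w'] by (simp add: wmetric.diff_left)
      qed
    qed
    then show "S' = S" by simp
  qed
  moreover have "(\<exists>k. S = k *\<^sub>R ?T) \<longleftrightarrow> ?g S ?T = 0"
  proof
    show "?g S ?T = 0" if "\<exists>k. S = k *\<^sub>R ?T" using that chart_T_null[OF q] by (auto simp: wmetric.scaleR_left)
    show "\<exists>k. S = k *\<^sub>R ?T" if "?g S ?T = 0"
      using lorentz_plane_null_complement[OF XY(2-4) _ chart_T[OF q] chart_T_null[OF q] _ that]
        T_mem[OF q] S_mem unfolding XY(1) by blast
  qed
  moreover have "?g S ?T = ?g (second_derivative \<phi> q w0 w0) \<xi>"
  proof -
    have "snd ?T = 0" using wmetric_T[OF q T_mem[OF q]] chart_T_null[OF q] by simp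
    moreover from this have "lprod c (fst ?T) (fst ?T) = 0" using horizontal_null[OF q, of w0] w0 by simp
    ultimately show ?thesis
      using S[of w0] unfolding w0 \<beta> christoffel_eq[OF snd_ambient[OF chart_ambient[OF q]]] by (simp add: w0)
  qed
  moreover have "?g (second_derivative \<phi> q w0 w0) \<xi> = 0 \<longleftrightarrow>
    (\<forall>w. snd (d\<phi> q w) = 0 \<longrightarrow> ?g (second_derivative \<phi> q w w) \<xi> = 0)"
  proof
    assume z: "?g (second_derivative \<phi> q w0 w0) \<xi> = 0"
    show "\<forall>w. snd (d\<phi> q w) = 0 \<longrightarrow> ?g (second_derivative \<phi> q w w) \<xi> = 0"
    proof safe
      fix w assume "snd (d\<phi> q w) = 0"
      then obtain k where "d\<phi> q w = k *\<^sub>R ?T" using horizontal_iff_parallel_T[OF q tangent_plane_mem] by blast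
      then have "d\<phi> q w = d\<phi> q (k *\<^sub>R w0)" by (simp add: linear_cmul[OF lin] w0)
      then have "w = k *\<^sub>R w0" using chart_inj[OF q] by (simp add: inj_eq)
      then show "?g (second_derivative \<phi> q w w) \<xi> = 0"
        using z by (simp add: linear_cmul[OF lin2(1)] linear_cmul[OF lin2(2)] wmetric.scaleR_left)
    qed
  next
    assume "\<forall>w. snd (d\<phi> q w) = 0 \<longrightarrow> ?g (second_derivative \<phi> q w w) \<xi> = 0"
    moreover have "snd (d\<phi> q w0) = 0" using horizontal_iff_parallel_T[OF q tangent_plane_mem, of w0] w0
      by (metis scaleR_one)
    ultimately show "?g (second_derivative \<phi> q w0 w0) \<xi> = 0" by blast
  qed
  ultimately show ?thesis by simp
qed

text \<open>The tangent plane and the tangent space of the space-time are both nondegenerate, so a vector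
  splits into a tangent and a normal part, and a normal part orthogonal to all normals vanishes.\<close>

lemma tangent_of_orthogonal_normals:
  assumes q: "q \<in> D" and V: "V \<in> ambient_tangent c (\<phi> q)"
    and orth: "\<And>\<xi>. \<xi> \<in> normal_space c f \<phi> q \<Longrightarrow> wmetric c f (\<phi> q) V \<xi> = 0"
  shows "V \<in> tangent_plane \<phi> q"
proof -
  let ?g = "wmetric c f (\<phi> q)"
  obtain t where t: "t \<in> tangent_plane \<phi> q" "\<And>w. w \<in> tangent_plane \<phi> q \<Longrightarrow> ?g (V - t) w = 0"
    using tangent_projection_exists[OF q] by blast
  have tam: "tangent_plane \<phi> q \<subseteq> ambient_tangent c (\<phi> q)"
  proof
    fix X assume "X \<in> tangent_plane \<phi> q"
    then obtain w where w: "X = d\<phi> q w" by (auto simp: tangent_plane_def)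
    show "X \<in> ambient_tangent c (\<phi> q)"
      unfolding w by (rule derivative_in_ambient_tangent[OF d\<phi>[OF q] open_D q chart_ambient])
  qed
  have n: "V - t \<in> normal_space c f \<phi> q"
    unfolding normal_space_def using t tam V subspace_diff[OF subspace_ambient_tangent] by blast
  have "V - t = 0"
  proof (rule ambient_nondegenerate[OF chart_ambient[OF q]])
    show "V - t \<in> ambient_tangent c (\<phi> q)" using n by (simp add: normal_space_def)
    fix Z assume Z: "Z \<in> ambient_tangent c (\<phi> q)"
    obtain s where s: "s \<in> tangent_plane \<phi> q" "\<And>w. w \<in> tangent_plane \<phi> q \<Longrightarrow> ?g (Z - s) w = 0"
      using tangent_projection_exists[OF q] by blast
    have "Z - s \<in> normal_space c f \<phi> q"
      unfolding normal_space_def using s tam Z subspace_diff[OF subspace_ambient_tangent] by blast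
    then have "?g V (Z - s) = 0" "?g (Z - s) t = 0" using orth s t by auto
    then have "?g (V - t) (Z - s) = 0" by (metis wmetric.diff_left wmetric_commute diff_zero)
    then show "?g (V - t) Z = 0" using t(2)[OF s(1)] by (simp add: wmetric.diff_right)
  qed
  then show ?thesis using t(1) by simp
qed

end

section \<open>Charts adapted to the height function\<close>

lemma homeomorphism_imp_homeomorphic_map:
  "homeomorphism S T f g \<Longrightarrow> homeomorphic_map (top_of_set S) (top_of_set T) f"
  unfolding homeomorphic_map_maps homeomorphic_maps_def homeomorphism_def
  by (auto simp: continuous_map_in_subtopology image_subset_iff intro!: exI[of _ g])

lemma local_paramD:
  assumes "local_param M x D \<psi>"
  shows "open D" "openin M (\<psi> ` D)" "homeomorphic_map (top_of_set D) (subtopology M (\<psi> ` D)) \<psi>"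
    "smooth_on D (\<lambda>q. x (\<psi> q))" "q \<in> D \<Longrightarrow> inj (frechet_derivative (\<lambda>q. x (\<psi> q)) (at q))"
    "q \<in> D \<Longrightarrow> \<psi> q \<in> topspace M"
  using assms openin_subset[of M "\<psi> ` D"] by (auto simp: local_param_def o_def)

lemma frechet_derivative_chain:
  assumes "(f has_derivative frechet_derivative f (at x)) (at x)"
    "(g has_derivative frechet_derivative g (at (f x))) (at (f x))"
  shows "frechet_derivative (\<lambda>x. g (f x)) (at x) v = frechet_derivative g (at (f x)) (frechet_derivative f (at x) v)"
  using frechet_derivative_at[OF has_derivative_compose[OF assms]] by metis

lemma local_param_reparam:
  assumes lp: "local_param M x D \<psi>" and E: "open E" and hom: "homeomorphism E (\<kappa> ` E) \<kappa> g"
    and im: "open (\<kappa> ` E)" "\<kappa> ` E \<subseteq> D" and sm: "smooth_on E \<kappa>"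
    and inj: "\<And>q. q \<in> E \<Longrightarrow> inj (frechet_derivative \<kappa> (at q))"
  shows "local_param M x E (\<lambda>q. \<psi> (\<kappa> q))"
proof -
  note lpD = local_paramD[OF lp]
  have "openin (top_of_set D) (\<kappa> ` E)" using im lpD(1) by (simp add: openin_open_eq)
  then have "openin (subtopology M (\<psi> ` D)) (\<psi> ` \<kappa> ` E)"
    using homeomorphic_map_openness[OF lpD(3)] im by simp
  then have op: "openin M (\<psi> ` \<kappa> ` E)" using openin_trans_full lpD(2) by blast
  have "homeomorphic_map (top_of_set (\<kappa> ` E)) (subtopology M (\<psi> ` \<kappa> ` E)) \<psi>"
  proof -
    have "homeomorphic_map (subtopology (top_of_set D) (\<kappa> ` E)) (subtopology (subtopology M (\<psi> ` D)) (\<psi> ` \<kappa> ` E)) \<psi>"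
      by (rule homeomorphic_map_subtopologies[OF lpD(3)])
         (use im lpD(2) openin_subset[OF op] in \<open>auto simp: topspace_subtopology\<close>)
    moreover have "D \<inter> \<kappa> ` E = \<kappa> ` E" "\<psi> ` D \<inter> \<psi> ` \<kappa> ` E = \<psi> ` \<kappa> ` E" using im by auto
    ultimately show ?thesis by (simp add: subtopology_subtopology)
  qed
  from homeomorphic_map_compose[OF homeomorphism_imp_homeomorphic_map[OF hom] this]
  have hm: "homeomorphic_map (top_of_set E) (subtopology M (\<psi> ` \<kappa> ` E)) (\<lambda>q. \<psi> (\<kappa> q))" by (simp add: o_def)
  have smc: "smooth_on E (\<lambda>q. x (\<psi> (\<kappa> q)))"
    by (rule smooth_on_compose[OF lpD(4) sm E lpD(1) im(2)])
  have "inj (frechet_derivative (\<lambda>q. x (\<psi> (\<kappa> q))) (at q))" if q: "q \<in> E" for q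
  proof -
    have \<kappa>q: "\<kappa> q \<in> D" using im q by auto
    have "frechet_derivative (\<lambda>q. x (\<psi> (\<kappa> q))) (at q) =
       (\<lambda>v. frechet_derivative (\<lambda>q. x (\<psi> q)) (at (\<kappa> q)) (frechet_derivative \<kappa> (at q) v))"
      by (rule ext, rule frechet_derivative_chain[where g = "\<lambda>q. x (\<psi> q)"])
         (use smooth_on_has_derivative[OF sm q] smooth_on_has_derivative[OF lpD(4) \<kappa>q] in auto)
    then show ?thesis using inj_compose[OF lpD(5)[OF \<kappa>q] inj[OF q]] by (simp add: o_def)
  qed
  with E op hm smc show ?thesis by (auto simp: local_param_def o_def image_image)
qed

lemma box_neighbourhood:
  fixes u0 v0 :: real
  assumes "open G" "(u0, v0) \<in> G"
  obtains \<epsilon> where "\<epsilon> > 0" "ball u0 \<epsilon> \<times> ball v0 \<epsilon> \<subseteq> G"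
proof -
  obtain A B where AB: "open A" "open B" "u0 \<in> A" "v0 \<in> B" "A \<times> B \<subseteq> G"
    using open_prod_elim[OF assms] by (metis mem_Sigma_iff)
  obtain e1 e2 where e: "e1 > 0" "ball u0 e1 \<subseteq> A" "e2 > 0" "ball v0 e2 \<subseteq> B"
    using AB open_contains_ball by metis
  have "ball u0 (min e1 e2) \<times> ball v0 (min e1 e2) \<subseteq> G" using e AB(5) by (fastforce simp: subset_iff)
  then show ?thesis using that[of "min e1 e2"] e by simp
qed

text \<open>By the inverse function theorem two functions with independent differentials are local coordinates
  of \<open>M\<close>. The coordinate domain is a box, so that it is connected and contains the coordinate lines.\<close>

lemma local_param_coordinates:
  fixes \<theta> :: "real \<times> real \<Rightarrow> real \<times> real"
  assumes lp: "local_param M x D \<psi>" and E: "open E" "E \<subseteq> D" "q \<in> E"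
    and sm: "smooth_on E \<theta>" and inj: "inj (frechet_derivative \<theta> (at q))"
    and G: "open G" "\<theta> q \<in> G"
  obtains \<epsilon> \<kappa> where "\<epsilon> > 0" "ball (fst (\<theta> q)) \<epsilon> \<times> ball (snd (\<theta> q)) \<epsilon> \<subseteq> G"
    "local_param M x (ball (fst (\<theta> q)) \<epsilon> \<times> ball (snd (\<theta> q)) \<epsilon>) (\<lambda>y. \<psi> (\<kappa> y))"
    "smooth_on (ball (fst (\<theta> q)) \<epsilon> \<times> ball (snd (\<theta> q)) \<epsilon>) \<kappa>" "\<kappa> (\<theta> q) = q"
    "\<And>y. y \<in> ball (fst (\<theta> q)) \<epsilon> \<times> ball (snd (\<theta> q)) \<epsilon> \<Longrightarrow> \<kappa> y \<in> E \<and> \<theta> (\<kappa> y) = y"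
proof -
  obtain U V \<kappa> where UV: "open U" "U \<subseteq> E" "q \<in> U" "open V" "homeomorphism U V \<theta> \<kappa>" "smooth_on V \<kappa>"
    and injg: "\<And>y. y \<in> V \<Longrightarrow> inj (frechet_derivative \<kappa> (at y))"
    using smooth_inverse_function[OF E(1) sm E(3) inj] by metis
  have hom: "homeomorphism V U \<kappa> \<theta>" using UV(5) by (rule homeomorphism_symD)
  have qV: "\<theta> q \<in> V" using UV by (auto simp: homeomorphism_def)
  obtain \<epsilon> where \<epsilon>: "\<epsilon> > 0" "ball (fst (\<theta> q)) \<epsilon> \<times> ball (snd (\<theta> q)) \<epsilon> \<subseteq> V \<inter> G"
    using box_neighbourhood[of "V \<inter> G" "fst (\<theta> q)" "snd (\<theta> q)"] UV(4) G qV by auto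
  define B where "B = ball (fst (\<theta> q)) \<epsilon> \<times> ball (snd (\<theta> q)) \<epsilon>"
  have B: "open B" "B \<subseteq> V" "B \<subseteq> G" using \<epsilon> by (auto simp: B_def open_Times)
  have homB: "homeomorphism B (\<kappa> ` B) \<kappa> \<theta>"
    by (rule homeomorphism_of_subsets[OF hom B(2)]) (use hom B(2) in \<open>auto simp: homeomorphism_def\<close>)
  have opB: "open (\<kappa> ` B)"
  proof -
    have "openin (top_of_set V) B" using B(1,2) UV(4) by (simp add: openin_open_eq)
    then have "openin (top_of_set U) (\<kappa> ` B)" using homeomorphism_imp_open_map[OF hom] by blast
    then show ?thesis using UV(1) openin_open_eq by blast
  qed
  have \<kappa>B: "\<kappa> y \<in> U" "\<theta> (\<kappa> y) = y" if "y \<in> B" for y using hom B(2) that by (auto simp: homeomorphism_def)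
  have "local_param M x B (\<lambda>y. \<psi> (\<kappa> y))"
    by (rule local_param_reparam[OF lp B(1) homB opB _ smooth_on_subset[OF UV(6) B(2)]])
       (use \<kappa>B UV(2) E(2) injg B(2) in blast)+
  moreover have "\<kappa> (\<theta> q) = q" using UV(3,5) by (auto simp: homeomorphism_def)
  ultimately show ?thesis using \<epsilon>(1) B \<kappa>B UV(2) smooth_on_subset[OF UV(6) B(2)]
    by (intro that[of \<epsilon> \<kappa>]) (auto simp: B_def)
qed

lemma lightlike_chart_local_param:
  assumes "c \<in> {-1, 0, 1}" "open I" "smooth_on I f" "\<forall>z\<in>I. 0 < f z"
    and surf: "timelike_surface c f I M x" and T: "T_lightlike c f M x" and lp: "local_param M x D \<psi>"
  shows "lightlike_chart c f I D (\<lambda>q. x (\<psi> q))"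
proof unfold_locales
  note lpD = local_paramD[OF lp]
  show "c \<in> {-1, 0, 1}" "open I" "smooth_on I f" "\<And>z. z \<in> I \<Longrightarrow> 0 < f z" using assms by auto
  show "open D" "smooth_on D (\<lambda>q. x (\<psi> q))" using lpD by auto
  fix q assume q: "q \<in> D"
  show "x (\<psi> q) \<in> ambient c I"
    using surf lpD(6)[OF q] by (auto simp: timelike_surface_def submanifold_def)
  show "inj (frechet_derivative (\<lambda>q. x (\<psi> q)) (at q))" by (rule lpD(5)[OF q])
  show "\<exists>X Y. tangent_plane (\<lambda>q. x (\<psi> q)) q = span {X, Y} \<and> wmetric c f (x (\<psi> q)) X X = - 1 \<and>
      wmetric c f (x (\<psi> q)) Y Y = 1 \<and> wmetric c f (x (\<psi> q)) X Y = 0"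
    using surf lp q unfolding timelike_surface_def o_def by blast
  show "T_field c f (\<lambda>q. x (\<psi> q)) q \<noteq> 0"
    "wmetric c f (x (\<psi> q)) (T_field c f (\<lambda>q. x (\<psi> q)) q) (T_field c f (\<lambda>q. x (\<psi> q)) q) = 0"
    using T lp q unfolding T_lightlike_def o_def by blast+
qed

text \<open>The height \<open>z\<close> has gradient \<open>T \<noteq> 0\<close> on the surface, so it is a local coordinate.\<close>

lemma adapted_local_param:
  assumes chart: "lightlike_chart c f I D (\<lambda>q. x (\<psi> q))" and lp: "local_param M x D \<psi>" and q: "q \<in> D"
    and G: "open G" "q \<in> G"
  obtains t0 :: real and \<epsilon> \<kappa> where "\<epsilon> > 0" "local_param M x (ball (snd (x (\<psi> q))) \<epsilon> \<times> ball t0 \<epsilon>) (\<lambda>y. \<psi> (\<kappa> y))"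
    "smooth_on (ball (snd (x (\<psi> q))) \<epsilon> \<times> ball t0 \<epsilon>) \<kappa>" "\<kappa> (snd (x (\<psi> q)), t0) = q"
    "\<And>y. y \<in> ball (snd (x (\<psi> q))) \<epsilon> \<times> ball t0 \<epsilon> \<Longrightarrow> \<kappa> y \<in> D \<and> \<kappa> y \<in> G \<and> snd (x (\<psi> (\<kappa> y))) = fst y"
proof -
  interpret lightlike_chart c f I D "\<lambda>q. x (\<psi> q)" by fact
  let ?z = "\<lambda>q. snd (x (\<psi> q))"
  have dz: "(?z has_derivative (\<lambda>w. snd (d\<phi> q w))) (at q)" by (rule has_derivative_snd[OF d\<phi>[OF q]])
  obtain w where w: "snd (d\<phi> q w) \<noteq> 0" using not_horizontal_exists[OF q] by blast
  have lin: "linear (\<lambda>w. snd (d\<phi> q w))" using has_derivative_linear[OF dz] .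
  have dec: "snd (d\<phi> q (a, b)) = a * snd (d\<phi> q (1, 0)) + b * snd (d\<phi> q (0, 1))" for a b
  proof -
    have "(a, b) = a *\<^sub>R (1, 0) + b *\<^sub>R (0::real, 1::real)" by simp
    then show ?thesis using linear_add[OF lin] linear_cmul[OF lin] by (metis real_scaleR_def)
  qed
  obtain L :: "real \<times> real \<Rightarrow> real" where L: "bounded_linear L"
    and inj: "\<And>v. snd (d\<phi> q v) = 0 \<Longrightarrow> L v = 0 \<Longrightarrow> v = 0"
  proof (cases "snd (d\<phi> q (0, 1)) = 0")
    case True
    then have nz: "snd (d\<phi> q (1, 0)) \<noteq> 0" using w dec[of "fst w" "snd w"] by auto
    have "v = 0" if "snd (d\<phi> q v) = 0" "snd v = 0" for v
      using that nz True dec[of "fst v" "snd v"] unfolding prod.collapse by (simp add: prod_eq_iff)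
    then show ?thesis using that[OF bounded_linear_snd] by blast
  next
    case False
    have "v = 0" if "snd (d\<phi> q v) = 0" "fst v = 0" for v
      using that False dec[of "fst v" "snd v"] unfolding prod.collapse by (simp add: prod_eq_iff)
    then show ?thesis using that[OF bounded_linear_fst] by blast
  qed
  define \<theta> where "\<theta> q = (?z q, L q)" for q
  have sm: "smooth_on (D \<inter> G) \<theta>"
    unfolding \<theta>_def
    by (intro smooth_intros open_Int open_D G smooth_on_subset[OF smooth_chart] smooth_on_linear L) auto
  have "(\<theta> has_derivative (\<lambda>v. (snd (d\<phi> q v), L v))) (at q)"
    unfolding \<theta>_def by (intro has_derivative_Pair dz bounded_linear_imp_has_derivative L)
  note d\<theta> = this frechet_derivative_at[OF this]
  have "inj (frechet_derivative \<theta> (at q))"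
    unfolding d\<theta>(2)[symmetric] linear_injective_0[OF has_derivative_linear[OF d\<theta>(1)]]
    using inj by (simp add: zero_prod_def)
  from local_param_coordinates[OF lp open_Int[OF open_D G(1)] _ _ sm this open_UNIV UNIV_I] q G
  obtain \<epsilon> \<kappa> where *: "\<epsilon> > 0"
    "local_param M x (ball (fst (\<theta> q)) \<epsilon> \<times> ball (snd (\<theta> q)) \<epsilon>) (\<lambda>y. \<psi> (\<kappa> y))"
    "smooth_on (ball (fst (\<theta> q)) \<epsilon> \<times> ball (snd (\<theta> q)) \<epsilon>) \<kappa>" "\<kappa> (\<theta> q) = q"
    "\<And>y. y \<in> ball (fst (\<theta> q)) \<epsilon> \<times> ball (snd (\<theta> q)) \<epsilon> \<Longrightarrow> \<kappa> y \<in> D \<inter> G \<and> \<theta> (\<kappa> y) = y"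
    by (metis Int_iff Int_lower1)
  show ?thesis
    by (rule that[of \<epsilon> "L q" \<kappa>]) (use * in \<open>auto simp: \<theta>_def prod_eq_iff\<close>)
qed

text \<open>Second derivatives along a curve in a chart differ from second derivatives of the chart only by
  a tangent vector.\<close>

lemma second_derivative_along_curve:
  fixes \<phi> :: "real \<times> real \<Rightarrow> 'b::real_normed_vector"
  assumes D: "open D" "smooth_on D \<phi>" and J: "open J" "smooth_on J \<sigma>" "\<And>s. s \<in> J \<Longrightarrow> \<sigma> s \<in> D" "s \<in> J"
  obtains \<sigma>1 \<sigma>2 where
    "((\<lambda>s. \<phi> (\<sigma> s)) has_vector_derivative frechet_derivative \<phi> (at (\<sigma> s)) \<sigma>1) (at s)"
    "((\<lambda>s. vector_derivative (\<lambda>s. \<phi> (\<sigma> s)) (at s)) has_vector_derivative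
      second_derivative \<phi> (\<sigma> s) \<sigma>1 \<sigma>1 + frechet_derivative \<phi> (at (\<sigma> s)) \<sigma>2) (at s)"
proof -
  let ?d = "\<lambda>q. frechet_derivative \<phi> (at q)"
  define \<sigma>' where "\<sigma>' s = frechet_derivative \<sigma> (at s) 1" for s
  have d\<sigma>: "(\<sigma> has_vector_derivative \<sigma>' s) (at s)" if "s \<in> J" for s
  proof -
    note d = smooth_on_has_derivative[OF J(2) that]
    have "frechet_derivative \<sigma> (at s) v = v *\<^sub>R \<sigma>' s" for v
      using linear_cmul[OF has_derivative_linear[OF d], of v 1] by (simp add: \<sigma>'_def)
    then show ?thesis using d unfolding has_vector_derivative_def by presburger
  qed
  have sm': "smooth_on J \<sigma>'" unfolding \<sigma>'_def by (rule smooth_on_frechet_derivative[OF J(2)])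
  define \<sigma>'' where "\<sigma>'' = frechet_derivative \<sigma>' (at s) 1"
  have d\<sigma>': "(\<sigma>' has_vector_derivative \<sigma>'') (at s)"
  proof -
    note d = smooth_on_has_derivative[OF sm' J(4)]
    have "frechet_derivative \<sigma>' (at s) v = v *\<^sub>R \<sigma>''" for v
      using linear_cmul[OF has_derivative_linear[OF d], of v 1] by (simp add: \<sigma>''_def)
    then show ?thesis using d unfolding has_vector_derivative_def by presburger
  qed
  have lin: "linear (?d q)" if "q \<in> D" for q
    using has_derivative_linear[OF smooth_on_has_derivative[OF D(2) that]] .
  have chain: "((\<lambda>s. h (\<sigma> s)) has_vector_derivative frechet_derivative h (at (\<sigma> s)) (\<sigma>' s)) (at s)"
    if h: "smooth_on D h" and s: "s \<in> J" for h :: "real \<times> real \<Rightarrow> 'b" and s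
    using vector_derivative_diff_chain_within[OF d\<sigma>[OF s], of h "frechet_derivative h (at (\<sigma> s))"]
      smooth_on_has_derivative[OF h J(3)[OF s]] has_derivative_at_withinI
    by (fastforce simp: o_def)
  note d1 = chain[OF D(2)]
  define e1 e2 where "e1 = (1::real, 0::real)" and "e2 = (0::real, 1::real)"
  have exp: "?d q v = fst v *\<^sub>R ?d q e1 + snd v *\<^sub>R ?d q e2" if "q \<in> D" for q v
  proof -
    have "v = fst v *\<^sub>R e1 + snd v *\<^sub>R e2" by (simp add: e1_def e2_def)
    then show ?thesis using linear_add[OF lin[OF that]] linear_cmul[OF lin[OF that]] by metis
  qed
  have D2: "second_derivative \<phi> (\<sigma> s) v w = fst w *\<^sub>R second_derivative \<phi> (\<sigma> s) v e1 +
      snd w *\<^sub>R second_derivative \<phi> (\<sigma> s) v e2" for v w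
  proof -
    have dd: "((\<lambda>r. ?d r e) has_derivative (\<lambda>v. second_derivative \<phi> (\<sigma> s) v e)) (at (\<sigma> s))" for e
      unfolding second_derivative_def
      by (rule smooth_on_has_derivative[OF smooth_on_frechet_derivative[OF D(2)] J(3)[OF J(4)]])
    have "((\<lambda>r. fst w *\<^sub>R ?d r e1 + snd w *\<^sub>R ?d r e2) has_derivative
      (\<lambda>v. fst w *\<^sub>R second_derivative \<phi> (\<sigma> s) v e1 + snd w *\<^sub>R second_derivative \<phi> (\<sigma> s) v e2)) (at (\<sigma> s))"
      by (intro has_derivative_add has_derivative_scaleR_right dd)
    then have "((\<lambda>r. ?d r w) has_derivative
      (\<lambda>v. fst w *\<^sub>R second_derivative \<phi> (\<sigma> s) v e1 + snd w *\<^sub>R second_derivative \<phi> (\<sigma> s) v e2)) (at (\<sigma> s))"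
      by (rule has_derivative_transform_within_open[OF _ D(1) J(3)[OF J(4)]]) (simp add: exp[symmetric])
    from has_derivative_unique[OF dd this] show ?thesis by (rule fun_cong)
  qed
  have vd: "vector_derivative (\<lambda>s. \<phi> (\<sigma> s)) (at s) = ?d (\<sigma> s) (\<sigma>' s)" if "s \<in> J" for s
    using vector_derivative_at[OF d1[OF that]] .
  have dc: "((\<lambda>s. fst (\<sigma>' s)) has_real_derivative fst \<sigma>'') (at s)"
    "((\<lambda>s. snd (\<sigma>' s)) has_real_derivative snd \<sigma>'') (at s)"
    using bounded_linear.has_vector_derivative[OF bounded_linear_fst d\<sigma>']
      bounded_linear.has_vector_derivative[OF bounded_linear_snd d\<sigma>']
    by (auto simp: has_real_derivative_iff_has_vector_derivative)
  have chain2: "((\<lambda>s. ?d (\<sigma> s) e) has_vector_derivative second_derivative \<phi> (\<sigma> s) (\<sigma>' s) e) (at s)" for e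
    unfolding second_derivative_def by (rule chain[OF smooth_on_frechet_derivative[OF D(2)] J(4)])
  have "((\<lambda>s. fst (\<sigma>' s) *\<^sub>R ?d (\<sigma> s) e1 + snd (\<sigma>' s) *\<^sub>R ?d (\<sigma> s) e2) has_vector_derivative
      (fst (\<sigma>' s) *\<^sub>R second_derivative \<phi> (\<sigma> s) (\<sigma>' s) e1 + fst \<sigma>'' *\<^sub>R ?d (\<sigma> s) e1) +
      (snd (\<sigma>' s) *\<^sub>R second_derivative \<phi> (\<sigma> s) (\<sigma>' s) e2 + snd \<sigma>'' *\<^sub>R ?d (\<sigma> s) e2)) (at s)"
    by (rule has_vector_derivative_add[OF has_vector_derivative_scaleR[OF dc(1) chain2]
          has_vector_derivative_scaleR[OF dc(2) chain2]])
  then have "((\<lambda>s. fst (\<sigma>' s) *\<^sub>R ?d (\<sigma> s) e1 + snd (\<sigma>' s) *\<^sub>R ?d (\<sigma> s) e2) has_vector_derivative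
      second_derivative \<phi> (\<sigma> s) (\<sigma>' s) (\<sigma>' s) + ?d (\<sigma> s) \<sigma>'') (at s)"
    unfolding D2[of "\<sigma>' s" "\<sigma>' s"] exp[OF J(3)[OF J(4)], of \<sigma>''] by (simp add: algebra_simps)
  then have "((\<lambda>s. vector_derivative (\<lambda>s. \<phi> (\<sigma> s)) (at s)) has_vector_derivative
      second_derivative \<phi> (\<sigma> s) (\<sigma>' s) (\<sigma>' s) + ?d (\<sigma> s) \<sigma>'') (at s)"
    by (rule has_vector_derivative_transform_within_open[OF _ J(1,4)]) (simp only: vd J(3) exp[symmetric])
  then show ?thesis
    using that[of "\<sigma>' s" \<sigma>''] d1[OF J(4)] by simp
qed

section \<open>Null scrolls and Cartan frames\<close>

lemma vector_4 [simp]: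
  "(vector [a, b, c, d] :: 'a::zero ^ 4) $ 1 = a" "(vector [a, b, c, d] :: 'a::zero ^ 4) $ 2 = b"
  "(vector [a, b, c, d] :: 'a::zero ^ 4) $ 3 = c" "(vector [a, b, c, d] :: 'a::zero ^ 4) $ 4 = d"
  unfolding vector_def by auto

lemma vector_4_eq:
  "(vector [a, b, c, d] :: real ^ 4) = a *\<^sub>R axis 1 1 + b *\<^sub>R axis 2 1 + c *\<^sub>R axis 3 1 + d *\<^sub>R axis 4 1"
  by (simp add: vec_eq_iff forall_4 axis_def)

lemma smooth_on_vector_derivative:
  fixes h :: "real \<Rightarrow> 'b::real_normed_vector"
  assumes "open S" "smooth_on S h"
  shows "u \<in> S \<Longrightarrow> (h has_vector_derivative vector_derivative h (at u)) (at u)"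
    and "smooth_on S (\<lambda>u. vector_derivative h (at u))"
proof -
  have d: "(h has_vector_derivative frechet_derivative h (at u) 1) (at u)" if "u \<in> S" for u
  proof -
    note d = smooth_on_has_derivative[OF assms(2) that]
    define k where "k = frechet_derivative h (at u) 1"
    have "frechet_derivative h (at u) v = v *\<^sub>R k" for v
      using linear_cmul[OF has_derivative_linear[OF d], of v 1] unfolding k_def by simp
    then have "frechet_derivative h (at u) = (\<lambda>v. v *\<^sub>R k)" by (rule ext)
    then show ?thesis using d unfolding has_vector_derivative_def k_def[symmetric] by simp
  qed
  show "(h has_vector_derivative vector_derivative h (at u)) (at u)" if "u \<in> S"
    using d[OF that] vector_derivative_at[OF d[OF that]] by simp
  show "smooth_on S (\<lambda>u. vector_derivative h (at u))"
    using smooth_on_cong[OF assms(1), of "\<lambda>u. vector_derivative h (at u)" "\<lambda>u. frechet_derivative h (at u) 1"]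
      vector_derivative_at[OF d] smooth_on_frechet_derivative[OF assms(2)] by auto
qed

lemma smooth_on_lprod:
  "open S \<Longrightarrow> smooth_on S X \<Longrightarrow> smooth_on S Y \<Longrightarrow> smooth_on S (\<lambda>u. lprod c (X u) (Y u))"
  using smooth_on_bilinear[OF _ lprod.bounded_bilinear_axioms] .

lemma lprod_constant_derivative:
  assumes S: "open S" "u \<in> S" and const: "\<And>u. u \<in> S \<Longrightarrow> lprod c (X u) (Y u) = k"
    and d: "(X has_vector_derivative X') (at u)" "(Y has_vector_derivative Y') (at u)"
  shows "lprod c X' (Y u) = - lprod c (X u) Y'"
proof -
  have "((\<lambda>u. lprod c (X u) (Y u)) has_vector_derivative lprod c (X u) Y' + lprod c X' (Y u)) (at u)"
    by (rule lprod.has_vector_derivative[OF d])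
  moreover have "((\<lambda>u. lprod c (X u) (Y u)) has_vector_derivative 0) (at u)"
    by (rule has_vector_derivative_transform_within_open[OF has_vector_derivative_const S, of k]) (simp add: const)
  ultimately have "lprod c (X u) Y' + lprod c X' (Y u) = 0" by (rule vector_derivative_unique_at)
  then show ?thesis by simp
qed

text \<open>The vector product of three vectors: its components are the cofactors of the determinant
  \<open>\<lambda>X. det (X, A, B, n)\<close>, raised with the metric.\<close>

definition cofactor :: "real ^ 4 \<Rightarrow> real ^ 4 \<Rightarrow> real ^ 4 \<Rightarrow> 4 \<Rightarrow> 4 \<Rightarrow> 4 \<Rightarrow> real" where
  "cofactor A B n i j k = A $ i * (B $ j * n $ k - B $ k * n $ j) - A $ j * (B $ i * n $ k - B $ k * n $ i)
     + A $ k * (B $ i * n $ j - B $ j * n $ i)"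

definition vector_product :: "real \<Rightarrow> real ^ 4 \<Rightarrow> real ^ 4 \<Rightarrow> real ^ 4 \<Rightarrow> real ^ 4" where
  "vector_product c A B n = vector [- cofactor A B n 2 3 4,
     - (if c = -1 then -1 else 1) * cofactor A B n 1 3 4, cofactor A B n 1 2 4, - cofactor A B n 1 2 3]"

lemma vector_product_orthogonal:
  "lprod c (vector_product c A B n) A = 0" "lprod c (vector_product c A B n) B = 0"
  "lprod c (vector_product c A B n) n = 0"
  by (auto simp: lprod_def vector_product_def cofactor_def algebra_simps)

text \<open>The Cauchy--Binet formula: the right-hand side is the Gram determinant of the three factors times the
  determinant of the metric.\<close>

lemma vector_product_square:
  "lprod c (vector_product c A B n) (vector_product c A B n) = (if c = -1 then 1 else -1) *
    (lprod c A A * (lprod c B B * lprod c n n - lprod c B n * lprod c B n)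
     - lprod c A B * (lprod c A B * lprod c n n - lprod c B n * lprod c A n)
     + lprod c A n * (lprod c A B * lprod c B n - lprod c B B * lprod c A n))"
proof -
  \<comment> \<open>the two signatures differ in the sign \<open>e\<close> of the second coordinate\<close>
  define e :: real where "e = (if c = -1 then -1 else 1)"
  have e: "e * e = 1" by (simp add: e_def)
  have l: "lprod c X Y = - X $ 1 * Y $ 1 + e * X $ 2 * Y $ 2 + X $ 3 * Y $ 3 + X $ 4 * Y $ 4" for X Y
    by (simp add: lprod_def e_def)
  have e': "(if c = -1 then 1 else -1) = - e" by (simp add: e_def)
  show ?thesis
    using e unfolding l vector_product_def cofactor_def vector_4 e_def[symmetric] e' by algebra
qed

lemma smooth_on_vector_product:
  assumes "open S" "smooth_on S A" "smooth_on S B" "smooth_on S n"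
  shows "smooth_on S (\<lambda>u. vector_product c (A u) (B u) (n u))"
  unfolding vector_product_def cofactor_def vector_4_eq by (intro smooth_intros assms)

text \<open>The Gram matrix of the frame is nondegenerate, so a vector is determined by its scalar products
  with the frame.\<close>

lemma null_frame_expansion:
  assumes g: "lprod c A A = 0" "lprod c B B = 0" "lprod c A B = -1" "lprod c C C = 1" "lprod c n n = \<nu>" "\<nu> \<noteq> 0"
    "lprod c C A = 0" "lprod c C B = 0" "lprod c A n = 0" "lprod c B n = 0" "lprod c C n = 0"
  shows "X = - lprod c X B *\<^sub>R A - lprod c X A *\<^sub>R B + lprod c X C *\<^sub>R C + (lprod c X n / \<nu>) *\<^sub>R n"
proof -
  define L where "L X = (vector [lprod c X A, lprod c X B, lprod c X C, lprod c X n] :: real ^ 4)" for X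
  note g' = g lprod_commute[of c B A] lprod_commute[of c A C] lprod_commute[of c B C]
    lprod_commute[of c n A] lprod_commute[of c n B] lprod_commute[of c n C]
  have L: "linear L"
    by (rule linearI) (simp_all add: L_def vec_eq_iff forall_4 lprod.add_left lprod.scaleR_left)
  have "surj L"
  proof
    show "UNIV \<subseteq> range L"
    proof
      fix y :: "real ^ 4"
      have "L (- (y $ 2) *\<^sub>R A - (y $ 1) *\<^sub>R B + (y $ 3) *\<^sub>R C + (y $ 4 / \<nu>) *\<^sub>R n) = y"
        by (simp add: L_def vec_eq_iff forall_4 lprod.add_left lprod.scaleR_left lprod.diff_left lprod.minus_left g')
      then show "y \<in> range L" by (metis rangeI)
    qed
  qed simp
  then have "inj L" using linear_surjective_imp_injective[OF L] by simp
  moreover have "L X = L (- lprod c X B *\<^sub>R A - lprod c X A *\<^sub>R B + lprod c X C *\<^sub>R C + (lprod c X n / \<nu>) *\<^sub>R n)"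
    by (simp add: L_def vec_eq_iff forall_4 lprod.add_left lprod.scaleR_left lprod.diff_left lprod.minus_left g')
  ultimately show ?thesis by (simp add: inj_eq)
qed

text \<open>The Frenet equations of a null frame: the coefficients of the expansion of the derivatives
  are read off from the constant scalar products. The hypothesis \<open>\<langle>A', B\<rangle> = 0\<close> says that the curve is
  affinely parametrised relative to \<open>B\<close>.\<close>

lemma null_frame_equations:
  assumes J: "open J" "u \<in> J"
    and g: "\<And>u. u \<in> J \<Longrightarrow> lprod c (A u) (A u) = 0" "\<And>u. u \<in> J \<Longrightarrow> lprod c (B u) (B u) = 0"
      "\<And>u. u \<in> J \<Longrightarrow> lprod c (A u) (B u) = -1" "\<And>u. u \<in> J \<Longrightarrow> lprod c (C u) (C u) = 1"
      "\<And>u. u \<in> J \<Longrightarrow> lprod c (n u) (n u) = \<nu>" "\<nu> \<noteq> 0"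
      "\<And>u. u \<in> J \<Longrightarrow> lprod c (C u) (A u) = 0" "\<And>u. u \<in> J \<Longrightarrow> lprod c (C u) (B u) = 0"
      "\<And>u. u \<in> J \<Longrightarrow> lprod c (A u) (n u) = 0" "\<And>u. u \<in> J \<Longrightarrow> lprod c (B u) (n u) = 0"
      "\<And>u. u \<in> J \<Longrightarrow> lprod c (C u) (n u) = 0"
    and d: "(A has_vector_derivative A') (at u)" "(B has_vector_derivative B') (at u)"
      "(C has_vector_derivative C') (at u)" "(n has_vector_derivative k *\<^sub>R A u) (at u)"
    and par: "lprod c A' (B u) = 0"
  shows "A' = lprod c A' (C u) *\<^sub>R C u"
    and "B' = lprod c B' (C u) *\<^sub>R C u + (k / \<nu>) *\<^sub>R n u"
    and "C' = lprod c B' (C u) *\<^sub>R A u + lprod c A' (C u) *\<^sub>R B u"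
proof -
  note gu = g(1-5)[OF J(2)] g(6) g(7-11)[OF J(2)]
  note E = null_frame_expansion[OF gu]
  note comm = lprod_commute[of c "A u"] lprod_commute[of c "B u"] lprod_commute[of c "C u"]
  have dA: "lprod c A' (A u) = 0" using lprod_constant_derivative[OF J g(1) d(1,1)] by (simp add: comm)
  have dB: "lprod c B' (B u) = 0" using lprod_constant_derivative[OF J g(2) d(2,2)] by (simp add: comm)
  have dC: "lprod c C' (C u) = 0" using lprod_constant_derivative[OF J g(4) d(3,3)] by (simp add: comm)
  have dAB: "lprod c B' (A u) = 0" using lprod_constant_derivative[OF J g(3) d(1,2)] par by (simp add: comm)
  have dCA: "lprod c C' (A u) = - lprod c A' (C u)" using lprod_constant_derivative[OF J g(7) d(3,1)] by (simp add: comm)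
  have dCB: "lprod c C' (B u) = - lprod c B' (C u)" using lprod_constant_derivative[OF J g(8) d(3,2)] by (simp add: comm)
  have dAn: "lprod c A' (n u) = 0" using lprod_constant_derivative[OF J g(9) d(1,4)] gu by (simp add: lprod.scaleR_right)
  have dBn: "lprod c B' (n u) = k" using lprod_constant_derivative[OF J g(10) d(2,4)] gu lprod_commute[of c "B u" "A u"]
    by (simp add: lprod.scaleR_right)
  have dCn: "lprod c C' (n u) = 0" using lprod_constant_derivative[OF J g(11) d(3,4)] gu by (simp add: lprod.scaleR_right)
  show "A' = lprod c A' (C u) *\<^sub>R C u" using E[of A'] by (simp add: dA par dAn)
  show "B' = lprod c B' (C u) *\<^sub>R C u + (k / \<nu>) *\<^sub>R n u" using E[of B'] by (simp add: dAB dB dBn)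
  show "C' = lprod c B' (C u) *\<^sub>R A u + lprod c A' (C u) *\<^sub>R B u" using E[of C'] by (simp add: dC dCA dCB dCn)
qed

lemma smooth_inverse_real:
  fixes U w :: "real \<Rightarrow> real"
  assumes e: "e > 0" and sm: "smooth_on (ball u0 e) w"
    and d: "\<And>u. u \<in> ball u0 e \<Longrightarrow> (U has_real_derivative w u) (at u)" and w: "\<And>u. u \<in> ball u0 e \<Longrightarrow> w u > 0"
  obtains g where "open (U ` ball u0 e)" "is_interval (U ` ball u0 e)"
    "\<And>u. u \<in> ball u0 e \<Longrightarrow> g (U u) = u" "\<And>s. s \<in> U ` ball u0 e \<Longrightarrow> g s \<in> ball u0 e \<and> U (g s) = s"
    "smooth_on (U ` ball u0 e) g"
    "\<And>s. s \<in> U ` ball u0 e \<Longrightarrow> (g has_real_derivative inverse (w (g s))) (at s)"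
proof -
  let ?B = "ball u0 e"
  have mono: "U a < U b" if "a \<in> ?B" "b \<in> ?B" "a < b" for a b
  proof (rule DERIV_pos_imp_increasing[OF that(3)])
    fix x assume "a \<le> x" "x \<le> b"
    then have "x \<in> ?B" using that by (auto simp: dist_real_def)
    then show "\<exists>y. (U has_real_derivative y) (at x) \<and> y > 0" using d w by blast
  qed
  have inj: "inj_on U ?B"
    by (rule inj_onI) (metis mono linorder_neq_iff)
  have cont: "continuous_on ?B U"
    using d by (auto intro!: continuous_at_imp_continuous_on DERIV_isCont)
  have op: "open (U ` ?B)" using injective_into_1d_imp_open_map_UNIV[OF open_ball cont inj] by blast
  have int: "is_interval (U ` ?B)"
    unfolding is_interval_connected_1 by (intro connected_continuous_image cont convex_connected convex_ball)
  obtain g where g: "homeomorphism ?B (U ` ?B) U g"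
    using injective_into_1d_eq_homeomorphism[OF cont] inj convex_imp_path_connected convex_ball by blast
  have gU: "g (U u) = u" if "u \<in> ?B" for u using g that by (auto simp: homeomorphism_def)
  have Ug: "g s \<in> ?B \<and> U (g s) = s" if "s \<in> U ` ?B" for s using gU that by auto
  have dg: "(g has_real_derivative inverse (w (g s))) (at s)" if s: "s \<in> U ` ?B" for s
  proof (rule has_field_derivative_inverse_basic[OF d _ _ op s])
    show "g s \<in> ?B" "w (g s) \<noteq> 0" using Ug[OF s] w by fastforce+
    show "continuous (at s) g" using g op s by (auto simp: homeomorphism_def continuous_on_eq_continuous_at)
    show "U (g z) = z" if "z \<in> U ` ?B" for z using Ug[OF that] by simp
  qed
  have "smooth_on (U ` ?B) g"
  proof (rule smooth_on_bootstrap[OF op, where H = "\<lambda>v z. v * inverse (w (snd z))" and T = "UNIV \<times> ?B"])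
    have o: "open ((UNIV :: real set) \<times> ?B)" by (intro open_Times) auto
    have "smooth_on (UNIV \<times> ?B) (\<lambda>z::real \<times> real. w (snd z))"
      by (rule smooth_on_compose[OF sm]) (use o in \<open>auto intro!: smooth_intros\<close>)
    then show "smooth_on (UNIV \<times> ?B) (\<lambda>z::real \<times> real. v * inverse (w (snd z)))" for v
      by (intro smooth_intros o) (use w in force)+
    show "(g has_derivative (\<lambda>v. v * inverse (w (snd (y, g y))))) (at y)" if "y \<in> U ` ?B" for y
      using dg[OF that] by (simp add: has_field_derivative_def mult_commute_abs)
  qed (use Ug in \<open>auto intro!: open_Times\<close>)
  with that op int gU Ug dg show ?thesis by blast
qed

lemma space_form_null_line:
  assumes "p \<in> space_form c" "B \<in> space_form_tangent c p" "lprod c B B = 0"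
  shows "p + t *\<^sub>R B \<in> space_form c" "X \<in> space_form_tangent c p \<Longrightarrow> lprod c X B = 0 \<Longrightarrow>
     X \<in> space_form_tangent c (p + t *\<^sub>R B)"
  using assms lprod_commute[of c B p] lprod_commute[of c B X]
  by (auto simp: space_form_def space_form_tangent_def lprod.add_left lprod.add_right lprod.scaleR_left
      lprod.scaleR_right split: if_splits)

text \<open>Every ruled surface in the space form with null rulings transversal to its directrix \<open>\<gamma>\<close> is a
  null scroll. A Riccati equation for \<open>l\<close> makes the directrix \<open>\<gamma> + l R\<close> null and a linear equation for
  \<open>U'\<close> makes its parameter affine. The value \<open>l u0 = -1\<close> keeps the new directrix away from \<open>\<gamma> u0\<close>, and
  \<open>U u0 = 1\<close> keeps \<open>U\<close> away from zero.\<close>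

lemma null_scroll_frame:
  assumes c: "c \<in> {-1, 0, 1}" and J: "open J" "u0 \<in> J"
    and sm: "smooth_on J \<gamma>" "smooth_on J R"
    and \<gamma>: "\<And>u. u \<in> J \<Longrightarrow> \<gamma> u \<in> space_form c" and R: "\<And>u. u \<in> J \<Longrightarrow> R u \<in> space_form_tangent c (\<gamma> u)"
    and null: "\<And>u. u \<in> J \<Longrightarrow> lprod c (R u) (R u) = 0"
    and trans: "\<And>u. u \<in> J \<Longrightarrow> lprod c (vector_derivative \<gamma> (at u)) (R u) \<noteq> 0"
  obtains e l \<rho> U w K \<alpha> A B C a b where "e > 0" "ball u0 e \<subseteq> J"
    "smooth_on (ball u0 e) l" "smooth_on (ball u0 e) \<rho>" "smooth_on (ball u0 e) U" "smooth_on (ball u0 e) w"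
    "l u0 = (-1::real)" "U u0 = (1::real)" "cartan_framed c K \<alpha> A B C a b"
    "\<And>u. u \<in> ball u0 e \<Longrightarrow> \<rho> u \<noteq> (0::real) \<and> w u > 0 \<and> (U has_real_derivative w u) (at u) \<and> U u \<in> K \<and>
      \<alpha> (U u) = \<gamma> u + l u *\<^sub>R R u \<and> B (U u) = \<rho> u *\<^sub>R R u"
proof -
  define \<gamma>' R' where "\<gamma>' u = vector_derivative \<gamma> (at u)" and "R' u = vector_derivative R (at u)" for u
  have d\<gamma>: "(\<gamma> has_vector_derivative \<gamma>' u) (at u)" and dR: "(R has_vector_derivative R' u) (at u)" if "u \<in> J" for u
    using smooth_on_vector_derivative(1)[OF J(1)] sm that by (auto simp: \<gamma>'_def R'_def)
  have sm': "smooth_on J \<gamma>'" "smooth_on J R'"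
    using smooth_on_vector_derivative(2)[OF J(1)] sm by (auto simp: \<gamma>'_def[abs_def] R'_def[abs_def])
  define g where "g u = lprod c (\<gamma>' u) (R u)" for u
  have g: "g u \<noteq> 0" if "u \<in> J" for u using trans[OF that] by (simp add: g_def \<gamma>'_def)
  have smg: "smooth_on J g" unfolding g_def by (intro smooth_on_lprod J sm sm')
  have RR': "lprod c (R' u) (R u) = 0" if "u \<in> J" for u
    using lprod_constant_derivative[OF J(1) that null dR[OF that] dR[OF that]] lprod_commute[of c "R u" "R' u"] by simp
  \<comment> \<open>the Riccati equation that makes \<open>\<gamma> + l R\<close> null\<close>
  have smr: "smooth_on J (\<lambda>u. - lprod c (R' u) (R' u) / (2 * g u))"
    "smooth_on J (\<lambda>u. - lprod c (\<gamma>' u) (R' u) / g u)" "smooth_on J (\<lambda>u. - lprod c (\<gamma>' u) (\<gamma>' u) / (2 * g u))"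
    using g by (auto intro!: smooth_intros smooth_on_lprod J sm' smg)
  note flow = riccati_flow[OF J smr, of "-1"]
  obtain E :: "(real \<times> real) set" and V :: "real \<Rightarrow> real \<Rightarrow> real"
    where E: "open E" "(u0, -1) \<in> E" "fst ` E \<subseteq> J" "smooth_on E (\<lambda>(u, v). V u v)" "V u0 (-1) = -1"
    "\<And>u v. (u, v) \<in> E \<Longrightarrow> ((\<lambda>s. V s v) has_real_derivative
      - lprod c (R' u) (R' u) / (2 * g u) * (V u v)\<^sup>2 + - lprod c (\<gamma>' u) (R' u) / g u * V u v
      + - lprod c (\<gamma>' u) (\<gamma>' u) / (2 * g u)) (at u)"
    by (rule flow) (rule that)
  define l l' where "l u = V u (-1)" and "l' u = - lprod c (R' u) (R' u) / (2 * g u) * (l u)\<^sup>2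
      + - lprod c (\<gamma>' u) (R' u) / g u * l u + - lprod c (\<gamma>' u) (\<gamma>' u) / (2 * g u)" for u
  obtain e1 where e1: "e1 > 0" "ball u0 e1 \<times> ball (-1) e1 \<subseteq> E" using box_neighbourhood[OF E(1,2)] by metis
  define J1 where "J1 = ball u0 e1"
  have J1E: "(u, -1) \<in> E" if "u \<in> J1" for u using e1 that by (auto simp: J1_def)
  then have J1: "open J1" "u0 \<in> J1" "J1 \<subseteq> J" using e1 E(3) by (force simp: J1_def)+
  have dl: "(l has_real_derivative l' u) (at u)" if "u \<in> J1" for u
    using E(6)[OF J1E[OF that]] by (simp add: l_def[abs_def] l'_def)
  have sml: "smooth_on J1 l"
  proof -
    have "smooth_on J1 (\<lambda>u. (\<lambda>(u, v). V u v) (u, - 1))"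
      by (rule smooth_on_compose[OF E(4)]) (use J1 J1E E(1) in \<open>auto intro!: smooth_intros\<close>)
    then show ?thesis by (simp add: l_def[abs_def])
  qed
  have sm1: "smooth_on J1 \<gamma>" "smooth_on J1 R" "smooth_on J1 \<gamma>'" "smooth_on J1 R'" "smooth_on J1 g"
    using sm sm' smg J1(3) smooth_on_subset by blast+
  have sml': "smooth_on J1 l'"
    unfolding l'_def using g J1
    by (auto intro!: smooth_intros smooth_on_lprod J1 sm1 sml)
  define \<beta> \<beta>' where "\<beta> u = \<gamma> u + l u *\<^sub>R R u" and "\<beta>' u = \<gamma>' u + (l u *\<^sub>R R' u + l' u *\<^sub>R R u)" for u
  have d\<beta>: "(\<beta> has_vector_derivative \<beta>' u) (at u)" if u: "u \<in> J1" for u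
    unfolding \<beta>_def \<beta>'_def
    by (intro has_vector_derivative_add has_vector_derivative_scaleR d\<gamma> dR dl u subsetD[OF J1(3) u])
  have sm\<beta>: "smooth_on J1 \<beta>" "smooth_on J1 \<beta>'"
    unfolding \<beta>_def \<beta>'_def by (intro smooth_intros J1 sm1 sml sml')+
  have \<beta>R: "lprod c (\<beta>' u) (R u) = g u" if "u \<in> J1" for u
    using RR'[of u] null[of u] that J1(3)
    by (auto simp: \<beta>'_def g_def lprod.add_left lprod.scaleR_left)
  have \<beta>\<beta>: "lprod c (\<beta>' u) (\<beta>' u) = 0" if u: "u \<in> J1" for u
  proof -
    have uJ: "u \<in> J" using u J1 by auto
    define p q r where "p = lprod c (R' u) (R' u)" and "q = lprod c (\<gamma>' u) (R' u)" and "r = lprod c (\<gamma>' u) (\<gamma>' u)"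
    have "lprod c (\<beta>' u) (\<beta>' u) = r + 2 * l u * q + 2 * l' u * g u + (l u)\<^sup>2 * p"
      using RR'[OF uJ] null[OF uJ] lprod_commute[of c "R u" "R' u"] lprod_commute[of c "R u" "\<gamma>' u"]
        lprod_commute[of c "R' u" "\<gamma>' u"]
      by (simp add: \<beta>'_def g_def p_def q_def r_def lprod.add_left lprod.add_right lprod.scaleR_left lprod.scaleR_right
         power2_eq_square algebra_simps)
    also have "\<dots> = 0" using g[OF uJ] unfolding l'_def p_def[symmetric] q_def[symmetric] r_def[symmetric]
      by (simp add: field_simps)
    finally show ?thesis .
  qed
  have \<beta>sf: "\<beta> u \<in> space_form c" "R u \<in> space_form_tangent c (\<beta> u)" if "u \<in> J1" for u
    using space_form_null_line[OF \<gamma> R null] R null that J1(3) unfolding \<beta>_def by blast+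
  \<comment> \<open>the linear equation that makes the parameter affine\<close>
  define \<beta>'' where "\<beta>'' u = vector_derivative \<beta>' (at u)" for u
  have d\<beta>': "(\<beta>' has_vector_derivative \<beta>'' u) (at u)" if "u \<in> J1" for u
    unfolding \<beta>''_def by (rule smooth_on_vector_derivative(1)[OF J1(1) sm\<beta>(2) that])
  have sm\<beta>'': "smooth_on J1 \<beta>''"
    unfolding \<beta>''_def[abs_def] by (rule smooth_on_vector_derivative(2)[OF J1(1) sm\<beta>(2)])
  define h where "h u = lprod c (\<beta>'' u) (R u) / g u" for u
  have smh: "smooth_on J1 h"
    unfolding h_def using g J1 by (auto intro!: smooth_intros smooth_on_lprod sm1 sm\<beta>'')
  obtain e2 H where e2: "0 < e2" "ball u0 e2 \<subseteq> J1" "smooth_on (ball u0 e2) H" "H u0 = (0::real)"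
    "\<And>u. u \<in> ball u0 e2 \<Longrightarrow> (H has_real_derivative h u) (at u)"
    using local_antiderivative[OF J1(1,2) smh, of 0] by metis
  define w where "w u = exp (H u)" for u
  have smw2: "smooth_on (ball u0 e2) w" unfolding w_def by (intro smooth_intros e2) auto
  obtain e U where e: "0 < e" "ball u0 e \<subseteq> ball u0 e2" "smooth_on (ball u0 e) U" "U u0 = (1::real)"
    "\<And>u. u \<in> ball u0 e \<Longrightarrow> (U has_real_derivative w u) (at u)"
    using local_antiderivative[OF open_ball _ smw2, of u0 1] e2(1) by (metis centre_in_ball)
  define S where "S = ball u0 e"
  have S: "open S" "u0 \<in> S" "S \<subseteq> J1" "S \<subseteq> J" "S \<subseteq> ball u0 e2" using e e2 J1 by (auto simp: S_def)
  have w: "w u > 0" for u by (simp add: w_def)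
  have smw: "smooth_on S w" using smw2 S(5) smooth_on_subset by blast
  have dw: "(w has_real_derivative h u * w u) (at u)" if "u \<in> S" for u
    unfolding w_def using e2(5) S(5) that by (auto intro!: derivative_eq_intros)
  obtain G where G: "open (U ` S)" "is_interval (U ` S)" "\<And>u. u \<in> S \<Longrightarrow> G (U u) = u"
    "\<And>s. s \<in> U ` S \<Longrightarrow> G s \<in> S \<and> U (G s) = s" "smooth_on (U ` S) G"
    "\<And>s. s \<in> U ` S \<Longrightarrow> (G has_real_derivative inverse (w (G s))) (at s)"
    by (rule smooth_inverse_real[OF e(1) smw[unfolded S_def] e(5) w, folded S_def], assumption) (rule that)
  \<comment> \<open>\<open>n\<close> is the normal of the space form and \<open>k = 1\<close> iff it moves along the curve; all frame
    fields are functions of \<open>u\<close> until the inverse \<open>G\<close> of \<open>U\<close> is inserted at the end\<close>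
  define \<rho> where "\<rho> u = - w u / g u" for u
  define A B where "A u = inverse (w u) *\<^sub>R \<beta>' u" and "B u = \<rho> u *\<^sub>R R u" for u
  define n where "n u = (if c = 0 then axis 4 1 else \<beta> u)" for u
  define \<nu> k where "\<nu> = (if c = 0 then 1 else c)" and "k = (if c = 0 then 0 else 1::real)"
  define C where "C u = vector_product c (A u) (B u) (n u)" for u
  have smS: "smooth_on S \<beta>'" "smooth_on S \<beta>" "smooth_on S R" "smooth_on S g" "smooth_on S l"
    using sm1 sm\<beta> sml S(3) smooth_on_subset by blast+
  have sm\<rho>: "smooth_on S \<rho>" unfolding \<rho>_def using g S by (auto intro!: smooth_intros smw smS)
  have smn: "smooth_on S n" unfolding n_def[abs_def] using smS by (cases "c = 0") (auto intro: smooth_on_const)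
  have smA: "smooth_on S A" unfolding A_def using w by (auto intro!: smooth_intros S smw smS simp: less_imp_neq[symmetric])
  have smB: "smooth_on S B" unfolding B_def by (intro smooth_intros S sm\<rho> smS)
  have smC: "smooth_on S C" unfolding C_def by (intro smooth_on_vector_product S smA smB smn)
  have \<nu>: "\<nu> \<noteq> 0" "k / \<nu> = (if c = 0 then 0 else c)" using c by (auto simp: \<nu>_def k_def)
  have tang: "\<beta>' u \<in> space_form_tangent c (\<beta> u)" if u: "u \<in> S" for u
  proof (cases "c = 0")
    case True
    have "((\<lambda>u. \<beta> u $ 4) has_vector_derivative \<beta>' u $ 4) (at u)"
      using bounded_linear.has_vector_derivative[OF bounded_linear_vec_nth d\<beta>] u S by blast
    moreover have "((\<lambda>u. \<beta> u $ 4) has_vector_derivative 0) (at u)"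
      by (rule has_vector_derivative_transform_within_open[OF has_vector_derivative_const S(1) u, of 0])
         (use \<beta>sf True S in \<open>auto simp: space_form_def\<close>)
    ultimately have "\<beta>' u $ 4 = 0" by (rule vector_derivative_unique_at)
    then show ?thesis using True by (simp add: space_form_tangent_def)
  next
    case False
    have "lprod c (\<beta> u) (\<beta> u) = c" if "u \<in> S" for u using \<beta>sf(1)[of u] that False S by (auto simp: space_form_def)
    from lprod_constant_derivative[OF S(1) u this d\<beta> d\<beta>] u S
    have "lprod c (\<beta>' u) (\<beta> u) = 0" using lprod_commute[of c "\<beta> u" "\<beta>' u"] by auto
    then show ?thesis using False lprod_commute by (auto simp: space_form_tangent_def)
  qed
  have tang2: "A u \<in> space_form_tangent c (\<beta> u)" "B u \<in> space_form_tangent c (\<beta> u)" if "u \<in> S" for u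
    using tang[OF that] \<beta>sf(2)[of u] that S
    by (auto simp: A_def B_def space_form_tangent_def lprod.scaleR_right split: if_splits)
  have axis4: "lprod d X (axis 4 1) = X $ 4" for d X by (simp add: lprod_def axis_def)
  have gram: "lprod c (A u) (A u) = 0" "lprod c (B u) (B u) = 0" "lprod c (A u) (B u) = -1"
    "lprod c (n u) (n u) = \<nu>" "lprod c (A u) (n u) = 0" "lprod c (B u) (n u) = 0" if u: "u \<in> S" for u
  proof -
    have u': "u \<in> J1" "u \<in> J" using u S by auto
    show "lprod c (A u) (A u) = 0" "lprod c (B u) (B u) = 0"
      using \<beta>\<beta>[OF u'(1)] null[OF u'(2)] by (auto simp: A_def B_def lprod.scaleR_left lprod.scaleR_right)
    show "lprod c (A u) (B u) = -1" using \<beta>R[OF u'(1)] g[OF u'(2)] w[of u]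
      by (simp add: A_def B_def \<rho>_def lprod.scaleR_left lprod.scaleR_right lprod.minus_right)
    show "lprod c (n u) (n u) = \<nu>" using \<beta>sf(1)[OF u'(1)] by (auto simp: n_def \<nu>_def lprod_def axis_def space_form_def)
    show "lprod c (A u) (n u) = 0" "lprod c (B u) (n u) = 0"
      using tang2[OF u] lprod_commute[of c "\<beta> u" "A u"] lprod_commute[of c "\<beta> u" "B u"] by (auto simp: n_def axis4 space_form_tangent_def split: if_splits)
  qed
  have gramC: "lprod c (C u) (A u) = 0" "lprod c (C u) (B u) = 0" "lprod c (C u) (n u) = 0" for u
    unfolding C_def by (rule vector_product_orthogonal)+
  have CC: "lprod c (C u) (C u) = 1" if "u \<in> S" for u
    using gram[OF that] c unfolding C_def vector_product_square by (auto simp: \<nu>_def)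
  have Ctang: "C u \<in> space_form_tangent c (\<beta> u)" for u
    using gramC(3)[of u] lprod_commute[of c "\<beta> u" "C u"] by (auto simp: n_def axis4 space_form_tangent_def split: if_splits)
  define A' B' C' where "A' u = vector_derivative A (at u)" and "B' u = vector_derivative B (at u)"
    and "C' u = vector_derivative C (at u)" for u
  have dA: "(A has_vector_derivative A' u) (at u)" and dB: "(B has_vector_derivative B' u) (at u)"
    and dC: "(C has_vector_derivative C' u) (at u)" if "u \<in> S" for u
    using smooth_on_vector_derivative(1)[OF S(1)] smA smB smC that by (auto simp: A'_def B'_def C'_def)
  have smA': "smooth_on S A'" and smB': "smooth_on S B'"
    using smooth_on_vector_derivative(2)[OF S(1)] smA smB by (auto simp: A'_def[abs_def] B'_def[abs_def])
  have dn: "(n has_vector_derivative (k * w u) *\<^sub>R A u) (at u)" if u: "u \<in> S" for u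
    using d\<beta>[of u] u S w[of u] by (auto simp: n_def[abs_def] k_def A_def)
  have par: "lprod c (A' u) (B u) = 0" if u: "u \<in> S" for u
  proof -
    have u': "u \<in> J1" "u \<in> J" using u S by auto
    have "(A has_vector_derivative inverse (w u) *\<^sub>R \<beta>'' u + - (inverse (w u) * (h u * w u) * inverse (w u)) *\<^sub>R \<beta>' u) (at u)"
      unfolding A_def using DERIV_inverse_fun[OF dw[OF u]] w[of u] less_imp_neq[OF w]
      by (intro has_vector_derivative_scaleR d\<beta>' u') (auto simp: power2_eq_square divide_inverse mult_ac)
    then have A'u: "A' u = inverse (w u) *\<^sub>R \<beta>'' u + - (inverse (w u) * (h u * w u) * inverse (w u)) *\<^sub>R \<beta>' u"
      using dA[OF u] vector_derivative_unique_at by blast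
    have "lprod c (A' u) (R u) = inverse (w u) * (h u * g u) - inverse (w u) * (h u * w u) * inverse (w u) * g u"
      using g[OF u'(2)] unfolding A'u lprod.add_left lprod.scaleR_left \<beta>R[OF u'(1)] by (simp add: h_def)
    also have "\<dots> = 0" using w[of u] by simp
    finally show ?thesis by (simp add: B_def lprod.scaleR_right)
  qed
  define a b where "a u = inverse (w u) * lprod c (A' u) (C u)" and "b u = inverse (w u) * lprod c (B' u) (C u)" for u
  have sma: "smooth_on S a" "smooth_on S b"
    unfolding a_def b_def using w
    by (auto intro!: smooth_intros smooth_on_lprod S smw smA' smB' smC simp: less_imp_neq[symmetric])
  have frenet: "A' u = w u *\<^sub>R (a u *\<^sub>R C u)" "B' u = w u *\<^sub>R (b u *\<^sub>R C u + c *\<^sub>R \<beta> u)"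
    "C' u = w u *\<^sub>R (b u *\<^sub>R A u + a u *\<^sub>R B u)" if u: "u \<in> S" for u
  proof -
    note eq = null_frame_equations[OF S(1) u gram(1-3) CC gram(4) \<nu>(1) gramC(1,2) gram(5,6) gramC(3)
      dA[OF u] dB[OF u] dC[OF u] dn[OF u] par[OF u]]
    have wab: "w u * a u = lprod c (A' u) (C u)" "w u * b u = lprod c (B' u) (C u)"
      using w[of u] by (auto simp: a_def b_def)
    have kn: "(k * w u / \<nu>) *\<^sub>R n u = w u *\<^sub>R (c *\<^sub>R \<beta> u)"
      using \<nu>(2) c by (auto simp: n_def k_def \<nu>_def)
    show "A' u = w u *\<^sub>R (a u *\<^sub>R C u)" using eq(1) by (simp add: wab)
    show "B' u = w u *\<^sub>R (b u *\<^sub>R C u + c *\<^sub>R \<beta> u)" using eq(2) unfolding kn by (simp add: wab scaleR_add_right)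
    show "C' u = w u *\<^sub>R (b u *\<^sub>R A u + a u *\<^sub>R B u)" using eq(3) by (simp add: wab scaleR_add_right)
  qed
  have pull: "((\<lambda>s. X (G s)) has_vector_derivative Y) (at s)"
    if "(X has_vector_derivative w (G s) *\<^sub>R Y) (at (G s))" "s \<in> U ` S" for X :: "real \<Rightarrow> real ^ 4" and Y s
    using vector_diff_chain_at[OF G(6)[OF that(2), unfolded has_real_derivative_iff_has_vector_derivative] that(1)] w[of "G s"]
    by (simp add: o_def)
  have smpull: "smooth_on (U ` S) (\<lambda>s. X (G s))" if "smooth_on S X" for X :: "real \<Rightarrow> 'b::real_normed_vector"
    by (rule smooth_on_compose[OF that G(5,1) S(1)]) (use G(4) in auto)
  have "cartan_framed c (U ` S) (\<lambda>s. \<beta> (G s)) (\<lambda>s. A (G s)) (\<lambda>s. B (G s)) (\<lambda>s. C (G s)) (\<lambda>s. a (G s)) (\<lambda>s. b (G s))"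
    unfolding cartan_framed_def
  proof (intro conjI ballI G(1,2) smpull smA smB smC sma smS)
    fix s assume s: "s \<in> U ` S"
    have u: "G s \<in> S" "G s \<in> J1" using G(4)[OF s] S by auto
    show "\<beta> (G s) \<in> space_form c" by (rule \<beta>sf(1)[OF u(2)])
    show "A (G s) \<in> space_form_tangent c (\<beta> (G s))" "B (G s) \<in> space_form_tangent c (\<beta> (G s))"
      "C (G s) \<in> space_form_tangent c (\<beta> (G s))" using tang2[OF u(1)] Ctang by auto
    show "lprod c (A (G s)) (B (G s)) = - 1" "lprod c (C (G s)) (C (G s)) = 1" "lprod c (A (G s)) (A (G s)) = 0"
      "lprod c (B (G s)) (B (G s)) = 0" "lprod c (C (G s)) (A (G s)) = 0" "lprod c (C (G s)) (B (G s)) = 0"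
      using gram[OF u(1)] CC[OF u(1)] gramC by auto
    show "((\<lambda>s. \<beta> (G s)) has_vector_derivative A (G s)) (at s)"
      by (rule pull[OF _ s]) (use d\<beta>[OF u(2)] w[of "G s"] in \<open>simp add: A_def\<close>)
    show "((\<lambda>s. A (G s)) has_vector_derivative a (G s) *\<^sub>R C (G s)) (at s)"
      "((\<lambda>s. B (G s)) has_vector_derivative b (G s) *\<^sub>R C (G s) + c *\<^sub>R \<beta> (G s)) (at s)"
      "((\<lambda>s. C (G s)) has_vector_derivative b (G s) *\<^sub>R A (G s) + a (G s) *\<^sub>R B (G s)) (at s)"
      by (rule pull[OF _ s], use dA[OF u(1)] dB[OF u(1)] dC[OF u(1)] frenet[OF u(1)] in simp)+
  qed
  moreover have "\<rho> u \<noteq> 0" if "u \<in> S" for u using g[of u] w[of u] that S by (auto simp: \<rho>_def)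
  moreover have "l u0 = -1" using E(5) by (simp add: l_def)
  ultimately show ?thesis
    using that[of e l \<rho> U w] e(1,3,4,5) S G(3) w smw smS(5) sm\<rho> unfolding S_def[symmetric]
    by (auto simp: \<beta>_def B_def)
qed

section \<open>Class A surfaces are null scrolls\<close>

lemma partial_derivatives:
  fixes h :: "real \<times> real \<Rightarrow> 'b::real_normed_vector"
  assumes "smooth_on S h" "(u, t) \<in> S"
  shows "((\<lambda>s. h (s, t)) has_vector_derivative frechet_derivative h (at (u, t)) (1, 0)) (at u)"
    and "((\<lambda>s. h (u, s)) has_vector_derivative frechet_derivative h (at (u, t)) (0, 1)) (at t)"
proof -
  note d = smooth_on_has_derivative[OF assms]
  have lin: "frechet_derivative h (at (u, t)) (r, 0) = r *\<^sub>R frechet_derivative h (at (u, t)) (1, 0)"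
    "frechet_derivative h (at (u, t)) (0, r) = r *\<^sub>R frechet_derivative h (at (u, t)) (0, 1)" for r
    using linear_cmul[OF has_derivative_linear[OF d], of r "(1, 0)"] linear_cmul[OF has_derivative_linear[OF d], of r "(0, 1)"]
    by auto
  have "((\<lambda>s. h (s, t)) has_derivative (\<lambda>r. frechet_derivative h (at (u, t)) (r, 0))) (at u)"
    by (rule has_derivative_compose[where g = h]) (auto intro!: derivative_eq_intros d)
  then show "((\<lambda>s. h (s, t)) has_vector_derivative frechet_derivative h (at (u, t)) (1, 0)) (at u)"
    unfolding has_vector_derivative_def lin(1)[symmetric] .
  have "((\<lambda>s. h (u, s)) has_derivative (\<lambda>r. frechet_derivative h (at (u, t)) (0, r))) (at t)"
    by (rule has_derivative_compose[where g = h]) (auto intro!: derivative_eq_intros d)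
  then show "((\<lambda>s. h (u, s)) has_vector_derivative frechet_derivative h (at (u, t)) (0, 1)) (at t)"
    unfolding has_vector_derivative_def lin(2)[symmetric] .
qed

lemma inj_graph_coordinate:
  fixes h :: "real \<times> real \<Rightarrow> real"
  assumes "smooth_on S h" "q \<in> S" "frechet_derivative h (at q) (0, 1) \<noteq> 0"
  shows "inj (frechet_derivative (\<lambda>q. (fst q, h q)) (at q))"
proof -
  note d = smooth_on_has_derivative[OF assms(1,2)]
  have "((\<lambda>q. (fst q, h q)) has_derivative (\<lambda>v. (fst v, frechet_derivative h (at q) v))) (at q)"
    by (intro has_derivative_Pair d) (auto intro!: derivative_eq_intros)
  note d2 = this frechet_derivative_at[OF this]
  have "v = 0" if "fst v = 0" "frechet_derivative h (at q) v = 0" for v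
  proof -
    have "v = snd v *\<^sub>R (0, 1)" using that(1) by (simp add: prod_eq_iff)
    then have "snd v * frechet_derivative h (at q) (0, 1) = 0"
      using linear_cmul[OF has_derivative_linear[OF d]] that(2) by (metis real_scaleR_def)
    then show ?thesis using assms(3) that(1) by (simp add: prod_eq_iff)
  qed
  then show ?thesis
    unfolding d2(2)[symmetric] linear_injective_0[OF has_derivative_linear[OF d2(1)]]
    by (simp add: zero_prod_def)
qed

text \<open>A curve whose acceleration is proportional to its nonzero velocity runs in a line: the
  quotients of the components of the velocity are constant.\<close>

lemma ruled_of_parallel_acceleration:
  fixes Y :: "real \<times> real \<Rightarrow> real ^ 'n"
  assumes e: "e > 0" and sm: "smooth_on (ball u0 e \<times> ball t0 e) Y"
    and nz: "frechet_derivative Y (at (u0, t0)) (0, 1) \<noteq> 0"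
    and par: "\<And>q. q \<in> ball u0 e \<times> ball t0 e \<Longrightarrow>
      \<exists>k. second_derivative Y q (0, 1) (0, 1) = k *\<^sub>R frechet_derivative Y (at q) (0, 1)"
  obtains d \<mu> where "0 < d" "d \<le> e" "smooth_on (ball u0 d \<times> ball t0 d) \<mu>" "\<mu> (u0, t0) = (0::real)"
    "\<And>u t. (u, t) \<in> ball u0 d \<times> ball t0 d \<Longrightarrow> frechet_derivative \<mu> (at (u, t)) (0, 1) \<noteq> 0 \<and>
      Y (u, t) = Y (u, t0) + \<mu> (u, t) *\<^sub>R frechet_derivative Y (at (u, t0)) (0, 1)"
proof -
  let ?E = "ball u0 e \<times> ball t0 e"
  define Yt where "Yt q = frechet_derivative Y (at q) (0, 1)" for q
  have opE: "open ?E" by (intro open_Times) auto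
  have smYt: "smooth_on ?E Yt" unfolding Yt_def by (rule smooth_on_frechet_derivative[OF sm])
  obtain i where i: "Yt (u0, t0) $ i \<noteq> 0" using nz by (auto simp: Yt_def vec_eq_iff)
  have "open {q \<in> ?E. Yt q $ i \<in> - {0}}"
    by (rule continuous_open_preimage[OF smooth_on_imp_continuous_on[OF smooth_on_vec_nth[OF opE smYt]] opE,
          unfolded vimage_def, simplified Int_def mem_Collect_eq]) auto
  from box_neighbourhood[OF this, of u0 t0] i e
  obtain d where d: "d > 0" "ball u0 d \<times> ball t0 d \<subseteq> {q \<in> ?E. Yt q $ i \<in> - {0}}" by auto
  define m where "m = min d e"
  have m: "m > 0" "m \<le> e" using d e by (auto simp: m_def)
  define D where "D = ball u0 m \<times> ball t0 m"
  have D: "open D" "D \<subseteq> ?E" "\<And>q. q \<in> D \<Longrightarrow> Yt q $ i \<noteq> 0"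
    using d by (auto simp: D_def m_def open_Times subset_iff)
  have t0D: "(u, t0) \<in> D" if "(u, t) \<in> D" for u t using that m by (auto simp: D_def)
  define \<mu> where "\<mu> q = (Y q $ i - Y (fst q, t0) $ i) / Yt (fst q, t0) $ i" for q
  have t0i: "(\<lambda>q. (fst q, t0)) ` D \<subseteq> D" using t0D by auto
  have smD: "smooth_on D Y" "smooth_on D Yt" using sm smYt D(2) smooth_on_subset by blast+
  have smt: "smooth_on D (\<lambda>q. X (fst q, t0))" if "smooth_on D X" for X :: "real \<times> real \<Rightarrow> real ^ 'n"
    by (rule smooth_on_compose[OF that _ D(1,1) t0i]) (intro smooth_intros D)
  have sm\<mu>: "smooth_on D \<mu>"
    unfolding \<mu>_def using D(3) t0i by (intro smooth_intros D smD smt) auto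
  have line: "Y (u, t) = Y (u, t0) + \<mu> (u, t) *\<^sub>R Yt (u, t0)" if ut: "(u, t) \<in> D" for u t
  proof -
    have in_D: "(u, s) \<in> D" if "s \<in> ball t0 m" for s using that ut by (auto simp: D_def)
    have tm: "t \<in> ball t0 m" "t0 \<in> ball t0 m" using ut m by (auto simp: D_def)
    have dY: "((\<lambda>s. Y (u, s) $ j) has_real_derivative Yt (u, s) $ j) (at s)"
      and dYt: "((\<lambda>s. Yt (u, s) $ j) has_real_derivative second_derivative Y (u, s) (0, 1) (0, 1) $ j) (at s)"
      if "s \<in> ball t0 m" for s j
      using bounded_linear.has_vector_derivative[OF bounded_linear_vec_nth partial_derivatives(2)[OF smD(1) in_D[OF that]]]
        bounded_linear.has_vector_derivative[OF bounded_linear_vec_nth partial_derivatives(2)[OF smD(2) in_D[OF that]]]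
      by (auto simp: has_real_derivative_iff_has_vector_derivative Yt_def[abs_def] second_derivative_def)
    have const: "h r = h t0" if h: "\<And>s. s \<in> ball t0 m \<Longrightarrow> (h has_real_derivative 0) (at s)" and r: "r \<in> ball t0 m"
      for h :: "real \<Rightarrow> real" and r
    proof -
      have "\<exists>k. \<forall>s\<in>ball t0 m. h s = k"
        by (rule has_field_derivative_zero_constant[OF convex_ball]) (rule has_field_derivative_at_within[OF h])
      then show ?thesis using r tm(2) by auto
    qed
    have ratio: "Yt (u, s) $ j = Yt (u, t0) $ j / Yt (u, t0) $ i * Yt (u, s) $ i" if s: "s \<in> ball t0 m" for s j
    proof -
      have "((\<lambda>s. Yt (u, s) $ j / Yt (u, s) $ i) has_real_derivative 0) (at s)" if s: "s \<in> ball t0 m" for s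
      proof -
        obtain k where "second_derivative Y (u, s) (0, 1) (0, 1) = k *\<^sub>R Yt (u, s)"
          using par[OF subsetD[OF D(2) in_D[OF s]]] unfolding Yt_def by blast
        then show ?thesis using DERIV_divide[OF dYt[OF s, of j] dYt[OF s, of i] D(3)[OF in_D[OF s]]] by simp
      qed
      then have "Yt (u, s) $ j / Yt (u, s) $ i = Yt (u, t0) $ j / Yt (u, t0) $ i"
        using const[OF _ s] by blast
      then show ?thesis using D(3)[OF in_D[OF s]] by (simp add: field_simps)
    qed
    have diff_eq_imp: "p = q + (r - s)" if "p - r = q - s" for p q r s :: real using that by simp
    have "Y (u, t) $ j = Y (u, t0) $ j + \<mu> (u, t) * Yt (u, t0) $ j" for j
    proof -
      have "((\<lambda>s. Y (u, s) $ j - Yt (u, t0) $ j / Yt (u, t0) $ i * Y (u, s) $ i) has_real_derivative 0) (at s)"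
        if s: "s \<in> ball t0 m" for s
        using DERIV_diff[OF dY[OF s, of j] DERIV_cmult[OF dY[OF s, of i], of "Yt (u, t0) $ j / Yt (u, t0) $ i"]]
        unfolding ratio[OF s, of j] by simp
      from const[OF this tm(1)]
      have "Y (u, t) $ j = Y (u, t0) $ j + (Yt (u, t0) $ j / Yt (u, t0) $ i * Y (u, t) $ i -
          Yt (u, t0) $ j / Yt (u, t0) $ i * Y (u, t0) $ i)" by (rule diff_eq_imp)
      also have "Yt (u, t0) $ j / Yt (u, t0) $ i * Y (u, t) $ i - Yt (u, t0) $ j / Yt (u, t0) $ i * Y (u, t0) $ i
          = \<mu> (u, t) * Yt (u, t0) $ j" by (simp add: \<mu>_def diff_divide_distrib algebra_simps)
      finally show ?thesis .
    qed
    then show ?thesis by (simp add: vec_eq_iff)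
  qed
  have "frechet_derivative \<mu> (at (u, t)) (0, 1) \<noteq> 0" if ut: "(u, t) \<in> D" for u t
  proof -
    have "((\<lambda>s. Y (u, s) $ i) has_real_derivative Yt (u, t) $ i) (at t)"
      using bounded_linear.has_vector_derivative[OF bounded_linear_vec_nth partial_derivatives(2)[OF smD(1) ut]]
      by (auto simp: has_real_derivative_iff_has_vector_derivative Yt_def)
    then have "((\<lambda>s. \<mu> (u, s)) has_real_derivative (Yt (u, t) $ i - 0) / Yt (u, t0) $ i) (at t)"
      unfolding \<mu>_def fst_conv by (intro DERIV_cdivide DERIV_diff DERIV_const)
    then have "frechet_derivative \<mu> (at (u, t)) (0, 1) = Yt (u, t) $ i / Yt (u, t0) $ i"
      using partial_derivatives(2)[OF sm\<mu> ut] vector_derivative_unique_at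
      by (fastforce simp: has_real_derivative_iff_has_vector_derivative)
    then show ?thesis using D(3)[OF ut] D(3)[OF t0D[OF ut]] by simp
  qed
  with line show ?thesis
    using that[of m \<mu>] m sm\<mu> unfolding D_def[symmetric] Yt_def by (auto simp: \<mu>_def)
qed

locale adapted_chart = lightlike_chart c f I D \<phi> for c f I D \<phi> +
  assumes adapted: "q \<in> D \<Longrightarrow> snd (\<phi> q) = fst q"
begin

lemma snd_d\<phi>: assumes q: "q \<in> D" shows "snd (d\<phi> q w) = fst w"
proof -
  have "((\<lambda>q. snd (\<phi> q)) has_derivative fst) (at q)"
    by (rule has_derivative_transform_within_open[OF _ open_D q, of fst])
       (auto simp: adapted intro: bounded_linear_imp_has_derivative bounded_linear_fst)
  from has_derivative_unique[OF has_derivative_snd[OF d\<phi>[OF q]] this] show ?thesis by (rule fun_cong)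
qed

lemma d\<phi>_vertical: assumes q: "q \<in> D"
  shows "fst (d\<phi> q (0, 1)) \<noteq> 0" "lprod c (fst (d\<phi> q (0, 1))) (fst (d\<phi> q (0, 1))) = 0"
proof -
  have s: "snd (d\<phi> q (0, 1)) = 0" using snd_d\<phi>[OF q] by simp
  have "d\<phi> q (0, 1) \<noteq> 0"
    using chart_inj[OF q] linear_0[OF linear_d\<phi>[OF q]] by (metis injD zero_prod_def prod.inject zero_neq_one)
  then show "fst (d\<phi> q (0, 1)) \<noteq> 0" using s by (auto simp: prod_eq_iff)
  show "lprod c (fst (d\<phi> q (0, 1))) (fst (d\<phi> q (0, 1))) = 0" by (rule horizontal_null[OF q s])
qed

text \<open>Otherwise the vertical null vector would be orthogonal to the whole Lorentzian tangent plane.\<close>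

lemma d\<phi>_transversal: assumes q: "q \<in> D"
  shows "lprod c (fst (d\<phi> q (1, 0))) (fst (d\<phi> q (0, 1))) \<noteq> 0"
proof
  assume z: "lprod c (fst (d\<phi> q (1, 0))) (fst (d\<phi> q (0, 1))) = 0"
  have s: "snd (d\<phi> q (0, 1)) = 0" using snd_d\<phi>[OF q] by simp
  have "d\<phi> q (0, 1) = 0"
  proof (rule tangent_nondegenerate[OF q tangent_plane_mem])
    fix X assume "X \<in> tangent_plane \<phi> q"
    then obtain w where w: "X = d\<phi> q w" by (auto simp: tangent_plane_def)
    have "w = fst w *\<^sub>R (1, 0) + snd w *\<^sub>R (0, 1)" by simp
    then have X: "X = fst w *\<^sub>R d\<phi> q (1, 0) + snd w *\<^sub>R d\<phi> q (0, 1)"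
      using linear_add[OF linear_d\<phi>[OF q]] linear_cmul[OF linear_d\<phi>[OF q]] w by metis
    show "wmetric c f (\<phi> q) (d\<phi> q (0, 1)) X = 0"
      unfolding X wmetric.add_right wmetric.scaleR_right
      using d\<phi>_vertical(2)[OF q] z lprod_commute[of c "fst (d\<phi> q (0, 1))" "fst (d\<phi> q (1, 0))"]
      by (simp add: wmetric_def s)
  qed
  then show False using d\<phi>_vertical(1)[OF q] by simp
qed

lemma smooth_fst_chart: "smooth_on D (\<lambda>q. fst (\<phi> q))"
  by (intro smooth_intros open_D smooth_chart)

lemma frechet_derivative_fst_chart:
  "q \<in> D \<Longrightarrow> frechet_derivative (\<lambda>q. fst (\<phi> q)) (at q) w = fst (d\<phi> q w)"
  using frechet_derivative_linear_compose[OF bounded_linear_fst] d\<phi> differentiable_def by blast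

text \<open>Obtained by differentiating along the level curve that its velocity is horizontal, tangent to
  the space form and null.\<close>

lemma second_derivative_vertical:
  assumes q: "q \<in> D"
  shows "second_derivative \<phi> q (0, 1) (0, 1) = (second_derivative (\<lambda>q. fst (\<phi> q)) q (0, 1) (0, 1), 0)"
    and "second_derivative \<phi> q (0, 1) (0, 1) \<in> ambient_tangent c (\<phi> q)"
proof -
  let ?X = "\<lambda>r. d\<phi> r (0, 1)"
  let ?d2 = "\<lambda>w. second_derivative \<phi> q w (0, 1)"
  have d2: "(?X has_derivative ?d2) (at q)"
    unfolding second_derivative_def by (rule smooth_on_has_derivative[OF smooth_on_frechet_derivative[OF smooth_chart] q])
  have s: "snd (?d2 w) = 0" for w
    by (rule derivative_of_constant[OF has_derivative_snd[OF d2] open_D q]) (simp add: snd_d\<phi>)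
  have "((\<lambda>r. frechet_derivative (\<lambda>q. fst (\<phi> q)) (at r) (0, 1)) has_derivative (\<lambda>w. fst (?d2 w))) (at q)"
    by (rule has_derivative_transform_within_open[OF has_derivative_fst[OF d2] open_D q])
       (simp add: frechet_derivative_fst_chart)
  then have "second_derivative (\<lambda>q. fst (\<phi> q)) q w (0, 1) = fst (?d2 w)" for w
    unfolding second_derivative_def using frechet_derivative_at by metis
  then show "second_derivative \<phi> q (0, 1) (0, 1) = (second_derivative (\<lambda>q. fst (\<phi> q)) q (0, 1) (0, 1), 0)"
    using s by (simp add: prod_eq_iff)
  have tan: "?X r \<in> ambient_tangent c (\<phi> r)" if "r \<in> D" for r
    by (rule derivative_in_ambient_tangent[OF d\<phi>[OF that] open_D that chart_ambient])
  show "?d2 (0, 1) \<in> ambient_tangent c (\<phi> q)"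
  proof (cases "c = 0")
    case True
    have "fst (?d2 (0, 1)) $ 4 = 0"
      by (rule derivative_of_constant[OF bounded_linear.has_derivative[OF bounded_linear_vec_nth has_derivative_fst[OF d2]] open_D q])
         (use tan True in \<open>auto simp: ambient_tangent_def space_form_tangent_def mem_Times_iff\<close>)
    then show ?thesis using True by (simp add: ambient_tangent_def space_form_tangent_def mem_Times_iff)
  next
    case False
    have "lprod c (fst (\<phi> q)) (fst (?d2 (0, 1))) + lprod c (fst (?X q)) (fst (?X q)) = 0"
      by (rule derivative_of_constant[OF lprod.FDERIV[OF has_derivative_fst[OF d\<phi>[OF q]] has_derivative_fst[OF d2]] open_D q])
         (use tan False in \<open>auto simp: ambient_tangent_def space_form_tangent_def mem_Times_iff\<close>)
    then show ?thesis using False d\<phi>_vertical(2)[OF q]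
      by (simp add: ambient_tangent_def space_form_tangent_def mem_Times_iff)
  qed
qed

text \<open>By class A the acceleration of a level curve has no normal component. It is also horizontal, and
  horizontal tangent vectors are multiples of the velocity.\<close>

lemma parallel_acceleration:
  assumes q: "q \<in> D"
    and A: "\<And>\<xi>. \<xi> \<in> normal_space c f \<phi> q \<Longrightarrow>
      \<exists>k. shape_op c f \<phi> q \<xi> (T_field c f \<phi> q) = k *\<^sub>R T_field c f \<phi> q"
  shows "\<exists>k. second_derivative (\<lambda>q. fst (\<phi> q)) q (0, 1) (0, 1) =
    k *\<^sub>R frechet_derivative (\<lambda>q. fst (\<phi> q)) (at q) (0, 1)"
proof -
  note sd = second_derivative_vertical[OF q]
  have "wmetric c f (\<phi> q) (second_derivative \<phi> q (0, 1) (0, 1)) \<xi> = 0" if "\<xi> \<in> normal_space c f \<phi> q" for \<xi>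
    using shape_op_T_eigenvector_iff[OF q that] A[OF that] snd_d\<phi>[OF q, of "(0, 1)"] by simp
  then have "second_derivative \<phi> q (0, 1) (0, 1) \<in> tangent_plane \<phi> q"
    by (rule tangent_of_orthogonal_normals[OF q sd(2)])
  then obtain w where w: "second_derivative \<phi> q (0, 1) (0, 1) = d\<phi> q w" by (auto simp: tangent_plane_def)
  then have "snd (d\<phi> q w) = 0" using sd(1) by (metis snd_conv)
  then have "fst w = 0" using snd_d\<phi>[OF q, of w] by simp
  then have "w = snd w *\<^sub>R (0, 1)" by (simp add: prod_eq_iff)
  then have "d\<phi> q w = snd w *\<^sub>R d\<phi> q (0, 1)" using linear_cmul[OF linear_d\<phi>[OF q]] by metis
  then have "second_derivative (\<lambda>q. fst (\<phi> q)) q (0, 1) (0, 1) = snd w *\<^sub>R fst (d\<phi> q (0, 1))"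
    using w sd(1) by (metis fst_conv fst_scaleR)
  then show ?thesis using frechet_derivative_fst_chart[OF q] by metis
qed

end

lemma congruence_identity: "congruence c f I (\<lambda>p. p)"
proof -
  have id: "frechet_derivative (\<lambda>p::point. p) (at p) X = X" for p X
    using frechet_derivative_at[OF has_derivative_ident] by metis
  have sm: "smooth_on UNIV (\<lambda>p::point. p)" by (intro smooth_intros) auto
  then have "\<exists>W. open W \<and> ambient c I \<subseteq> W \<and> smooth_on W (\<lambda>p::point. p)"
    "\<exists>W \<Phi>. open W \<and> ambient c I \<subseteq> W \<and> smooth_on W \<Phi> \<and> (\<forall>p\<in>ambient c I. \<Phi> p = p)"
    by (metis open_UNIV subset_UNIV)+
  then show ?thesis
    unfolding congruence_def ambient_isometry_def id by (auto simp: bij_betw_def)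
qed

text \<open>Adapted charts exhibit the surface as ruled, and so as a null scroll with parameters \<open>(u, t)\<close>. It
  remains to replace \<open>t\<close> by a coordinate \<open>v\<close> whose \<open>u\<close>-curves are null.\<close>

lemma class_A_imp_family_i:
  assumes c: "c \<in> {-1, 0, 1}" and I: "open I" "smooth_on I f" "\<forall>z\<in>I. 0 < f z"
    and surf: "timelike_surface c f I M x" and T: "T_lightlike c f M x" and A: "class_A c f M x"
    and p: "p \<in> topspace M"
  shows "\<exists>N D \<phi>. openin M N \<and> p \<in> N \<and> congruent_to_param c f I M x N D \<phi> \<and> family_i c f D \<phi>"
proof -
  obtain D0 :: "(real \<times> real) set" and \<psi>0 where lp0: "local_param M x D0 \<psi>0" and "p \<in> \<psi>0 ` D0"
    using surf p unfolding timelike_surface_def submanifold_def by metis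
  then obtain q0 where q0: "q0 \<in> D0" "p = \<psi>0 q0" by blast
  define u0 where "u0 = snd (x (\<psi>0 q0))"
  obtain t0 :: real and e \<kappa> where e: "e > 0" and lp1: "local_param M x (ball u0 e \<times> ball t0 e) (\<lambda>y. \<psi>0 (\<kappa> y))"
    and "smooth_on (ball u0 e \<times> ball t0 e) \<kappa>"
    and \<kappa>: "\<kappa> (u0, t0) = q0" "\<And>y. y \<in> ball u0 e \<times> ball t0 e \<Longrightarrow>
      \<kappa> y \<in> D0 \<and> \<kappa> y \<in> UNIV \<and> snd (x (\<psi>0 (\<kappa> y))) = fst y"
    by (rule adapted_local_param[OF lightlike_chart_local_param[OF c I surf T lp0] lp0 q0(1) open_UNIV UNIV_I,
      folded u0_def]) (rule that)
  define E where "E = ball u0 e \<times> ball t0 e"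
  define \<psi> where "\<psi> y = \<psi>0 (\<kappa> y)" for y
  have lp: "local_param M x E \<psi>" using lp1 by (simp add: E_def \<psi>_def[abs_def])
  have \<psi>p: "\<psi> (u0, t0) = p" using \<kappa>(1) q0(2) by (simp add: \<psi>_def)
  interpret adapted_chart c f I E "\<lambda>q. x (\<psi> q)"
    using lightlike_chart_local_param[OF c I surf T lp] \<kappa>(2)
    by (auto simp: adapted_chart_def adapted_chart_axioms_def E_def \<psi>_def)
  define Y where "Y q = fst (x (\<psi> q))" for q
  have sY: "smooth_on (ball u0 e \<times> ball t0 e) Y" using smooth_fst_chart by (simp add: Y_def[abs_def] E_def)
  have dY: "frechet_derivative Y (at q) w = fst (d\<phi> q w)" if "q \<in> E" for q w
    using frechet_derivative_fst_chart[OF that] by (simp add: Y_def[abs_def])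
  have q1: "(u0, t0) \<in> E" using e by (simp add: E_def)
  have acc: "\<exists>k. second_derivative Y q (0, 1) (0, 1) = k *\<^sub>R frechet_derivative Y (at q) (0, 1)"
    if "q \<in> ball u0 e \<times> ball t0 e" for q
    unfolding Y_def[abs_def]
    by (rule parallel_acceleration) (use A lp that in \<open>auto simp: class_A_def E_def o_def\<close>)
  have nz: "frechet_derivative Y (at (u0, t0)) (0, 1) \<noteq> 0" using d\<phi>_vertical(1)[OF q1] dY[OF q1] by simp
  obtain d \<mu> where d: "0 < d" "d \<le> e" "smooth_on (ball u0 d \<times> ball t0 d) \<mu>" "\<mu> (u0, t0) = (0::real)"
    "\<And>u t. (u, t) \<in> ball u0 d \<times> ball t0 d \<Longrightarrow> frechet_derivative \<mu> (at (u, t)) (0, 1) \<noteq> 0 \<and>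
      Y (u, t) = Y (u, t0) + \<mu> (u, t) *\<^sub>R frechet_derivative Y (at (u, t0)) (0, 1)"
    by (rule ruled_of_parallel_acceleration[OF e sY nz acc], assumption) (rule that)
  define J where "J = ball u0 d"
  have J: "open J" "u0 \<in> J" using d by (auto simp: J_def)
  have JE: "(u, t0) \<in> E" if "u \<in> J" for u using that d by (auto simp: J_def E_def)
  define \<gamma> R where "\<gamma> u = Y (u, t0)" and "R u = frechet_derivative Y (at (u, t0)) (0, 1)" for u
  have restr: "smooth_on J (\<lambda>u. h (u, t0))" if "smooth_on E h" for h :: "real \<times> real \<Rightarrow> real ^ 4"
    by (rule smooth_on_compose[OF that _ J(1) open_D]) (use JE in \<open>auto intro!: smooth_intros J\<close>)
  have sm: "smooth_on J \<gamma>" "smooth_on J R"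
    unfolding \<gamma>_def[abs_def] R_def[abs_def] using sY
    by (auto intro!: restr smooth_on_frechet_derivative[where v = "(0, 1)" and f = Y] simp: E_def)
  have \<gamma>: "\<gamma> u \<in> space_form c" and RT: "R u \<in> space_form_tangent c (\<gamma> u)"
    and null: "lprod c (R u) (R u) = 0" and trans: "lprod c (vector_derivative \<gamma> (at u)) (R u) \<noteq> 0"
    and uI: "u \<in> I" if u: "u \<in> J" for u
  proof -
    note uE = JE[OF u]
    show "\<gamma> u \<in> space_form c" "u \<in> I"
      using chart_ambient[OF uE] adapted[OF uE] by (auto simp: \<gamma>_def Y_def ambient_def mem_Times_iff)
    show "R u \<in> space_form_tangent c (\<gamma> u)"
      using derivative_in_ambient_tangent[OF d\<phi>[OF uE] open_D uE chart_ambient, of "(0, 1)"]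
      by (simp add: R_def \<gamma>_def dY[OF uE] Y_def ambient_tangent_def mem_Times_iff)
    show "lprod c (R u) (R u) = 0" using d\<phi>_vertical(2)[OF uE] by (simp add: R_def dY[OF uE])
    have "vector_derivative \<gamma> (at u) = fst (d\<phi> (u, t0) (1, 0))"
      using vector_derivative_at[OF partial_derivatives(1)[OF sY uE[unfolded E_def]]] dY[OF uE]
      by (simp add: \<gamma>_def[abs_def])
    then show "lprod c (vector_derivative \<gamma> (at u)) (R u) \<noteq> 0"
      using d\<phi>_transversal[OF uE] by (simp add: R_def dY[OF uE])
  qed
  obtain s l \<rho> U w K \<alpha> FA FB FC a b where s: "s > 0" "ball u0 s \<subseteq> J"
    and sms: "smooth_on (ball u0 s) l" "smooth_on (ball u0 s) \<rho>" "smooth_on (ball u0 s) U" "smooth_on (ball u0 s) w"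
    and init: "l u0 = (-1::real)" "U u0 = (1::real)" and cf: "cartan_framed c K \<alpha> FA FB FC a b"
    and fr: "\<And>u. u \<in> ball u0 s \<Longrightarrow> \<rho> u \<noteq> (0::real) \<and> w u > 0 \<and> (U has_real_derivative w u) (at u) \<and> U u \<in> K \<and>
      \<alpha> (U u) = \<gamma> u + l u *\<^sub>R R u \<and> FB (U u) = \<rho> u *\<^sub>R R u"
    by (rule null_scroll_frame[OF c J sm \<gamma> RT null trans], assumption+) (rule that)
  define S where "S = ball u0 s"
  have S: "open S" "u0 \<in> S" "S \<subseteq> J" using s by (auto simp: S_def)
  note sms = sms[folded S_def] and fr = fr[folded S_def]
  define W where "W q = (\<mu> q - l (fst q)) / \<rho> (fst q)" for q
  define E3 where "E3 = S \<times> ball t0 d"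
  have E3: "open E3" "(u0, t0) \<in> E3" "E3 \<subseteq> ball u0 d \<times> ball t0 d" "E3 \<subseteq> E"
    using S d by (auto simp: E3_def J_def E_def open_Times)
  have restr3: "smooth_on E3 (\<lambda>q. h (fst q))" if "smooth_on S h" for h :: "real \<Rightarrow> real"
    by (rule smooth_on_compose[OF that _ E3(1) S(1)]) (use E3(1) in \<open>auto intro!: smooth_intros simp: E3_def\<close>)
  have smW: "smooth_on E3 W"
    unfolding W_def
    by (intro smooth_intros E3 smooth_on_subset[OF d(3)] restr3 sms) (use fr in \<open>auto simp: E3_def\<close>)
  have W0: "W (u0, t0) = 1 / \<rho> u0" "W (u0, t0) \<noteq> 0" using d(4) init fr[OF S(2)] by (auto simp: W_def)
  have surface: "x (\<psi> (u, t)) = (\<alpha> (U u) + W (u, t) *\<^sub>R FB (U u), u)" if "(u, t) \<in> E3" for u t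
  proof -
    have u: "u \<in> S" using that by (auto simp: E3_def)
    note u = u subsetD[OF E3(3) that] subsetD[OF E3(4) that]
    have "\<alpha> (U u) + W (u, t) *\<^sub>R FB (U u) = \<gamma> u + (l u + W (u, t) * \<rho> u) *\<^sub>R R u"
      using fr[OF u(1)] by (simp add: scaleR_add_left)
    also have "l u + W (u, t) * \<rho> u = \<mu> (u, t)" using fr[OF u(1)] by (simp add: W_def)
    also have "\<gamma> u + \<mu> (u, t) *\<^sub>R R u = Y (u, t)" using d(5)[OF u(2)] by (simp add: \<gamma>_def R_def)
    finally show ?thesis using adapted[OF u(3)] by (simp add: Y_def prod_eq_iff)
  qed
  have Wt: "frechet_derivative W (at (u0, t0)) (0, 1) \<noteq> 0"
  proof -
    have "((\<lambda>t. \<mu> (u0, t)) has_real_derivative frechet_derivative \<mu> (at (u0, t0)) (0, 1)) (at t0)"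
      using partial_derivatives(2)[OF d(3) subsetD[OF E3(3,2)]] by (simp add: has_real_derivative_iff_has_vector_derivative)
    then have "((\<lambda>t. W (u0, t)) has_real_derivative (frechet_derivative \<mu> (at (u0, t0)) (0, 1) - 0) / \<rho> u0) (at t0)"
      unfolding W_def fst_conv by (intro DERIV_cdivide DERIV_diff DERIV_const)
    then have "frechet_derivative W (at (u0, t0)) (0, 1) = frechet_derivative \<mu> (at (u0, t0)) (0, 1) / \<rho> u0"
      using partial_derivatives(2)[OF smW E3(2)] vector_derivative_unique_at
      by (fastforce simp: has_real_derivative_iff_has_vector_derivative)
    then show ?thesis using d(5)[of u0 t0] E3 fr[OF S(2)] by auto
  qed
  \<comment> \<open>\<open>W\<close> is the position on the ruling; along the null \<open>u\<close>-curves it solves a Riccati equation,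
    whose solutions \<open>V\<close> are labelled by \<open>v\<close>\<close>
  define P Q where "P u = w u * ((b (U u))\<^sup>2 + c) / 2" and "Q u = 1 / (2 * (f u)\<^sup>2 * w u)" for u
  have SI: "S \<subseteq> I" using S uI by auto
  have smb: "smooth_on S (\<lambda>u. b (U u))"
    by (rule smooth_on_compose[of K b S U]) (use cf sms S fr in \<open>auto simp: cartan_framed_def\<close>)
  have smPQ: "smooth_on S P" "smooth_on S Q"
    unfolding P_def Q_def using I(3) fr SI
    by (auto intro!: smooth_intros S sms smb smooth_on_subset[OF I(2) SI]) fastforce+
  define v0 where "v0 = W (u0, t0)"
  obtain E4 V where E4: "open E4" "(u0, v0) \<in> E4" "fst ` E4 \<subseteq> S" "smooth_on E4 (\<lambda>(u, v). V u v)" "V u0 v0 = v0"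
    "\<And>u v. (u, v) \<in> E4 \<Longrightarrow> ((\<lambda>s. V s v) has_real_derivative P u * (V u v)\<^sup>2 + 0 * V u v + Q u) (at u)"
    "\<And>u v. (u, v) \<in> E4 \<Longrightarrow> \<exists>m. m \<noteq> 0 \<and> ((\<lambda>t. V u t) has_real_derivative m) (at v)"
    by (rule riccati_flow[OF S(1,2) smPQ(1) smooth_on_const smPQ(2)]) (rule that)
  define h where "h q = V (fst q) (snd q)" for q
  have smh: "smooth_on E4 h" using E4(4) by (simp add: h_def[abs_def] case_prod_unfold)
  obtain m where m: "m \<noteq> 0" "((\<lambda>t. V u0 t) has_real_derivative m) (at v0)" using E4(7)[OF E4(2)] by blast
  have ht: "frechet_derivative h (at (u0, v0)) (0, 1) \<noteq> 0"
    using partial_derivatives(2)[OF smh E4(2)] m vector_derivative_unique_at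
    by (fastforce simp: has_real_derivative_iff_has_vector_derivative h_def)
  define \<theta>1 \<theta>2 where "\<theta>1 q = (fst q, W q)" and "\<theta>2 q = (fst q, h q)" for q :: "real \<times> real"
  have sm\<theta>: "smooth_on E3 \<theta>1" "smooth_on E4 \<theta>2"
    unfolding \<theta>1_def \<theta>2_def by (intro smooth_intros E3 E4 smW smh)+
  have inj\<theta>: "inj (frechet_derivative \<theta>1 (at (u0, t0)))" "inj (frechet_derivative \<theta>2 (at (u0, v0)))"
    using inj_graph_coordinate[OF smW E3(2) Wt] inj_graph_coordinate[OF smh E4(2) ht]
    by (simp_all add: \<theta>1_def[abs_def] \<theta>2_def[abs_def])
  obtain U4 V4 g where UV: "open U4" "U4 \<subseteq> E4" "(u0, v0) \<in> U4" "open V4" "homeomorphism U4 V4 \<theta>2 g" "smooth_on V4 g"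
    "\<And>y. y \<in> V4 \<Longrightarrow> inj (frechet_derivative g (at y))"
    by (rule smooth_inverse_function[OF E4(1) sm\<theta>(2) E4(2) inj\<theta>(2)]) (rule that)
  have \<theta>q: "\<theta>2 (u0, v0) = (u0, v0)" "\<theta>1 (u0, t0) = (u0, v0)" using E4(5) by (auto simp: \<theta>1_def \<theta>2_def h_def v0_def)
  have g0: "(u0, v0) \<in> V4" "g (u0, v0) = (u0, v0)" using UV(3,5) \<theta>q(1) unfolding homeomorphism_def by (metis imageI)+
  define E5 where "E5 = {q \<in> E3. \<theta>1 q \<in> V4}"
  have E5: "open E5" "(u0, t0) \<in> E5" "E5 \<subseteq> E" "E5 \<subseteq> E3"
    unfolding E5_def using E3 g0 \<theta>q
    by (auto intro!: continuous_open_preimage[OF smooth_on_imp_continuous_on[OF sm\<theta>(1)] E3(1) UV(4),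
          unfolded vimage_def, simplified Int_def mem_Collect_eq])
  define \<theta> where "\<theta> q = g (\<theta>1 q)" for q
  have sm5: "smooth_on E5 \<theta>"
    unfolding \<theta>_def by (rule smooth_on_compose[OF UV(6) smooth_on_subset[OF sm\<theta>(1) E5(4)] E5(1) UV(4)]) (auto simp: E5_def)
  have \<theta>0: "\<theta> (u0, t0) = (u0, v0)" using \<theta>q g0 by (simp add: \<theta>_def)
  have inj5: "inj (frechet_derivative \<theta> (at (u0, t0)))"
  proof -
    have "frechet_derivative \<theta> (at (u0, t0)) =
       (\<lambda>v. frechet_derivative g (at (\<theta>1 (u0, t0))) (frechet_derivative \<theta>1 (at (u0, t0)) v))"
      unfolding \<theta>_def
      by (rule ext, rule frechet_derivative_chain)
         (use smooth_on_has_derivative[OF sm\<theta>(1) E3(2)] smooth_on_has_derivative[OF UV(6) g0(1)] \<theta>q in auto)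
    then show ?thesis using inj_compose[OF UV(7)[OF g0(1)] inj\<theta>(1)] \<theta>q by (simp add: o_def)
  qed
  define G where "G = {q \<in> U4. (U (fst q), h q) \<in> (- {0}) \<times> (- {0})}"
  have G: "open G" "(u0, v0) \<in> G"
  proof -
    have "continuous_on U4 (\<lambda>q. (U (fst q), h q))"
      by (intro continuous_intros continuous_on_compose2[OF smooth_on_imp_continuous_on[OF sms(3)]]
          continuous_on_subset[OF smooth_on_imp_continuous_on[OF smh]] UV(2)) (use UV(2) E4(3) in auto)
    moreover have "open ((- {0::real}) \<times> (- {0::real}))" by (intro open_Times) auto
    ultimately have "open (U4 \<inter> (\<lambda>q. (U (fst q), h q)) -` ((- {0}) \<times> (- {0})))"
      using continuous_open_preimage UV(1) by blast
    moreover have "G = U4 \<inter> (\<lambda>q. (U (fst q), h q)) -` ((- {0}) \<times> (- {0}))" by (auto simp: G_def)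
    ultimately show "open G" by simp
    show "(u0, v0) \<in> G" using UV(3) init W0 E4(5) by (simp add: G_def h_def v0_def)
  qed
  have G\<theta>: "\<theta> (u0, t0) \<in> G" using G(2) \<theta>0 by simp
  obtain e' \<kappa>' where e': "e' > 0" and *: "ball u0 e' \<times> ball v0 e' \<subseteq> G"
    "local_param M x (ball u0 e' \<times> ball v0 e') (\<lambda>y. \<psi> (\<kappa>' y))"
    and "smooth_on (ball u0 e' \<times> ball v0 e') \<kappa>'"
    and **: "\<kappa>' (u0, v0) = (u0, t0)" "\<And>y. y \<in> ball u0 e' \<times> ball v0 e' \<Longrightarrow> \<kappa>' y \<in> E5 \<and> \<theta> (\<kappa>' y) = y"
    by (rule local_param_coordinates[OF lp E5(1,3,2) sm5 inj5 G(1) G\<theta>, unfolded \<theta>0 fst_conv snd_conv]) (rule that)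
  define D where "D = ball u0 e' \<times> ball v0 e'"
  define \<phi> where "\<phi> = (\<lambda>(u, v). (\<alpha> (U u) + V u v *\<^sub>R FB (U u), u))"
  have D: "D \<subseteq> G" "D \<subseteq> E4" "(u0, v0) \<in> D" "connected D" "fst ` D \<subseteq> S"
  proof -
    show "D \<subseteq> G" "(u0, v0) \<in> D" using *(1) e' by (auto simp: D_def)
    then show "D \<subseteq> E4" using UV(2) by (auto simp: G_def)
    then show "fst ` D \<subseteq> S" using E4(3) by auto
    show "connected D" unfolding D_def by (intro convex_connected convex_Times convex_ball)
  qed
  have param: "x (\<psi> (\<kappa>' q)) = \<phi> q" if q: "q \<in> D" for q
  proof -
    have k: "\<kappa>' q \<in> E5" "\<theta> (\<kappa>' q) = q" using **(2) q by (auto simp: D_def)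
    then have "\<theta>1 (\<kappa>' q) = \<theta>2 q"
      using UV(5) unfolding \<theta>_def E5_def homeomorphism_def by auto
    then have "fst (\<kappa>' q) = fst q" "W (\<kappa>' q) = V (fst q) (snd q)" by (auto simp: \<theta>1_def \<theta>2_def h_def)
    then show ?thesis
      using surface[of "fst (\<kappa>' q)" "snd (\<kappa>' q)", unfolded prod.collapse, OF subsetD[OF E5(4) k(1)]]
      by (simp add: \<phi>_def case_prod_unfold)
  qed
  have "congruent_to_param c f I M x ((\<lambda>y. \<psi> (\<kappa>' y)) ` D) D \<phi>"
    unfolding congruent_to_param_def
  proof (intro conjI exI[of _ "\<lambda>y. \<psi> (\<kappa>' y)"] exI[of _ "\<lambda>p. p"])
    show "D \<subseteq> I \<times> UNIV" using D(5) SI by force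
    show "local_param M x D (\<lambda>y. \<psi> (\<kappa>' y))" using *(2) by (simp add: D_def)
    show "\<forall>q\<in>D. x (\<psi> (\<kappa>' q)) = \<phi> q" using param by blast
  qed (use D(4) congruence_identity in auto)
  moreover have "openin M ((\<lambda>y. \<psi> (\<kappa>' y)) ` D)" using local_paramD(2)[OF *(2)] by (simp add: D_def)
  moreover have "p \<in> (\<lambda>y. \<psi> (\<kappa>' y)) ` D" using D(3) **(1) \<psi>p by (metis imageI)
  moreover have "family_i c f D \<phi>"
  proof -
    have "U u \<in> K \<and> U u \<noteq> 0 \<and> V u v \<noteq> 0 \<and> deriv U u \<noteq> 0 \<and> deriv (\<lambda>t. V u t) v \<noteq> 0 \<and>
           deriv U u * (V u v)\<^sup>2 * ((b (U u))\<^sup>2 + c) - 2 * deriv (\<lambda>s. V s v) u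
             = - 1 / ((f u)\<^sup>2 * deriv U u) \<and>
           \<phi> (u, v) = (\<alpha> (U u) + V u v *\<^sub>R FB (U u), u)" if uv: "(u, v) \<in> D" for u v
    proof -
      have u: "u \<in> S" "(u, v) \<in> E4" "(u, v) \<in> G" using uv D by auto
      have dU: "deriv U u = w u" "w u > 0" using fr[OF u(1)] DERIV_imp_deriv by auto
      have "f u > 0" using I(3) SI u(1) by auto
      then have "w u * (V u v)\<^sup>2 * ((b (U u))\<^sup>2 + c) - 2 * (P u * (V u v)\<^sup>2 + 0 * V u v + Q u) = - 1 / ((f u)\<^sup>2 * w u)"
        using dU(2) by (simp add: P_def Q_def field_simps)
      then show ?thesis
        using fr[OF u(1)] u(3) E4(7)[OF u(2)] DERIV_imp_deriv[OF E4(6)[OF u(2)]] dU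
        by (auto simp: G_def h_def \<phi>_def dest: DERIV_imp_deriv)
    qed
    moreover have "smooth_on (fst ` D) U" "smooth_on D (\<lambda>(u, v). V u v)"
      using sms(3) E4(4) D smooth_on_subset by blast+
    ultimately show ?thesis
      unfolding family_i_def using cf by blast
  qed
  ultimately show ?thesis by blast
qed

section \<open>The five families are ruled by null lines\<close>

text \<open>Formulated for each height \<open>u\<close> separately, since the class A condition can be tested on single level
  curves of the height.\<close>

definition null_ruled :: "real \<Rightarrow> (real \<times> real) set \<Rightarrow> (real \<times> real \<Rightarrow> point) \<Rightarrow> bool" where
  "null_ruled c D \<phi> \<longleftrightarrow> (\<forall>u\<in>fst ` D. \<exists>P R. P \<in> space_form c \<and> R \<in> space_form_tangent c P \<and>
     lprod c R R = 0 \<and> R \<noteq> 0 \<and> (\<forall>v. (u, v) \<in> D \<longrightarrow> (\<exists>g. \<phi> (u, v) = (P + g *\<^sub>R R, u))))"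

lemma null_ruledI:
  assumes "\<And>u v. (u, v) \<in> D \<Longrightarrow> P u \<in> space_form c \<and> R u \<in> space_form_tangent c (P u) \<and>
     lprod c (R u) (R u) = 0 \<and> R u \<noteq> 0 \<and> (\<exists>g. \<phi> (u, v) = (P u + g *\<^sub>R R u, u))"
  shows "null_ruled c D \<phi>"
  unfolding null_ruled_def using assms by fastforce

lemma family_i_null_ruled:
  assumes "family_i c f D \<phi>" shows "null_ruled c D \<phi>"
proof -
  obtain J \<alpha> A B C a b U V where cf: "cartan_framed c J \<alpha> A B C a b"
    and D: "\<And>u v. (u, v) \<in> D \<Longrightarrow> U u \<in> J \<and> \<phi> (u, v) = (\<alpha> (U u) + V u v *\<^sub>R B (U u), u)"
    using assms unfolding family_i_def by fast
  have "lprod c (A s) (B s) = -1 \<Longrightarrow> B s \<noteq> 0" for s by (auto simp: lprod.zero_right)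
  then show ?thesis
    using D cf by (intro null_ruledI[where P = "\<lambda>u. \<alpha> (U u)" and R = "\<lambda>u. B (U u)"])
      (auto simp: cartan_framed_def)
qed

lemma rotation_identity:
  fixes r t :: real
  shows "r * cos t * (r * cos t) + r * sin t * (r * sin t) = r * r"
  using sin_cos_squared_add[of t] by algebra

lemma family_ii_null_ruled:
  assumes "family_ii c f D \<phi>" shows "null_ruled c D \<phi>"
proof -
  obtain r a A where c: "c = 1" and r: "0 < r" "r < 1"
    and D: "\<And>u v. (u, v) \<in> D \<Longrightarrow> \<phi> (u, v) = (vector [r / A u v, r * (cos (a u) / A u v - sin (a u)),
                        r * (sin (a u) / A u v + cos (a u)), sqrt (1 - r\<^sup>2)], u)"
    using assms unfolding family_ii_def by fast
  have r1: "r * r \<le> 1" using r mult_le_one[of r r] by simp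
  define P R where "P u = (vector [0, - r * sin (a u), r * cos (a u), sqrt (1 - r\<^sup>2)] :: real ^ 4)" and "R u = (vector [r, r * cos (a u), r * sin (a u), 0] :: real ^ 4)" for u
  have "\<phi> (u, v) = (P u + (1 / A u v) *\<^sub>R R u, u)" if "(u, v) \<in> D" for u v
    by (simp add: D[OF that] P_def R_def vec_eq_iff forall_4 field_simps)
  moreover have "P u \<in> space_form c \<and> R u \<in> space_form_tangent c (P u) \<and> lprod c (R u) (R u) = 0 \<and> R u \<noteq> 0" for u
    using rotation_identity[of r "a u"] r r1
    by (simp add: P_def R_def c space_form_def space_form_tangent_def lprod_def vec_eq_iff forall_4 power2_eq_square)
  ultimately show ?thesis by (intro null_ruledI[where P = P and R = R]) blast
qed

lemma family_iii_null_ruled: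
  assumes "family_iii c f D \<phi>" shows "null_ruled c D \<phi>"
proof -
  obtain r a A where c: "c = -1" and r: "1 < r"
    and D: "\<And>u v. (u, v) \<in> D \<Longrightarrow> \<phi> (u, v) = (vector [r * (cos (a u) / A u v - sin (a u)),
                        r * (sin (a u) / A u v + cos (a u)), r / A u v, sqrt (r\<^sup>2 - 1)], u)"
    using assms unfolding family_iii_def by fast
  have r1: "r * r \<ge> 1" using r mult_mono[of 1 r 1 r] by simp
  define P R where "P u = (vector [- r * sin (a u), r * cos (a u), 0, sqrt (r\<^sup>2 - 1)] :: real ^ 4)" and "R u = (vector [r * cos (a u), r * sin (a u), r, 0] :: real ^ 4)" for u
  have "\<phi> (u, v) = (P u + (1 / A u v) *\<^sub>R R u, u)" if "(u, v) \<in> D" for u v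
    by (simp add: D[OF that] P_def R_def vec_eq_iff forall_4 field_simps)
  moreover have "P u \<in> space_form c \<and> R u \<in> space_form_tangent c (P u) \<and> lprod c (R u) (R u) = 0 \<and> R u \<noteq> 0" for u
    using rotation_identity[of r "a u"] r r1
    by (simp add: P_def R_def c space_form_def space_form_tangent_def lprod_def vec_eq_iff forall_4 power2_eq_square)
  ultimately show ?thesis by (intro null_ruledI[where P = P and R = R]) blast
qed

lemma family_iv_null_ruled:
  assumes "family_iv c f z0 D \<phi>" shows "null_ruled c D \<phi>"
proof -
  obtain a c1 c2 where c: "c = -1" and a: "a \<noteq> 0" and c1: "c1 \<noteq> 0"
    and D: "\<And>u v. (u, v) \<in> D \<Longrightarrow> \<phi> (u, v) = (vector
             [(2 * c1\<^sup>2 * F_int f z0 u + 2 * c2 * c1 + F_int f z0 u - 2 * v) / (2 * sqrt 2 * c1),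
              - (a * (c1 * F_int f z0 u + c2) * (2 * v - F_int f z0 u) / c1) - a - 1 / (4 * a),
              - (a * (c1 * F_int f z0 u + c2) * (2 * v - F_int f z0 u) / c1) - a + 1 / (4 * a),
              ((2 * c1\<^sup>2 - 1) * F_int f z0 u + 2 * (c1 * c2 + v)) / (2 * sqrt 2 * c1)], u)"
    using assms unfolding family_iv_def Let_def by fast
  define P where "P u = (let F = F_int f z0 u in vector
             [(2 * c1\<^sup>2 * F + 2 * c2 * c1 + F) / (2 * sqrt 2 * c1),
              a * (c1 * F + c2) * F / c1 - a - 1 / (4 * a),
              a * (c1 * F + c2) * F / c1 - a + 1 / (4 * a),
              ((2 * c1\<^sup>2 - 1) * F + 2 * (c1 * c2)) / (2 * sqrt 2 * c1)] :: real ^ 4)" for u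
  define R where "R u = (vector [- 1 / (sqrt 2 * c1), - 2 * a * (c1 * F_int f z0 u + c2) / c1,
      - 2 * a * (c1 * F_int f z0 u + c2) / c1, 1 / (sqrt 2 * c1)] :: real ^ 4)" for u
  show ?thesis
  proof (rule null_ruledI[where P = P and R = R])
    fix u v assume uv: "(u, v) \<in> D"
    define F where "F = F_int f z0 u"
    define x where "x = sqrt (2::real)"
    have s: "x * x = 2" "x \<noteq> 0" by (auto simp: x_def)
    \<comment> \<open>\<open>P $ 1 + P $ 4\<close> and \<open>P $ 3 - P $ 2\<close> are null coordinates in which the metric is a sum of products\<close>
    define k where "k = a * (c1 * F + c2) * F / c1 - a"
    define p where "p = (c1 * F + c2) / c1"
    have P: "P u $ 1 = (2 * c1\<^sup>2 * F + 2 * c2 * c1 + F) / (2 * x * c1)" "P u $ 2 = k - 1 / (4 * a)"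
      "P u $ 3 = k + 1 / (4 * a)" "P u $ 4 = ((2 * c1\<^sup>2 - 1) * F + 2 * (c1 * c2)) / (2 * x * c1)"
      by (auto simp: P_def F_def Let_def k_def x_def)
    have R: "R u $ 1 = - 1 / (x * c1)" "R u $ 2 = - 2 * a * p" "R u $ 3 = - 2 * a * p" "R u $ 4 = 1 / (x * c1)"
      by (auto simp: R_def F_def p_def x_def)
    have sum: "P u $ 1 + P u $ 4 = 2 * (c1 * F + c2) / x"
      unfolding P using c1 s by (simp add: field_simps power2_eq_square)
    have diff: "P u $ 4 - P u $ 1 = - F / (x * c1)"
      unfolding P using c1 s by (simp add: field_simps power2_eq_square)
    have "P u $ 4 * P u $ 4 - P u $ 1 * P u $ 1 = (P u $ 1 + P u $ 4) * (P u $ 4 - P u $ 1)" by (simp add: algebra_simps)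
    also have "\<dots> = - (F * p)" unfolding sum diff p_def using c1 s by (simp add: field_simps)
    finally have 1: "P u $ 4 * P u $ 4 - P u $ 1 * P u $ 1 = - (F * p)" .
    have 2: "P u $ 3 * P u $ 3 - P u $ 2 * P u $ 2 = F * p - 1"
      unfolding P k_def p_def using a c1 by (simp add: field_simps)
    have "lprod c (P u) (P u) = c" using 1 2 by (simp add: lprod_def c)
    moreover have "lprod c (P u) (R u) = 0"
    proof -
      have "lprod c (P u) (R u) = (P u $ 1 + P u $ 4) * (1 / (x * c1)) + (P u $ 3 - P u $ 2) * (- 2 * a * p)"
        unfolding lprod_def R c by (simp add: algebra_simps)
      also have "\<dots> = 0" unfolding sum unfolding P(2,3) p_def using a c1 s by (simp add: field_simps)
      finally show ?thesis .
    qed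
    moreover have "lprod c (R u) (R u) = 0" unfolding lprod_def R c by simp
    moreover have "R u $ 4 \<noteq> 0" using c1 s(2) by (simp add: R)
    then have "R u \<noteq> 0" by auto
    moreover have "\<phi> (u, v) = (P u + v *\<^sub>R R u, u)"
      unfolding D[OF uv] F_def[symmetric] x_def[symmetric] prod.inject vec_eq_iff forall_4 vector_add_component vector_scaleR_component vector_4 P R
      using a c1 s by (auto simp: k_def p_def field_simps)
    ultimately show "P u \<in> space_form c \<and> R u \<in> space_form_tangent c (P u) \<and>
     lprod c (R u) (R u) = 0 \<and> R u \<noteq> 0 \<and> (\<exists>g. \<phi> (u, v) = (P u + g *\<^sub>R R u, u))"
      by (auto simp: space_form_def space_form_tangent_def c)
  qed
qed

lemma family_v_null_ruled:
  assumes "family_v c f D \<phi>" shows "null_ruled c D \<phi>"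
proof -
  obtain r a A where c: "c = 0" and r: "0 < r"
    and D: "\<And>u v. (u, v) \<in> D \<Longrightarrow> \<phi> (u, v) = (vector [r / A u v, r * (cos (a u) / A u v - sin (a u)),
                        r * (sin (a u) / A u v + cos (a u)), 0], u)"
    using assms unfolding family_v_def by fast
  define P R where "P u = (vector [0, - r * sin (a u), r * cos (a u), 0] :: real ^ 4)" and "R u = (vector [r, r * cos (a u), r * sin (a u), 0] :: real ^ 4)" for u
  have "\<phi> (u, v) = (P u + (1 / A u v) *\<^sub>R R u, u)" if "(u, v) \<in> D" for u v
    by (simp add: D[OF that] P_def R_def vec_eq_iff forall_4 field_simps)
  moreover have "P u \<in> space_form c \<and> R u \<in> space_form_tangent c (P u) \<and> lprod c (R u) (R u) = 0 \<and> R u \<noteq> 0" for u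
    using rotation_identity[of r "a u"] r
    by (simp add: P_def R_def c space_form_def space_form_tangent_def lprod_def vec_eq_iff forall_4 power2_eq_square)
  ultimately show ?thesis by (intro null_ruledI[where P = P and R = R]) blast
qed

section \<open>Congruences and null lines\<close>

context warped_space_form
begin

text \<open>Every tangent vector of the space-time is the velocity of a curve whose projection to the space
  form lies in the plane spanned by the base point and the vector. For \<open>c = 0\<close> this curve is a line.\<close>

lemma ambient_curve:
  assumes p: "p \<in> ambient c I" and \<xi>: "\<xi> \<in> ambient_tangent c p"
  obtains e h where "e > 0" "smooth_on (ball 0 e) h" "h 0 = (1::real)"
    "\<And>s. s \<in> ball 0 e \<Longrightarrow> (h s *\<^sub>R fst p + s *\<^sub>R fst \<xi>, snd p + s * snd \<xi>) \<in> ambient c I"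
    "((\<lambda>s. (h s *\<^sub>R fst p + s *\<^sub>R fst \<xi>, snd p + s * snd \<xi>)) has_vector_derivative \<xi>) (at 0)"
    "c = 0 \<Longrightarrow> h = (\<lambda>s. 1)"
proof -
  define k where "k = c * lprod c (fst \<xi>) (fst \<xi>)"
  define h where "h s = sqrt (1 - k * s\<^sup>2)" for s
  have "open ({s. 1 - k * s\<^sup>2 > 0} \<inter> {s. snd p + s * snd \<xi> \<in> I})"
    by (intro open_Int open_Collect_less continuous_intros open_vimage[OF open_I, unfolded vimage_def])
  moreover have "0 \<in> {s. 1 - k * s\<^sup>2 > 0} \<inter> {s. snd p + s * snd \<xi> \<in> I}" using snd_ambient[OF p] by simp
  ultimately obtain e where e: "e > 0" "ball 0 e \<subseteq> {s. 1 - k * s\<^sup>2 > 0} \<inter> {s. snd p + s * snd \<xi> \<in> I}"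
    using open_contains_ball by meson
  have pos: "1 - k * s\<^sup>2 > 0" "snd p + s * snd \<xi> \<in> I" if "s \<in> ball 0 e" for s using e that by auto
  have sm: "smooth_on (ball 0 e) h" unfolding h_def by (intro smooth_intros) (use pos in auto)
  have mem: "(h s *\<^sub>R fst p + s *\<^sub>R fst \<xi>, snd p + s * snd \<xi>) \<in> ambient c I" if s: "s \<in> ball 0 e" for s
  proof (cases "c = 0")
    case True
    then show ?thesis using p \<xi> pos(2)[OF s]
      by (auto simp: ambient_def space_form_def ambient_tangent_def space_form_tangent_def mem_Times_iff)
  next
    case False
    have "lprod c (fst p) (fst p) = c" "lprod c (fst p) (fst \<xi>) = 0"
      using p \<xi> False by (auto simp: ambient_def space_form_def ambient_tangent_def space_form_tangent_def mem_Times_iff)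
    moreover have "h s * h s = 1 - k * (s * s)" using pos(1)[OF s] by (simp add: h_def power2_eq_square)
    moreover have "c * c = 1" using c False by auto
    ultimately have "lprod c (h s *\<^sub>R fst p + s *\<^sub>R fst \<xi>) (h s *\<^sub>R fst p + s *\<^sub>R fst \<xi>) = c"
      using lprod_commute[of c "fst \<xi>" "fst p"]
      by (simp add: lprod.add_left lprod.add_right lprod.scaleR_left lprod.scaleR_right k_def mult.assoc[symmetric])
         (simp add: algebra_simps)
    then show ?thesis using pos(2)[OF s] False by (simp add: ambient_def space_form_def)
  qed
  have "(h has_real_derivative 0) (at 0)"
    unfolding h_def by (auto intro!: derivative_eq_intros)
  then have "((\<lambda>s. h s *\<^sub>R fst p + s *\<^sub>R fst \<xi>) has_vector_derivative (h 0 *\<^sub>R 0 + 0 *\<^sub>R fst p) + (0 *\<^sub>R 0 + 1 *\<^sub>R fst \<xi>)) (at 0)"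
    by (intro has_vector_derivative_add has_vector_derivative_scaleR has_vector_derivative_const DERIV_ident)
  moreover have "((\<lambda>s. snd p + s * snd \<xi>) has_vector_derivative snd \<xi>) (at 0)"
    by (auto intro!: derivative_eq_intros)
  ultimately have "((\<lambda>s. (h s *\<^sub>R fst p + s *\<^sub>R fst \<xi>, snd p + s * snd \<xi>)) has_vector_derivative \<xi>) (at 0)"
    using has_vector_derivative_Pair by fastforce
  with e(1) sm mem show ?thesis by (intro that[of e h]) (auto simp: h_def k_def)
qed

end

text \<open>A congruence \<open>\<Psi>\<close> with smooth inverse \<open>\<Phi>\<close>, where \<open>\<epsilon>\<close> is the sign by which it acts on the direction
  of the warped axis.\<close>

locale warped_congruence = warped_space_form c f I for c f I +
  fixes \<Psi> \<Phi> :: "point \<Rightarrow> point" and W1 W2 :: "point set" and \<epsilon> :: real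
  assumes W1: "open W1" "ambient c I \<subseteq> W1" "smooth_on W1 \<Psi>"
    and W2: "open W2" "ambient c I \<subseteq> W2" "smooth_on W2 \<Phi>"
    and \<Phi>\<Psi>: "p \<in> ambient c I \<Longrightarrow> \<Phi> (\<Psi> p) = p"
    and bij: "bij_betw \<Psi> (ambient c I) (ambient c I)"
    and isometry: "p \<in> ambient c I \<Longrightarrow> X \<in> ambient_tangent c p \<Longrightarrow> Y \<in> ambient_tangent c p \<Longrightarrow>
        wmetric c f (\<Psi> p) (frechet_derivative \<Psi> (at p) X) (frechet_derivative \<Psi> (at p) Y) = wmetric c f p X Y"
    and \<epsilon>: "\<epsilon> * \<epsilon> = 1" and d\<Psi>_dz: "p \<in> ambient c I \<Longrightarrow> frechet_derivative \<Psi> (at p) dz = \<epsilon> *\<^sub>R dz"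
begin

lemma \<Psi>_ambient: "p \<in> ambient c I \<Longrightarrow> \<Psi> p \<in> ambient c I"
  using bij by (auto simp: bij_betw_def)

lemma \<Psi>\<Phi>: "p \<in> ambient c I \<Longrightarrow> \<Psi> (\<Phi> p) = p \<and> \<Phi> p \<in> ambient c I"
  using bij \<Phi>\<Psi> unfolding bij_betw_def by (metis imageE)

lemma d\<Psi>: "p \<in> ambient c I \<Longrightarrow> (\<Psi> has_derivative frechet_derivative \<Psi> (at p)) (at p)"
  using smooth_on_has_derivative[OF W1(3)] W1(2) by blast

lemma d\<Phi>: "p \<in> ambient c I \<Longrightarrow> (\<Phi> has_derivative frechet_derivative \<Phi> (at p)) (at p)"
  using smooth_on_has_derivative[OF W2(3)] W2(2) by blast

lemma snd_d\<Psi>: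
  assumes p: "p \<in> ambient c I" and X: "X \<in> ambient_tangent c p"
  shows "snd (frechet_derivative \<Psi> (at p) X) = \<epsilon> * snd X"
proof -
  have dz: "dz \<in> ambient_tangent c p"
    by (auto simp: dz_def ambient_tangent_def space_form_tangent_def lprod.zero_right)
  have "wmetric c f (\<Psi> p) (\<epsilon> *\<^sub>R dz) (frechet_derivative \<Psi> (at p) X) = snd X"
    using isometry[OF p dz X] unfolding d\<Psi>_dz[OF p] wmetric_dz .
  then have "\<epsilon> * snd (frechet_derivative \<Psi> (at p) X) = snd X" by (simp add: wmetric.scaleR_left wmetric_dz)
  then have "\<epsilon> * (\<epsilon> * snd (frechet_derivative \<Psi> (at p) X)) = \<epsilon> * snd X" by simp
  then show ?thesis using \<epsilon> by (simp add: mult.assoc[symmetric])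
qed

text \<open>The values of \<open>\<Psi>\<close> and \<open>\<Phi>\<close> outside the space-time carry no information, so their derivatives are
  controlled by means of curves that stay inside it.\<close>

lemma
  assumes p: "p \<in> ambient c I" and \<xi>: "\<xi> \<in> ambient_tangent c p"
  shows d\<Psi>_tangent: "frechet_derivative \<Psi> (at p) \<xi> \<in> ambient_tangent c (\<Psi> p)"
    and d\<Phi>_d\<Psi>: "frechet_derivative \<Phi> (at (\<Psi> p)) (frechet_derivative \<Psi> (at p) \<xi>) = \<xi>"
proof -
  obtain e \<tau> where \<tau>: "e > 0" "\<And>s. s \<in> ball 0 e \<Longrightarrow> \<tau> s \<in> ambient c I" "\<tau> 0 = p" "(\<tau> has_vector_derivative \<xi>) (at (0::real))"
  proof (rule ambient_curve[OF p \<xi>])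
    fix e h assume "e > 0" "h 0 = (1::real)"
      "\<And>s. s \<in> ball 0 e \<Longrightarrow> (h s *\<^sub>R fst p + s *\<^sub>R fst \<xi>, snd p + s * snd \<xi>) \<in> ambient c I"
      "((\<lambda>s. (h s *\<^sub>R fst p + s *\<^sub>R fst \<xi>, snd p + s * snd \<xi>)) has_vector_derivative \<xi>) (at 0)"
    then show thesis by (intro that[of e "\<lambda>s. (h s *\<^sub>R fst p + s *\<^sub>R fst \<xi>, snd p + s * snd \<xi>)"]) auto
  qed
  have d1: "((\<lambda>s. \<Psi> (\<tau> s)) has_derivative (\<lambda>s. frechet_derivative \<Psi> (at p) (s *\<^sub>R \<xi>))) (at 0)"
    using has_derivative_compose[OF \<tau>(4)[unfolded has_vector_derivative_def], of \<Psi>] d\<Psi>[OF p] \<tau>(3) by simp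
  from derivative_in_ambient_tangent[OF d1, where S = "ball 0 e" and w = 1] \<tau> \<Psi>_ambient
  show "frechet_derivative \<Psi> (at p) \<xi> \<in> ambient_tangent c (\<Psi> p)" by simp
  have "((\<lambda>s. \<Phi> (\<Psi> (\<tau> s))) has_derivative (\<lambda>s. frechet_derivative \<Phi> (at (\<Psi> p)) (frechet_derivative \<Psi> (at p) (s *\<^sub>R \<xi>)))) (at 0)"
    using has_derivative_compose[OF d1, of \<Phi>] d\<Phi>[OF \<Psi>_ambient[OF p]] \<tau>(3) by simp
  then have "(\<tau> has_derivative (\<lambda>s. frechet_derivative \<Phi> (at (\<Psi> p)) (frechet_derivative \<Psi> (at p) (s *\<^sub>R \<xi>)))) (at 0)"
    by (rule has_derivative_transform_within_open[OF _ open_ball centre_in_ball[THEN iffD2, OF \<tau>(1)]])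
       (use \<tau> \<Phi>\<Psi> in auto)
  from fun_cong[OF has_derivative_unique[OF this \<tau>(4)[unfolded has_vector_derivative_def]], of 1]
  show "frechet_derivative \<Phi> (at (\<Psi> p)) (frechet_derivative \<Psi> (at p) \<xi>) = \<xi>" by simp
qed

text \<open>Null lines of the space form are geodesics, so their images under a congruence satisfy the
  class A condition again. In the proof the null line is translated along a curve orthogonal to it and
  becomes a ruling, \<open>s = 0\<close>, of a surface with degenerate metric. For the image \<open>X\<close> of that surface
  \<open>\<langle>X\<^sub>t, X\<^sub>t\<rangle>\<close> and \<open>\<langle>X\<^sub>t, X\<^sub>s\<rangle>\<close> vanish identically, whence
  \<open>\<langle>X\<^sub>t\<^sub>t, X\<^sub>s\<rangle> = - \<langle>X\<^sub>t, X\<^sub>t\<^sub>s\<rangle> = 0\<close>. The direction of translation is chosen so that \<open>X\<^sub>s = \<xi>\<close>.\<close>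

lemma image_of_null_line:
  assumes u0: "u0 \<in> I" and P: "P \<in> space_form c" and R: "R \<in> space_form_tangent c P" "lprod c R R = 0"
  defines "Z \<equiv> \<lambda>t. \<Phi> (P + t *\<^sub>R R, u0)"
  shows "smooth_on UNIV Z" and "Z t \<in> ambient c I"
    and "\<xi> \<in> ambient_tangent c (Z t0) \<Longrightarrow> wmetric c f (Z t0) (vector_derivative Z (at t0)) \<xi> = 0 \<Longrightarrow>
      wmetric c f (Z t0) (vector_derivative (\<lambda>t. vector_derivative Z (at t)) (at t0)) \<xi> = 0"
proof -
  have line: "(P + t *\<^sub>R R, u0) \<in> ambient c I" for t
    using space_form_null_line(1)[OF P R] u0 by (simp add: ambient_def)
  show Zamb: "Z t \<in> ambient c I" for t using \<Psi>\<Phi>[OF line] by (simp add: Z_def)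
  show smZ: "smooth_on UNIV Z"
    unfolding Z_def
    by (rule smooth_on_compose[OF W2(3) _ _ W2(1)]) (use line W2(2) in \<open>auto intro!: smooth_intros\<close>)
  assume \<xi>: "\<xi> \<in> ambient_tangent c (Z t0)" and orth: "wmetric c f (Z t0) (vector_derivative Z (at t0)) \<xi> = 0"
  define p0 where "p0 = (P + t0 *\<^sub>R R, u0)"
  have p0: "p0 \<in> ambient c I" "\<Psi> (Z t0) = p0" "\<Phi> p0 = Z t0" using line \<Psi>\<Phi>[OF line] by (auto simp: p0_def Z_def)
  define \<xi>0 where "\<xi>0 = frechet_derivative \<Psi> (at (Z t0)) \<xi>"
  have \<xi>0: "\<xi>0 \<in> ambient_tangent c p0" "frechet_derivative \<Phi> (at p0) \<xi>0 = \<xi>"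
    using d\<Psi>_tangent[OF Zamb \<xi>] d\<Phi>_d\<Psi>[OF Zamb \<xi>] p0(2) by (auto simp: \<xi>0_def)
  obtain e h where e: "e > 0" "smooth_on (ball 0 e) h" "h 0 = (1::real)"
    "\<And>s. s \<in> ball 0 e \<Longrightarrow> (h s *\<^sub>R fst p0 + s *\<^sub>R fst \<xi>0, snd p0 + s * snd \<xi>0) \<in> ambient c I"
    "((\<lambda>s. (h s *\<^sub>R fst p0 + s *\<^sub>R fst \<xi>0, snd p0 + s * snd \<xi>0)) has_vector_derivative \<xi>0) (at 0)"
    "c = 0 \<Longrightarrow> h = (\<lambda>s. 1)"
    by (rule ambient_curve[OF p0(1) \<xi>0(1)]) (rule that)
  define \<tau> where "\<tau> s = (h s *\<^sub>R fst p0 + s *\<^sub>R fst \<xi>0, snd p0 + s * snd \<xi>0)" for s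
  define Y where "Y q = \<tau> (snd q) + ((fst q - t0) *\<^sub>R R, 0)" for q :: "real \<times> real"
  define S where "S = (UNIV :: real set) \<times> ball (0::real) e"
  have S: "open S" "(t, 0) \<in> S" for t using e(1) by (auto simp: S_def open_Times)
  define e1 e2 where "e1 = (1::real, 0::real)" and "e2 = (0::real, 1::real)"
  have sm\<tau>: "smooth_on (ball 0 e) \<tau>" unfolding \<tau>_def by (intro smooth_intros e) auto
  define \<tau>' where "\<tau>' s = vector_derivative \<tau> (at s)" for s
  have d\<tau>: "(\<tau> has_vector_derivative \<tau>' s) (at s)" if "s \<in> ball 0 e" for s
    unfolding \<tau>'_def using smooth_on_vector_derivative(1)[OF open_ball sm\<tau> that] .
  have \<tau>'0: "\<tau>' 0 = \<xi>0" unfolding \<tau>'_def \<tau>_def[abs_def] by (rule vector_derivative_at[OF e(5)])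
  have dY: "(Y has_derivative (\<lambda>v. snd v *\<^sub>R \<tau>' (snd q) + (fst v *\<^sub>R R, 0))) (at q)" if "q \<in> S" for q
  proof -
    have "snd q \<in> ball 0 e" using that by (auto simp: S_def)
    have "((\<lambda>q. \<tau> (snd q)) has_derivative (\<lambda>v. snd v *\<^sub>R \<tau>' (snd q))) (at q)"
      using has_derivative_compose[OF has_derivative_snd[OF has_derivative_ident]
          d\<tau>[OF \<open>snd q \<in> ball 0 e\<close>, unfolded has_vector_derivative_def]] .
    then show ?thesis unfolding Y_def by (auto intro!: derivative_eq_intros)
  qed
  \<comment> \<open>\<open>\<Psi>\<close> maps the velocity of \<open>Z\<close> to \<open>R\<close>; hence \<open>\<xi>0\<close> is orthogonal to \<open>R\<close>, and the translates of \<open>\<tau>\<close>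
    along \<open>R\<close> stay in the space form\<close>
  have Zt0: "frechet_derivative \<Psi> (at (Z t0)) (vector_derivative Z (at t0)) = (R, 0)"
  proof -
    have dZ: "(Z has_vector_derivative vector_derivative Z (at t0)) (at t0)"
      by (rule smooth_on_vector_derivative(1)[OF open_UNIV smZ UNIV_I])
    have "((\<lambda>t. \<Psi> (Z t)) has_derivative (\<lambda>s. frechet_derivative \<Psi> (at (Z t0)) (s *\<^sub>R vector_derivative Z (at t0)))) (at t0)"
      using has_derivative_compose[OF dZ[unfolded has_vector_derivative_def] d\<Psi>[OF Zamb]] .
    moreover have "(\<lambda>t. \<Psi> (Z t)) = (\<lambda>t. (P + t *\<^sub>R R, u0))" using \<Psi>\<Phi>[OF line] by (simp add: Z_def)
    moreover have "((\<lambda>t. (P + t *\<^sub>R R, u0)) has_derivative (\<lambda>s. (s *\<^sub>R R, 0))) (at t0)"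
      by (auto intro!: derivative_eq_intros)
    ultimately have "(\<lambda>s. frechet_derivative \<Psi> (at (Z t0)) (s *\<^sub>R vector_derivative Z (at t0))) = (\<lambda>s. (s *\<^sub>R R, 0))"
      using has_derivative_unique by metis
    from fun_cong[OF this, of 1] show ?thesis by simp
  qed
  have Ztan: "vector_derivative Z (at t0) \<in> ambient_tangent c (Z t0)"
    using derivative_in_ambient_tangent[OF smooth_on_vector_derivative(1)[OF open_UNIV smZ UNIV_I,
        unfolded has_vector_derivative_def] open_UNIV UNIV_I Zamb, of 1] by simp
  have RN: "lprod c R (fst \<xi>0) = 0"
  proof -
    have "wmetric c f p0 (R, 0) \<xi>0 = 0"
      using isometry[OF Zamb Ztan \<xi>] orth unfolding Zt0 \<xi>0_def[symmetric] p0(2) by simp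
    then show ?thesis using f_nonzero[OF p0(1)] by (simp add: wmetric_def)
  qed
  have Rp0: "lprod c R (fst p0) = 0 \<or> c = 0"
    using P R by (auto simp: p0_def space_form_tangent_def lprod.add_right lprod.scaleR_right lprod_commute[of c R P])
  have R\<tau>: "lprod c R (fst (\<tau>' s)) = 0" and Yamb: "Y (t, s) \<in> ambient c I" if s: "s \<in> ball 0 e" for s t
  proof -
    have \<tau>s: "\<tau> s \<in> ambient c I" using e(4)[OF s] by (simp add: \<tau>_def)
    have "R \<in> space_form_tangent c (fst (\<tau> s))"
      using Rp0 R(1) RN lprod_commute[of c R]
      by (auto simp: \<tau>_def space_form_tangent_def lprod.add_left lprod.scaleR_left split: if_splits)
    then have "fst (\<tau> s) + (t - t0) *\<^sub>R R \<in> space_form c"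
      using space_form_null_line(1)[of "fst (\<tau> s)" c R "t - t0"] R(2) \<tau>s by (auto simp: ambient_def mem_Times_iff)
    then show "Y (t, s) \<in> ambient c I" using \<tau>s by (simp add: Y_def ambient_def mem_Times_iff)
    show "lprod c R (fst (\<tau>' s)) = 0"
    proof -
      have hs: "(h has_real_derivative vector_derivative h (at s)) (at s)"
        using smooth_on_vector_derivative(1)[OF open_ball e(2) s] by (simp add: has_real_derivative_iff_has_vector_derivative)
      have "((\<lambda>s. fst (\<tau> s)) has_vector_derivative (h s *\<^sub>R 0 + vector_derivative h (at s) *\<^sub>R fst p0) +
         (s *\<^sub>R 0 + 1 *\<^sub>R fst \<xi>0)) (at s)"
        unfolding \<tau>_def fst_conv
        by (intro has_vector_derivative_add has_vector_derivative_scaleR has_vector_derivative_const DERIV_ident hs)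
      then have "fst (\<tau>' s) = vector_derivative h (at s) *\<^sub>R fst p0 + fst \<xi>0"
        using bounded_linear.has_vector_derivative[OF bounded_linear_fst d\<tau>[OF s]] vector_derivative_unique_at by fastforce
      moreover have "vector_derivative h (at s) * lprod c R (fst p0) = 0" using Rp0 e(6) by auto
      ultimately show ?thesis using RN by (simp add: lprod.add_right lprod.scaleR_right)
    qed
  qed
  define X where "X q = \<Phi> (Y q)" for q
  have smY: "smooth_on S Y"
    unfolding Y_def by (intro smooth_intros S smooth_on_compose[OF sm\<tau>]) (auto simp: S_def)
  have Yamb': "Y q \<in> ambient c I" if "q \<in> S" for q using Yamb[of "snd q" "fst q"] that by (auto simp: S_def)
  have Xamb: "X q \<in> ambient c I" "\<Psi> (X q) = Y q" if "q \<in> S" for q using \<Psi>\<Phi>[OF Yamb'[OF that]] by (auto simp: X_def)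
  have smX: "smooth_on S X"
    unfolding X_def by (rule smooth_on_compose[OF W2(3) smY S(1) W2(1)]) (use Yamb' W2(2) in auto)
  define dX where "dX q = frechet_derivative X (at q)" for q
  have dX: "(X has_derivative dX q) (at q)" if "q \<in> S" for q
    unfolding dX_def by (rule smooth_on_has_derivative[OF smX that])
  have dXtan: "dX q v \<in> ambient_tangent c (X q)" if "q \<in> S" for q v
    by (rule derivative_in_ambient_tangent[OF dX[OF that] S(1) that Xamb(1)])
  have \<Psi>X: "frechet_derivative \<Psi> (at (X q)) (dX q v) = snd v *\<^sub>R \<tau>' (snd q) + (fst v *\<^sub>R R, 0)" if q: "q \<in> S" for q v
  proof -
    have "((\<lambda>q. \<Psi> (X q)) has_derivative (\<lambda>v. frechet_derivative \<Psi> (at (X q)) (dX q v))) (at q)"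
      by (rule has_derivative_compose[OF dX[OF q] d\<Psi>[OF Xamb(1)[OF q]]])
    then have "(Y has_derivative (\<lambda>v. frechet_derivative \<Psi> (at (X q)) (dX q v))) (at q)"
      by (rule has_derivative_transform_within_open[OF _ S(1) q]) (simp add: Xamb)
    from fun_cong[OF has_derivative_unique[OF this dY[OF q]], of v] show ?thesis .
  qed
  have snd0: "snd (dX q e1) = 0" if q: "q \<in> S" for q
  proof -
    have "\<epsilon> * snd (dX q e1) = 0"
      using snd_d\<Psi>[OF Xamb(1)[OF q] dXtan[OF q], of e1] \<Psi>X[OF q, of e1] by (simp add: e1_def)
    then show ?thesis using \<epsilon> by auto
  qed
  have metric: "lprod c (fst (dX q e1)) (fst (dX q e1)) = 0" "lprod c (fst (dX q e1)) (fst (dX q e2)) = 0" if q: "q \<in> S" for q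
  proof -
    have sq: "snd q \<in> ball 0 e" using q by (auto simp: S_def)
    have fX: "f (snd (X q)) \<noteq> 0" by (rule f_nonzero[OF Xamb(1)[OF q]])
    have "wmetric c f (X q) (dX q e1) (dX q e1) = 0"
      using isometry[OF Xamb(1)[OF q] dXtan[OF q, of e1] dXtan[OF q, of e1]] R(2)
      unfolding \<Psi>X[OF q] by (simp add: e1_def wmetric_def)
    then show "lprod c (fst (dX q e1)) (fst (dX q e1)) = 0" using snd0[OF q] fX by (simp add: wmetric_def)
    have "wmetric c f (X q) (dX q e1) (dX q e2) = 0"
      using isometry[OF Xamb(1)[OF q] dXtan[OF q, of e1] dXtan[OF q, of e2]] R\<tau>[OF sq]
      unfolding \<Psi>X[OF q] by (simp add: e1_def e2_def wmetric_def)
    then show "lprod c (fst (dX q e1)) (fst (dX q e2)) = 0" using snd0[OF q] fX by (simp add: wmetric_def)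
  qed
  define q0 where "q0 = (t0, 0::real)"
  have q0: "q0 \<in> S" using S(2) by (simp add: q0_def)
  define D where "D v w = second_derivative X q0 v w" for v w
  have dd: "((\<lambda>r. dX r w) has_derivative (\<lambda>v. D v w)) (at q0)" for w
    unfolding D_def second_derivative_def dX_def
    by (rule smooth_on_has_derivative[OF smooth_on_frechet_derivative[OF smX] q0])
  have prod: "lprod c (fst (dX q0 e1)) (fst (D v w)) + lprod c (fst (D v e1)) (fst (dX q0 w)) = 0"
    if "w = e1 \<or> w = e2" for v w
    by (rule derivative_of_constant[OF lprod.FDERIV[OF has_derivative_fst[OF dd] has_derivative_fst[OF dd]] S(1) q0])
       (use that metric in auto)
  have sym: "D e2 e1 = D e1 e2"
    unfolding D_def second_derivative_def by (rule mixed_derivatives_eq[OF S(1) smX q0])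
  have "lprod c (fst (dX q0 e1)) (fst (D e2 e1)) = 0"
    using prod[of e1 e2] lprod_commute[of c "fst (D e2 e1)" "fst (dX q0 e1)"] by simp
  then have key: "lprod c (fst (D e1 e1)) (fst (dX q0 e2)) = 0" using prod[of e2 e1] sym by simp
  have snd_D: "snd (D e1 e1) = 0"
    by (rule derivative_of_constant[OF has_derivative_snd[OF dd] S(1) q0]) (simp add: snd0)
  have Yq0: "Y q0 = p0" using e(3) by (simp add: Y_def q0_def \<tau>_def prod_eq_iff)
  have "dX q0 e2 = frechet_derivative \<Phi> (at p0) \<xi>0"
  proof -
    have "(X has_derivative (\<lambda>v. frechet_derivative \<Phi> (at (Y q0)) (snd v *\<^sub>R \<tau>' (snd q0) + (fst v *\<^sub>R R, 0)))) (at q0)"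
      unfolding X_def[abs_def] by (rule has_derivative_compose[OF dY[OF q0] d\<Phi>[OF Yamb'[OF q0]]])
    from fun_cong[OF has_derivative_unique[OF dX[OF q0] this], of e2]
    show ?thesis by (simp add: Yq0 e2_def \<tau>'0 zero_prod_def[symmetric]) (simp add: q0_def \<tau>'0)
  qed
  then have Xs: "dX q0 e2 = \<xi>" using \<xi>0(2) by simp
  have XZ: "X (t, 0) = Z t" for t
    using e(3) by (simp add: X_def Y_def \<tau>_def p0_def Z_def algebra_simps)
  have Z1: "vector_derivative Z (at t) = dX (t, 0) e1" for t
    using vector_derivative_at[OF partial_derivatives(1)[OF smX S(2)]] by (simp add: XZ dX_def e1_def)
  have "((\<lambda>t. dX (t, 0) e1) has_vector_derivative D e1 e1) (at t0)"
    using partial_derivatives(1)[OF smooth_on_frechet_derivative[OF smX, of e1] q0[unfolded q0_def]]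
    by (simp add: D_def second_derivative_def dX_def e1_def q0_def)
  then have Z2: "vector_derivative (\<lambda>t. vector_derivative Z (at t)) (at t0) = D e1 e1"
    unfolding Z1 by (rule vector_derivative_at)
  show "wmetric c f (Z t0) (vector_derivative (\<lambda>t. vector_derivative Z (at t)) (at t0)) \<xi> = 0"
    unfolding Z2 using key snd_D Xs by (simp add: wmetric_def)
qed

end

lemma congruence_inverse:
  assumes "c \<in> {-1, 0, 1}" "open I" "smooth_on I f" "\<forall>z\<in>I. 0 < f z" and cong: "congruence c f I \<Psi>"
  obtains \<Phi> W1 W2 \<epsilon> where "warped_congruence c f I \<Psi> \<Phi> W1 W2 \<epsilon>"
proof -
  obtain W1 W2 \<Phi> where W: "open W1" "ambient c I \<subseteq> W1" "smooth_on W1 \<Psi>"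
    "open W2" "ambient c I \<subseteq> W2" "smooth_on W2 \<Phi>" "\<forall>p\<in>ambient c I. \<Phi> (\<Psi> p) = p"
    using cong unfolding congruence_def ambient_isometry_def by blast
  obtain \<epsilon> where \<epsilon>: "\<epsilon> \<in> {-1, 1::real}" "\<forall>p\<in>ambient c I. frechet_derivative \<Psi> (at p) dz = \<epsilon> *\<^sub>R dz"
    using cong unfolding congruence_def by blast
  have ee: "\<epsilon> * \<epsilon> = 1" using \<epsilon>(1) by auto
  have "warped_space_form c f I" using assms by unfold_locales auto
  then have "warped_congruence c f I \<Psi> \<Phi> W1 W2 \<epsilon>"
    unfolding warped_congruence_def warped_congruence_axioms_def
    using W \<epsilon>(2) ee cong unfolding congruence_def ambient_isometry_def by blast
  then show ?thesis by (rule that)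
qed

text \<open>The level curves of the height through a point of any chart run in one of the null lines, pulled
  back by the congruence. Their acceleration, and hence the second derivative of the chart in the
  direction of \<open>T\<close>, is tangent to the surface.\<close>

lemma class_A_at_null_ruled:
  assumes c: "c \<in> {-1, 0, 1}" and I: "open I" "smooth_on I f" "\<forall>z\<in>I. 0 < f z"
    and surf: "timelike_surface c f I M x" and T: "T_lightlike c f M x"
    and N: "openin M N" "congruent_to_param c f I M x N D \<phi>" "null_ruled c D \<phi>"
    and lp0: "local_param M x D0 \<psi>0" and q: "q \<in> D0" "\<psi>0 q \<in> N"
    and \<xi>: "\<xi> \<in> normal_space c f (\<lambda>q. x (\<psi>0 q)) q"
  shows "\<exists>k. shape_op c f (\<lambda>q. x (\<psi>0 q)) q \<xi> (T_field c f (\<lambda>q. x (\<psi>0 q)) q) =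
    k *\<^sub>R T_field c f (\<lambda>q. x (\<psi>0 q)) q"
proof -
  let ?\<phi> = "\<lambda>q. x (\<psi>0 q)"
  have chart: "lightlike_chart c f I D0 ?\<phi>" by (rule lightlike_chart_local_param[OF c I surf T lp0])
  interpret lightlike_chart c f I D0 ?\<phi> by (rule chart)
  obtain \<psi> \<Psi> where \<psi>: "D \<subseteq> I \<times> UNIV" "\<psi> ` D = N" "congruence c f I \<Psi>" "\<And>y. y \<in> D \<Longrightarrow> \<Psi> (x (\<psi> y)) = \<phi> y"
    using N(2) unfolding congruent_to_param_def by blast
  obtain \<Phi> W1 W2 \<epsilon> where "warped_congruence c f I \<Psi> \<Phi> W1 W2 \<epsilon>"
    using congruence_inverse[OF c I \<psi>(3)] by blast
  then interpret \<Psi>: warped_congruence c f I \<Psi> \<Phi> W1 W2 \<epsilon> .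
  note lpD = local_paramD[OF lp0]
  \<comment> \<open>\<open>\<sigma>\<close> will be the level curve of the height through \<open>q\<close>, inside the part of the chart covered by \<open>N\<close>\<close>
  define G where "G = {r \<in> D0. \<psi>0 r \<in> N}"
  have G: "open G" "q \<in> G"
  proof -
    have "continuous_map (top_of_set D0) (subtopology M (\<psi>0 ` D0)) \<psi>0"
      using homeomorphic_imp_continuous_map[OF lpD(3)] .
    then have "continuous_map (top_of_set D0) M \<psi>0" by (simp add: continuous_map_in_subtopology)
    from openin_continuous_map_preimage[OF this N(1)] have "openin (top_of_set D0) G" by (simp add: G_def)
    then show "open G" using lpD(1) openin_open_eq by blast
    show "q \<in> G" using q by (simp add: G_def)
  qed
  define u1 where "u1 = snd (x (\<psi>0 q))"
  obtain t0 :: real and e \<kappa> where e: "e > 0" and lp1: "local_param M x (ball u1 e \<times> ball t0 e) (\<lambda>y. \<psi>0 (\<kappa> y))"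
    and sm\<kappa>: "smooth_on (ball u1 e \<times> ball t0 e) \<kappa>"
    and \<kappa>: "\<kappa> (u1, t0) = q" "\<And>y. y \<in> ball u1 e \<times> ball t0 e \<Longrightarrow>
      \<kappa> y \<in> D0 \<and> \<kappa> y \<in> G \<and> snd (x (\<psi>0 (\<kappa> y))) = fst y"
    by (rule adapted_local_param[OF chart lp0 q(1) G, folded u1_def]) (rule that)
  define J where "J = ball t0 e"
  define \<sigma> where "\<sigma> s = \<kappa> (u1, s)" for s
  have J: "open J" "t0 \<in> J" using e by (auto simp: J_def)
  have in_box: "(u1, s) \<in> ball u1 e \<times> ball t0 e" if "s \<in> J" for s using that e by (auto simp: J_def)
  have \<sigma>: "\<sigma> s \<in> D0" "\<psi>0 (\<sigma> s) \<in> N" "snd (x (\<psi>0 (\<sigma> s))) = u1" if "s \<in> J" for s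
    using \<kappa>(2)[OF in_box[OF that]] by (auto simp: \<sigma>_def G_def)
  have \<sigma>0: "\<sigma> t0 = q" by (simp add: \<sigma>_def \<kappa>(1))
  have sm\<sigma>: "smooth_on J \<sigma>"
    unfolding \<sigma>_def by (rule smooth_on_compose[OF sm\<kappa>]) (use J in_box in \<open>auto intro!: smooth_intros open_Times\<close>)
  define h where "h s = x (\<psi>0 (\<sigma> s))" for s
  have smh: "smooth_on J h"
    unfolding h_def by (rule smooth_on_compose[OF smooth_chart sm\<sigma> J(1) open_D]) (use \<sigma> in auto)
  define h' where "h' s = vector_derivative h (at s)" for s
  have dh: "(h has_vector_derivative h' s) (at s)" if "s \<in> J" for s
    unfolding h'_def by (rule smooth_on_vector_derivative(1)[OF J(1) smh that])
  have hamb: "h s \<in> ambient c I" if "s \<in> J" for s using chart_ambient[OF \<sigma>(1)[OF that]] by (simp add: h_def)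
  have h'tan: "h' s \<in> ambient_tangent c (h s)" if "s \<in> J" for s
    using derivative_in_ambient_tangent[OF dh[OF that, unfolded has_vector_derivative_def] J(1) that hamb, of 1] by simp
  have snd_h': "snd (h' s) = 0" if "s \<in> J" for s
  proof -
    have "((\<lambda>s. snd (h s)) has_vector_derivative 0) (at s)"
      by (rule has_vector_derivative_transform_within_open[OF has_vector_derivative_const J(1) that, of u1])
         (simp add: h_def \<sigma>)
    then show ?thesis
      using bounded_linear.has_vector_derivative[OF bounded_linear_snd dh[OF that]] vector_derivative_unique_at by blast
  qed
  have h'0: "h' t0 \<noteq> 0"
  proof -
    note l1 = local_paramD[OF lp1]
    note qq = in_box[OF J(2)]
    have "h' t0 = frechet_derivative (\<lambda>y. x (\<psi>0 (\<kappa> y))) (at (u1, t0)) (0, 1)"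
      unfolding h'_def h_def \<sigma>_def using vector_derivative_at[OF partial_derivatives(2)[OF l1(4) qq]] .
    moreover have "linear (frechet_derivative (\<lambda>y. x (\<psi>0 (\<kappa> y))) (at (u1, t0)))"
      using has_derivative_linear[OF smooth_on_has_derivative[OF l1(4) qq]] .
    then have "frechet_derivative (\<lambda>y. x (\<psi>0 (\<kappa> y))) (at (u1, t0)) (0, 1) \<noteq> 0"
      using linear_injective_0 l1(5)[OF qq] by (metis Pair_inject zero_neq_one zero_prod_def)
    ultimately show ?thesis by simp
  qed
  \<comment> \<open>\<open>\<Psi>\<close> changes the height only by a sign and a constant, so the image of \<open>\<sigma>\<close> stays in one ruling\<close>
  have const: "\<exists>u2. \<forall>s\<in>J. snd (\<Psi> (h s)) = u2"
    unfolding J_def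
  proof (rule has_field_derivative_zero_constant[OF convex_ball])
    fix s assume "s \<in> ball t0 e"
    then have s: "s \<in> J" by (simp add: J_def)
    have "((\<lambda>s. \<Psi> (h s)) has_derivative (\<lambda>r. frechet_derivative \<Psi> (at (h s)) (r *\<^sub>R h' s))) (at s)"
      using has_derivative_compose[OF dh[OF s, unfolded has_vector_derivative_def] \<Psi>.d\<Psi>[OF hamb[OF s]]] .
    from has_derivative_snd[OF this]
    have "((\<lambda>s. snd (\<Psi> (h s))) has_derivative (\<lambda>r. snd (frechet_derivative \<Psi> (at (h s)) (r *\<^sub>R h' s)))) (at s)" .
    moreover have "snd (frechet_derivative \<Psi> (at (h s)) (r *\<^sub>R h' s)) = 0" for r
      using \<Psi>.snd_d\<Psi>[OF hamb[OF s] subspace_scale[OF subspace_ambient_tangent h'tan[OF s]], of r] snd_h'[OF s] by simp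
    ultimately have "((\<lambda>s. snd (\<Psi> (h s))) has_real_derivative 0) (at s)"
      by (simp add: has_field_derivative_def lambda_zero[symmetric])
    then show "((\<lambda>s. snd (\<Psi> (h s))) has_real_derivative 0) (at s within ball t0 e)"
      by (rule has_field_derivative_at_within)
  qed
  then obtain u2 where u2: "\<And>s. s \<in> J \<Longrightarrow> snd (\<Psi> (h s)) = u2" by blast
  have \<Psi>h: "\<exists>y\<in>D. \<Psi> (h s) = \<phi> y" if "s \<in> J" for s
    using \<sigma>(2)[OF that] \<psi>(2,4) unfolding h_def by (metis imageE)
  have fst_param: "fst y \<in> fst ` D \<and> snd (\<phi> y) = fst y" if "y \<in> D" for y
    using N(3) that unfolding null_ruled_def by (metis imageI prod.collapse snd_conv)
  have "u2 \<in> fst ` D" using \<Psi>h[OF J(2)] u2[OF J(2)] fst_param by metis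
  then obtain P R where PR: "P \<in> space_form c" "R \<in> space_form_tangent c P" "lprod c R R = 0" "R \<noteq> 0"
    and ruling: "\<And>v. (u2, v) \<in> D \<Longrightarrow> \<exists>g. \<phi> (u2, v) = (P + g *\<^sub>R R, u2)"
    using N(3) unfolding null_ruled_def by blast
  have u2I: "u2 \<in> I" using \<open>u2 \<in> fst ` D\<close> \<psi>(1) by auto
  have in_line: "\<exists>g. \<Psi> (h s) = (P + g *\<^sub>R R, u2)" if s: "s \<in> J" for s
  proof -
    obtain y where y: "y \<in> D" "\<Psi> (h s) = \<phi> y" using \<Psi>h[OF s] by blast
    then have "y = (u2, snd y)" using fst_param[OF y(1)] u2[OF s] by (simp add: prod_eq_iff)
    then show ?thesis using ruling[of "snd y"] y by metis
  qed
  obtain i where i: "R $ i \<noteq> 0" using PR(4) by (auto simp: vec_eq_iff)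
  define g where "g s = (fst (\<Psi> (h s)) $ i - P $ i) / R $ i" for s
  have line: "\<Psi> (h s) = (P + g s *\<^sub>R R, u2)" if s: "s \<in> J" for s
    using in_line[OF s] i by (auto simp: g_def)
  have sm\<Psi>h: "smooth_on J (\<lambda>s. \<Psi> (h s))"
    by (rule smooth_on_compose[OF \<Psi>.W1(3) smh J(1) \<Psi>.W1(1)]) (use hamb \<Psi>.W1(2) in auto)
  have smg: "smooth_on J g" unfolding g_def by (intro smooth_intros J sm\<Psi>h) (use i in auto)
  define Z where "Z t = \<Phi> (P + t *\<^sub>R R, u2)" for t
  note image = \<Psi>.image_of_null_line[OF u2I PR(1-3), folded Z_def]
  have hZ: "h s = Z (g s)" if "s \<in> J" for s
    using \<Psi>.\<Phi>\<Psi>[OF hamb[OF that]] line[OF that] by (simp add: Z_def)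
  define Z' g' where "Z' t = vector_derivative Z (at t)" and "g' s = vector_derivative g (at s)" for t s :: real
  define Z'' g'' where "Z'' t = vector_derivative Z' (at t)" and "g'' s = vector_derivative g' (at s)" for t s :: real
  note vdZ = smooth_on_vector_derivative[OF open_UNIV image(1), folded Z'_def]
  note vdg = smooth_on_vector_derivative[OF J(1) smg, folded g'_def]
  note vdZ' = smooth_on_vector_derivative(1)[OF open_UNIV vdZ(2), folded Z''_def]
  note vdg' = smooth_on_vector_derivative(1)[OF J(1) vdg(2), folded g''_def]
  have h'Z: "h' s = g' s *\<^sub>R Z' (g s)" if "s \<in> J" for s
  proof -
    have "((\<lambda>s. Z (g s)) has_vector_derivative g' s *\<^sub>R Z' (g s)) (at s)"
      using vector_diff_chain_at[OF vdg(1)[OF that] vdZ(1)[OF UNIV_I]] by (simp add: o_def)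
    then have "(h has_vector_derivative g' s *\<^sub>R Z' (g s)) (at s)"
      by (rule has_vector_derivative_transform_within_open[OF _ J(1) that]) (simp add: hZ)
    then show ?thesis using dh[OF that] vector_derivative_unique_at by blast
  qed
  have "((\<lambda>s. g' s *\<^sub>R Z' (g s)) has_vector_derivative g' t0 *\<^sub>R (g' t0 *\<^sub>R Z'' (g t0)) + g'' t0 *\<^sub>R Z' (g t0)) (at t0)"
    using vector_diff_chain_at[OF vdg(1)[OF J(2)] vdZ'[OF UNIV_I]] vdg'[OF J(2)]
    by (intro has_vector_derivative_scaleR) (auto simp: o_def has_real_derivative_iff_has_vector_derivative)
  then have h'': "(h' has_vector_derivative g' t0 *\<^sub>R (g' t0 *\<^sub>R Z'' (g t0)) + g'' t0 *\<^sub>R Z' (g t0)) (at t0)"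
    by (rule has_vector_derivative_transform_within_open[OF _ J]) (simp add: h'Z)
  obtain \<sigma>1 \<sigma>2 where \<sigma>12: "(h has_vector_derivative d\<phi> q \<sigma>1) (at t0)"
    "(h' has_vector_derivative second_derivative ?\<phi> q \<sigma>1 \<sigma>1 + d\<phi> q \<sigma>2) (at t0)"
    using second_derivative_along_curve[OF open_D smooth_chart J(1) sm\<sigma> \<sigma>(1) J(2)]
    unfolding \<sigma>0 h'_def[abs_def] h_def[abs_def] by metis
  have d\<sigma>1: "d\<phi> q \<sigma>1 = h' t0" using \<sigma>12(1) dh[OF J(2)] vector_derivative_unique_at by blast
  have acc: "second_derivative ?\<phi> q \<sigma>1 \<sigma>1 + d\<phi> q \<sigma>2 = g' t0 *\<^sub>R (g' t0 *\<^sub>R Z'' (g t0)) + g'' t0 *\<^sub>R Z' (g t0)"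
    using \<sigma>12(2) h'' vector_derivative_unique_at by blast
  have g'0: "g' t0 \<noteq> 0" using h'Z[OF J(2)] h'0 by auto
  have hq: "Z (g t0) = ?\<phi> q" using hZ[OF J(2)] \<sigma>0 by (simp add: h_def)
  have tan_\<xi>: "wmetric c f (?\<phi> q) (d\<phi> q w) \<xi> = 0" for w
  proof -
    have "wmetric c f (?\<phi> q) \<xi> (d\<phi> q w) = 0"
      using \<xi> tangent_plane_mem[of q w] unfolding normal_space_def by blast
    then show ?thesis by (subst wmetric_commute)
  qed
  have Z'\<xi>: "wmetric c f (?\<phi> q) (Z' (g t0)) \<xi> = 0"
    using tan_\<xi>[of \<sigma>1] g'0 unfolding d\<sigma>1 h'Z[OF J(2)] by (simp add: wmetric.scaleR_left)
  have Z''\<xi>: "wmetric c f (?\<phi> q) (Z'' (g t0)) \<xi> = 0"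
    using image(3)[of \<xi> "g t0"] Z'\<xi> \<xi> hq by (simp add: normal_space_def Z''_def Z'_def[abs_def])
  have "wmetric c f (?\<phi> q) (second_derivative ?\<phi> q \<sigma>1 \<sigma>1 + d\<phi> q \<sigma>2) \<xi> = 0"
    unfolding acc by (simp add: wmetric.add_left wmetric.scaleR_left Z'\<xi> Z''\<xi>)
  then have zero: "wmetric c f (?\<phi> q) (second_derivative ?\<phi> q \<sigma>1 \<sigma>1) \<xi> = 0"
    by (simp add: wmetric.add_left tan_\<xi>)
  have "wmetric c f (?\<phi> q) (second_derivative ?\<phi> q w w) \<xi> = 0" if w: "snd (d\<phi> q w) = 0" for w
  proof -
    obtain k where k: "d\<phi> q w = k *\<^sub>R T_field c f ?\<phi> q"
      using horizontal_iff_parallel_T[OF q(1) tangent_plane_mem] w by blast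
    obtain k1 where k1: "d\<phi> q \<sigma>1 = k1 *\<^sub>R T_field c f ?\<phi> q"
      using horizontal_iff_parallel_T[OF q(1) tangent_plane_mem] snd_h'[OF J(2)] d\<sigma>1 by metis
    have "k1 \<noteq> 0" using k1 h'0 d\<sigma>1 by auto
    then have "d\<phi> q w = d\<phi> q ((k / k1) *\<^sub>R \<sigma>1)" using k k1 by (simp add: linear_cmul[OF linear_d\<phi>[OF q(1)]])
    then have "w = (k / k1) *\<^sub>R \<sigma>1" using chart_inj[OF q(1)] by (simp add: inj_eq)
    then show ?thesis
      using zero by (simp add: linear_cmul[OF linear_second_derivative(1)[OF q(1)]]
        linear_cmul[OF linear_second_derivative(2)[OF q(1)]] wmetric.scaleR_left)
  qed
  then show ?thesis using shape_op_T_eigenvector_iff[OF q(1) \<xi>] by blast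
qed

section \<open>The classification\<close>

theorem theorem4p3:
  fixes c z0 :: real and f :: "real \<Rightarrow> real" and I :: "real set"
    and M :: "'m topology" and x :: "'m \<Rightarrow> point"
  assumes "c \<in> {-1, 0, 1}"
    and "open I" "is_interval I" "z0 \<in> I"
    and "smooth_on I f" "\<forall>z\<in>I. 0 < f z"
    and "timelike_surface c f I M x"
    and "standing_assumptions c f I M x"
    and "T_lightlike c f M x"
  shows "class_A c f M x \<longleftrightarrow>
    (\<forall>p\<in>topspace M. \<exists>N D \<phi>. openin M N \<and> p \<in> N \<and> congruent_to_param c f I M x N D \<phi> \<and>
       (family_i c f D \<phi> \<or> family_ii c f D \<phi> \<or> family_iii c f D \<phi> \<or>
        family_iv c f z0 D \<phi> \<or> family_v c f D \<phi>))"
proof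
  assume "class_A c f M x"
  then show "\<forall>p\<in>topspace M. \<exists>N D \<phi>. openin M N \<and> p \<in> N \<and> congruent_to_param c f I M x N D \<phi> \<and>
       (family_i c f D \<phi> \<or> family_ii c f D \<phi> \<or> family_iii c f D \<phi> \<or>
        family_iv c f z0 D \<phi> \<or> family_v c f D \<phi>)"
    using class_A_imp_family_i[OF assms(1,2,5,6,7,9)] by meson
next
  assume families: "\<forall>p\<in>topspace M. \<exists>N D \<phi>. openin M N \<and> p \<in> N \<and> congruent_to_param c f I M x N D \<phi> \<and>
       (family_i c f D \<phi> \<or> family_ii c f D \<phi> \<or> family_iii c f D \<phi> \<or>
        family_iv c f z0 D \<phi> \<or> family_v c f D \<phi>)"
  show "class_A c f M x"
    unfolding class_A_def o_def
  proof (intro allI impI ballI conjI)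
    fix D0 \<psi>0 q assume lp0: "local_param M x D0 \<psi>0" and q: "q \<in> (D0 :: (real \<times> real) set)"
    show "T_field c f (\<lambda>q. x (\<psi>0 q)) q \<noteq> 0"
      using assms(9) lp0 q unfolding T_lightlike_def o_def by blast
    fix \<xi> assume \<xi>: "\<xi> \<in> normal_space c f (\<lambda>q. x (\<psi>0 q)) q"
    obtain N D \<phi> where N: "openin M N" "\<psi>0 q \<in> N" "congruent_to_param c f I M x N D \<phi>"
      "family_i c f D \<phi> \<or> family_ii c f D \<phi> \<or> family_iii c f D \<phi> \<or> family_iv c f z0 D \<phi> \<or> family_v c f D \<phi>"
      using families local_paramD(6)[OF lp0 q] by meson
    have "null_ruled c D \<phi>"
      using N(4) by (elim disjE) (rule family_i_null_ruled family_ii_null_ruled family_iii_null_ruled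
        family_iv_null_ruled family_v_null_ruled; assumption)+
    then show "\<exists>k. shape_op c f (\<lambda>q. x (\<psi>0 q)) q \<xi> (T_field c f (\<lambda>q. x (\<psi>0 q)) q) =
        k *\<^sub>R T_field c f (\<lambda>q. x (\<psi>0 q)) q"
      using class_A_at_null_ruled[OF assms(1,2,5,6,7,9) N(1,3) _ lp0 q N(2) \<xi>] by blast
  qed
qed

end
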